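(* For all $\gamma > 0$ and $0 < \beta < 1$, there exists a dimension-independent $\varepsilon_{\gamma,\beta} > 0$ such that testing whether a $d$-dimensional state has rank at most $\beta d$ or is $\varepsilon_{\gamma,\beta}$-far in trace distance from all such states requires $\Omega(d^{2-\gamma})$ copies of the state. That is, there exist $\varepsilon_{\gamma,\beta}>0$, $c_{\gamma,\beta}>0$ and $d_{\gamma,\beta}$ such that for all $d\ge d_{\gamma,\beta}$, any such tester using $n$ copies satisfies $n\ge c_{\gamma,\beta}\,d^{2-\gamma}$.
   Context: A $d$-dimensional state is a positive semidefinite matrix $\rho\in\mathbb C^{d\times d}$ with $\mathrm{Tr}\,\rho=1$. Trace distance is $\frac12\|\rho-\sigma\|_1$ (Schatten 1-norm). A tester using $n$ copies is an arbitrary two-outcome quantum measurement on $(\mathbb C^d)^{\otimes n}$ applied to $\rho^{\otimes n}$. It must, with probability at least $2/3$, accept if $\mathrm{rank}(\rho)\le\beta d$, and, with probability at least $2/3$, reject if $\frac12\|\rho-\sigma\|_1\ge\varepsilon_{\gamma,\beta}$ for every $d$-dimensional state $\sigma$ with $\mathrm{rank}(\sigma)\le\beta d$ (two-sided error). *)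

theory Defs
  imports
    "Jordan_Normal_Form.Schur_Decomposition"
    "Jordan_Normal_Form.DL_Rank"
begin

definition mat_trace :: "'a::comm_monoid_add mat \<Rightarrow> 'a" where
  "mat_trace A = (\<Sum>i<dim_row A. A $$ (i, i))"

text \<open>The order on \<^typ>\<open>complex\<close> is the one of HOL-Library.Complex_Order: \<open>0 \<le> z\<close> means that \<open>z\<close> is real
  and nonnegative. The scalar \<open>(A *\<^sub>v v) \<bullet>c v\<close> is \<open>v\<^sup>* A v\<close>.\<close>

definition psd_mat :: "nat \<Rightarrow> complex mat \<Rightarrow> bool" where
  "psd_mat d A \<longleftrightarrow> A \<in> carrier_mat d d \<and> mat_adjoint A = A \<and>
     (\<forall>v \<in> carrier_vec d. 0 \<le> (A *\<^sub>v v) \<bullet>c v)"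

definition quantum_state :: "nat \<Rightarrow> complex mat \<Rightarrow> bool" where
  "quantum_state d \<rho> \<longleftrightarrow> psd_mat d \<rho> \<and> mat_trace \<rho> = 1"

text \<open>The Schatten 1-norm: the sum of the singular values of \<open>A\<close>, that is, of the square roots of
  the eigenvalues of \<open>A\<^sup>* A\<close> counted with multiplicity.\<close>

definition schatten1_norm :: "complex mat \<Rightarrow> real" where
  "schatten1_norm A = (\<Sum>x \<in># proots (char_poly (mat_adjoint A * A)). sqrt (Re x))"

definition trace_distance :: "complex mat \<Rightarrow> complex mat \<Rightarrow> real" where
  "trace_distance \<rho> \<sigma> = schatten1_norm (\<rho> - \<sigma>) / 2"

text \<open>Kronecker product; \<open>(\<complex>\<^sup>d)\<close> tensored \<open>n\<close> times is identified with the space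
  of complex vectors of length \<open>d ^ n\<close> via the lexicographically ordered product basis.\<close>

definition kronecker :: "'a::times mat \<Rightarrow> 'a mat \<Rightarrow> 'a mat" where
  "kronecker A B = mat (dim_row A * dim_row B) (dim_col A * dim_col B)
     (\<lambda>(i, j). A $$ (i div dim_row B, j div dim_col B) * B $$ (i mod dim_row B, j mod dim_col B))"

primrec tensor_power :: "'a::semiring_1 mat \<Rightarrow> nat \<Rightarrow> 'a mat" where
  "tensor_power A 0 = 1\<^sub>m 1"
| "tensor_power A (Suc n) = kronecker A (tensor_power A n)"

lemma tensor_power_carrier:
  "A \<in> carrier_mat d d \<Longrightarrow> tensor_power A n \<in> carrier_mat (d ^ n) (d ^ n)"
  by (induction n) (auto simp: kronecker_def)

text \<open>A two-outcome measurement (POVM) on \<open>\<complex>\<^sup>N\<close>; by the Born rule the outcome with effect \<open>M\<close> occurs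
  on the state \<open>\<rho>\<close> with probability \<open>Tr (M \<rho>)\<close>, which is real.\<close>

definition two_outcome_measurement :: "nat \<Rightarrow> complex mat \<Rightarrow> complex mat \<Rightarrow> bool" where
  "two_outcome_measurement N M\<^sub>1 M\<^sub>2 \<longleftrightarrow> psd_mat N M\<^sub>1 \<and> psd_mat N M\<^sub>2 \<and> M\<^sub>1 + M\<^sub>2 = 1\<^sub>m N"

definition outcome_prob :: "complex mat \<Rightarrow> complex mat \<Rightarrow> real" where
  "outcome_prob M \<rho> = Re (mat_trace (M * \<rho>))"

definition low_rank_state :: "nat \<Rightarrow> real \<Rightarrow> complex mat \<Rightarrow> bool" where
  "low_rank_state d \<beta> \<rho> \<longleftrightarrow> quantum_state d \<rho> \<and> real (vec_space.rank d \<rho>) \<le> \<beta> * real d"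

definition far_from_low_rank :: "nat \<Rightarrow> real \<Rightarrow> real \<Rightarrow> complex mat \<Rightarrow> bool" where
  "far_from_low_rank d \<beta> \<epsilon> \<rho> \<longleftrightarrow> quantum_state d \<rho> \<and>
     (\<forall>\<sigma>. low_rank_state d \<beta> \<sigma> \<longrightarrow> trace_distance \<rho> \<sigma> \<ge> \<epsilon>)"

definition rank_tester ::
    "nat \<Rightarrow> nat \<Rightarrow> real \<Rightarrow> real \<Rightarrow> complex mat \<Rightarrow> complex mat \<Rightarrow> bool" where
  "rank_tester d n \<beta> \<epsilon> M_acc M_rej \<longleftrightarrow>
     two_outcome_measurement (d ^ n) M_acc M_rej \<and>
     (\<forall>\<rho>. low_rank_state d \<beta> \<rho> \<longrightarrow> outcome_prob M_acc (tensor_power \<rho> n) \<ge> 2/3) \<and>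
     (\<forall>\<rho>. far_from_low_rank d \<beta> \<epsilon> \<rho> \<longrightarrow> outcome_prob M_rej (tensor_power \<rho> n) \<ge> 2/3)"

end

theory Submission
  imports Defs "HOL-Library.FuncSet" "HOL-Analysis.L2_Norm"
begin

text \<open>
  Fix \<open>k \<ge> 2/\<gamma>\<close> and two finite multisets of nonnegative reals of the same size and mean \<open>1\<close> with equal
  power sums up to order \<open>k\<close>: one consists almost entirely of zeros, the other is strictly positive.
  A diagonal state is built from a flat reservoir of eigenvalues \<open>1/d\<close> and about \<open>d/s\<close> blocks of
  size \<open>s\<close>, each carrying (divided by \<open>d\<close>) one of the two multisets. With zeros in all blocks the state
  has rank at most \<open>\<beta>d\<close>; with positive blocks it is far from every such state.

  By convexity and unitary invariance of the testing problem, the tester may be assumed to be almost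
  invariant under conjugation by \<open>U\<^sup>\<otimes>\<^sup>n\<close>. Hence exchanging a single block can be analysed
  after moving its eigenvectors into random directions of the space spanned by the block and the
  reservoir, on which the state is a rank-\<open>s\<close> perturbation of \<open>1/d\<close> times the identity.
  Weighted by the inverse of the unperturbed state, the squared norm of the difference of the two averaged
  \<open>n\<close>-copy states is a signed mean of \<open>(1 + Y)\<^sup>n\<close>, where \<open>Y\<close> is a rescaled inner product of two
  independent perturbations, of typical size \<open>1/d\<^sup>2\<close>. All
  terms of order below \<open>k\<close> cancel because of the equal power sums, which leaves \<open>(C n/d\<^sup>2)\<^sup>k\<close>.
  Summing the square roots over the blocks gives \<open>d (C n/d\<^sup>2)\<^sup>k\<^sup>/\<^sup>2\<close>, which is small unless
  \<open>n\<close> is at least of order \<open>d\<close> to the power \<open>2 - \<gamma>\<close>.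
\<close>

subsection \<open>Moments of sign sums and symmetric functions\<close>

text \<open>Blocks are exchanged one at a time so that each comparison concerns a perturbation of
  bounded rank \<open>s\<close> around a reference that is exactly flat where the perturbation
  lives. In the reference the exchanged block carries the constant value 1; the other blocks may
  contain zeros, but the perturbation vanishes there, so inverse weights do no harm. The price is a
  triangle inequality over up to d/s steps, each contributing the square root of y^k with y of order
  n/d^2. Below the threshold y is at most of order d^(-\<gamma>), so k\<gamma> \<ge> 2 is just what
  makes the total bounded. The reservoir has two opposed duties: it must fit into the rank budget
  \<beta>d, yet have length linear in d, since the overlap of two random directions in a space of
  dimension L has size 1/sqrt L. No Haar measure is used. Random directions are flat vectors with
  random signs, reached by explicit reflections, and invariance of the tester is only approximate
  and only for the finitely many spectra that occur. Permutations of the values inside a block are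
  averaged as well, because equal power sums control only symmetric functions of the values.\<close>

lemma sum_PiE_insert:
  assumes "finite D" "x \<notin> D"
  shows "(\<Sum>e\<in>Pi\<^sub>E (insert x D) T. F e) = (\<Sum>v\<in>T x. \<Sum>e\<in>Pi\<^sub>E D T. F (e(x := v)))"
proof -
  have inj: "inj_on (\<lambda>(v, e). e(x := v)) (T x \<times> Pi\<^sub>E D T)"
    by (rule inj_combinator[OF assms(2)])
  have "(\<Sum>e\<in>Pi\<^sub>E (insert x D) T. F e) = (\<Sum>p\<in>T x \<times> Pi\<^sub>E D T. F ((snd p)(x := fst p)))"
    unfolding PiE_insert_eq sum.reindex[OF inj] by (simp add: case_prod_beta)
  also have "\<dots> = (\<Sum>v\<in>T x. \<Sum>e\<in>Pi\<^sub>E D T. F (e(x := v)))"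
    by (simp add: sum.cartesian_product case_prod_beta)
  finally show ?thesis .
qed

text \<open>The double factorial (2m-1)!!, the 2m-th moment of a standard Gaussian.\<close>

definition odd_fact :: "nat \<Rightarrow> real" where
  "odd_fact m = fact (2 * m) / (2 ^ m * fact m)"

text \<open>The central binomial coefficient is at most 4^m. The \<open>fact m\<close> on the right
  is what later cancels against the factorial in \<open>n choose m\<close>.\<close>

lemma odd_fact_le: "odd_fact m \<le> 2 ^ m * fact m"
proof -
  have "fact (2 * m) = fact m * fact m * real (2 * m choose m)"
    by (subst binomial_fact) (auto simp: mult_2)
  moreover have "real (2 * m choose m) \<le> 2 ^ (2 * m)"
    by (metis binomial_le_pow2 of_nat_le_iff of_nat_numeral of_nat_power)
  ultimately have "fact (2 * m) \<le> fact m * fact m * (2::real) ^ (2 * m)"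
    by (simp add: mult_left_mono)
  then show ?thesis
    by (simp add: odd_fact_def field_simps power_mult power2_eq_square flip: power_mult_distrib)
qed

lemma two_pow_fact_le: "2 ^ m * fact m \<le> (fact (2 * m) :: real)"
proof (induction m)
  case (Suc m)
  have "2 ^ Suc m * fact (Suc m) = (2 * real (Suc m)) * (2 ^ m * fact m)"
    by simp
  also have "\<dots> \<le> (2 * real (Suc m)) * fact (2 * m)"
    by (rule mult_left_mono[OF Suc]) simp
  also have "\<dots> \<le> (2 * real (Suc m)) * (real (2 * m + 1) * fact (2 * m))"
    by (intro mult_left_mono) auto
  also have "\<dots> = fact (2 * Suc m)"
    by (simp add: algebra_simps)
  finally show ?case .
qed simp

text \<open>Cancelling factorials leaves \<open>2 ^ i * fact i \<le> fact (2 * i)\<close> with i = m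
  - j. The inequality converts the even binomial coefficients, which appear when one sign is summed
  out, into the coefficients of an m-th power of a sum of two squares.\<close>

lemma choose_even_odd_fact:
  assumes "j \<le> m"
  shows "real ((2 * m) choose (2 * j)) * odd_fact j \<le> odd_fact m * real (m choose j)"
proof -
  obtain i where m: "m = j + i" using assms le_Suc_ex by blast
  have a: "real ((2 * m) choose (2 * j)) = fact (2 * m) / (fact (2 * j) * fact (2 * i))"
    by (subst binomial_fact) (auto simp: m)
  have b: "real (m choose j) = fact m / (fact j * fact i)"
    by (subst binomial_fact) (auto simp: m)
  have "real ((2 * m) choose (2 * j)) * odd_fact j = fact (2 * m) / (2 ^ j * fact j) * (1 / fact (2 * i))"
    unfolding a odd_fact_def by (simp add: field_simps)
  also have "\<dots> \<le> fact (2 * m) / (2 ^ j * fact j) * (1 / (2 ^ i * fact i))"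
    using two_pow_fact_le[of i] by (intro mult_left_mono divide_left_mono) auto
  also have "\<dots> = odd_fact m * real (m choose j)"
    unfolding b odd_fact_def by (simp add: m field_simps power_add)
  finally show ?thesis .
qed

lemma sum_even_odd_split:
  fixes f :: "nat \<Rightarrow> 'a::comm_monoid_add"
  shows "(\<Sum>j\<le>2*m. f j) = (\<Sum>j\<le>m. f (2*j)) + (\<Sum>j<m. f (2*j+1))"
  by (induction m) (auto simp: algebra_simps)

lemma sym_binomial_even:
  fixes S y :: real
  shows "(y + S)^(2*m) + (-y + S)^(2*m) = 2 * (\<Sum>j\<le>m. real ((2*m) choose (2*j)) * S^(2*j) * (y^2)^(m-j))"
proof -
  have c: "(S + y)^(2*m) = (\<Sum>j\<le>2*m. real ((2*m) choose j) * S^j * y^(2*m-j))" for y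
    by (simp add: binomial_ring)
  have "(S + y)^(2*m) + (S + -y)^(2*m) = (\<Sum>j\<le>2*m. real ((2*m) choose j) * S^j * (y^(2*m-j) + (-y)^(2*m-j)))"
    unfolding c by (simp add: sum.distrib algebra_simps)
  also have "\<dots> = (\<Sum>j\<le>m. real ((2*m) choose (2*j)) * S^(2*j) * (y^(2*m-2*j) + (-y)^(2*m-2*j)))
     + (\<Sum>j<m. real ((2*m) choose (2*j+1)) * S^(2*j+1) * (y^(2*m-(2*j+1)) + (-y)^(2*m-(2*j+1))))"
    by (rule sum_even_odd_split)
  also have "(\<Sum>j<m. real ((2*m) choose (2*j+1)) * S^(2*j+1) * (y^(2*m-(2*j+1)) + (-y)^(2*m-(2*j+1)))) = 0"
    by (intro sum.neutral ballI) (simp add: power_minus_odd)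
  also have "(\<Sum>j\<le>m. real ((2*m) choose (2*j)) * S^(2*j) * (y^(2*m-2*j) + (-y)^(2*m-2*j)))
     = (\<Sum>j\<le>m. real ((2*m) choose (2*j)) * S^(2*j) * (2 * (y^2)^(m-j)))"
    by (intro sum.cong refl) (simp add: power_mult[symmetric] right_diff_distrib')
  finally show ?thesis
    by (simp add: sum_distrib_left algebra_simps)
qed

text \<open>Khintchine's inequality with the Gaussian constant, left unnormalised. Summing over the
  sign of one more coordinate kills the odd powers; the even ones reassemble into the binomial
  expansion of the enlarged sum of squares.\<close>

lemma Rademacher_even_moment:
  fixes y :: "'a \<Rightarrow> real"
  assumes "finite D"
  shows "(\<Sum>e\<in>Pi\<^sub>E D (\<lambda>_. {-1, 1}). (\<Sum>x\<in>D. e x * y x) ^ (2 * m))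
           \<le> 2 ^ card D * (odd_fact m * (\<Sum>x\<in>D. (y x)\<^sup>2) ^ m)"
  using assms
proof (induction D arbitrary: m rule: finite_induct)
  case empty
  show ?case by (cases m) (auto simp: odd_fact_def)
next
  case (insert z D)
  let ?E = "Pi\<^sub>E D (\<lambda>_. {-1, 1::real})"
  let ?S = "\<lambda>e. \<Sum>x\<in>D. e x * y x"
  let ?V = "\<Sum>x\<in>D. (y x)\<^sup>2"
  have upd: "(\<Sum>x\<in>D. (e(z := v)) x * y x) = ?S e" for e v
    using insert.hyps by (intro sum.cong) auto
  have "(\<Sum>e\<in>Pi\<^sub>E (insert z D) (\<lambda>_. {-1, 1}). (\<Sum>x\<in>insert z D. e x * y x) ^ (2 * m))
     = (\<Sum>e\<in>?E. (y z + ?S e) ^ (2*m) + (- y z + ?S e) ^ (2*m))"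
    using insert.hyps by (simp add: sum_PiE_insert upd sum.distrib add.commute del: fun_upd_apply) (simp add: add.commute)
  also have "\<dots> = 2 * (\<Sum>j\<le>m. real ((2*m) choose (2*j)) * (\<Sum>e\<in>?E. ?S e ^ (2*j)) * ((y z)^2)^(m-j))"
    unfolding sym_binomial_even
    by (subst sum_distrib_left[symmetric], subst sum.swap) (simp add: sum_distrib_left sum_distrib_right)
  also have "\<dots> \<le> 2 * (\<Sum>j\<le>m. real ((2*m) choose (2*j)) * (2 ^ card D * (odd_fact j * ?V ^ j)) * ((y z)^2)^(m-j))"
    by (intro mult_left_mono sum_mono mult_right_mono insert.IH) auto
  also have "\<dots> = 2 * 2 ^ card D * (\<Sum>j\<le>m. (real ((2*m) choose (2*j)) * odd_fact j) * (?V ^ j * ((y z)^2)^(m-j)))"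
    by (simp add: sum_distrib_left algebra_simps)
  also have "\<dots> \<le> 2 * 2 ^ card D * (\<Sum>j\<le>m. (odd_fact m * real (m choose j)) * (?V ^ j * ((y z)^2)^(m-j)))"
    by (intro mult_left_mono sum_mono mult_right_mono choose_even_odd_fact mult_nonneg_nonneg)
      (simp_all add: sum_nonneg zero_le_power)
  also have "\<dots> = 2 * 2 ^ card D * (odd_fact m * (?V + (y z)^2) ^ m)"
    unfolding binomial_ring by (simp add: sum_distrib_left algebra_simps)
  also have "\<dots> = 2 ^ card (insert z D) * (odd_fact m * (\<Sum>x\<in>insert z D. (y x)\<^sup>2) ^ m)"
    using insert.hyps by (simp add: add.commute)
  finally show ?case .
qed

text \<open>Extensional functions, so that the set is finite and can be summed over. For finite
  \<open>I = S\<close> these are the permutations of \<open>S\<close>.\<close>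

definition injections :: "'i set \<Rightarrow> 'j set \<Rightarrow> ('i \<Rightarrow> 'j) set" where
  "injections I S = {f \<in> Pi\<^sub>E I (\<lambda>_. S). inj_on f I}"

lemma finite_injections: "finite I \<Longrightarrow> finite S \<Longrightarrow> finite (injections I S)"
  unfolding injections_def by (rule finite_subset[of _ "Pi\<^sub>E I (\<lambda>_. S)"]) (auto intro: finite_PiE)

lemma sum_injections_insert:
  assumes "finite I" "finite S" "x \<notin> I"
  shows "(\<Sum>f\<in>injections (insert x I) S. F f) = (\<Sum>f\<in>injections I S. \<Sum>v\<in>S - f ` I. F (f(x := v)))"
proof -
  have eq: "injections (insert x I) S = (\<lambda>(f, v). f(x := v)) ` (SIGMA f:injections I S. S - f ` I)" (is "?L = ?R")
  proof (intro equalityI subsetI)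
    fix g assume g: "g \<in> ?L"
    then have "g(x := undefined) \<in> injections I S"
      using assms(3) fun_upd_in_PiE[of x I g "\<lambda>_. S"]
      by (auto simp: injections_def inj_on_def)
    moreover have "g x \<in> S - (g(x := undefined)) ` I"
      using g assms(3) by (auto simp: injections_def inj_on_def)
    ultimately show "g \<in> ?R"
      by (intro image_eqI[of _ _ "(g(x := undefined), g x)"]) auto
  next
    fix g assume "g \<in> ?R"
    then obtain f v where "f \<in> injections I S" "v \<in> S - f ` I" "g = f(x := v)" by auto
    then show "g \<in> ?L" using assms(3)
      by (auto simp: injections_def inj_on_def PiE_iff extensional_def)
  qed
  have inj: "inj_on (\<lambda>(f, v). f(x := v)) (SIGMA f:injections I S. S - f ` I)"
  proof (rule inj_onI, clarify)
    fix f v f' v' assume h: "f \<in> injections I S" "f' \<in> injections I S" "f(x := v) = f'(x := v')"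
    have "f y = f' y" for y
    proof (cases "y = x")
      case True
      then show ?thesis using h assms(3) by (auto simp: injections_def PiE_iff extensional_def)
    next
      case False
      then show ?thesis using fun_cong[OF h(3), of y] by simp
    qed
    then show "f = f' \<and> v = v'" using fun_cong[OF h(3), of x] by auto
  qed
  show ?thesis
    unfolding eq sum.reindex[OF inj]
    using assms by (subst sum.Sigma) (auto simp: finite_injections case_prod_beta)
qed

text \<open>Up to constants these are monomial symmetric functions, hence polynomials in the power
  sums. For a new index, let its value range over all of \<open>S\<close> and subtract the
  collisions: a collision with j merges the new exponent into \<open>r j\<close>. The total degree
  is preserved, so only power sums of order below k ever enter.\<close>

lemma sum_injections_power_sums:
  fixes a b :: "'j \<Rightarrow> 'a::comm_ring_1"
  assumes "finite S" "finite I"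
    and "\<And>m. m < k \<Longrightarrow> (\<Sum>x\<in>S. a x ^ m) = (\<Sum>x\<in>S. b x ^ m)"
    and "(\<Sum>i\<in>I. r i) < k"
  shows "(\<Sum>f\<in>injections I S. \<Prod>i\<in>I. a (f i) ^ r i) = (\<Sum>f\<in>injections I S. \<Prod>i\<in>I. b (f i) ^ r i)"
  using assms(2,4)
proof (induction I arbitrary: r rule: finite_induct)
  case empty
  show ?case by simp
next
  case (insert z I)
  have step: "(\<Sum>f\<in>injections (insert z I) S. \<Prod>i\<in>insert z I. c (f i) ^ r i)
      = (\<Sum>f\<in>injections I S. \<Prod>i\<in>I. c (f i) ^ r i) * (\<Sum>x\<in>S. c x ^ r z)
        - (\<Sum>j\<in>I. \<Sum>f\<in>injections I S. \<Prod>i\<in>I. c (f i) ^ ((r(j := r j + r z)) i))" for c :: "'j \<Rightarrow> 'a"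
  proof -
    have upd: "(\<Prod>i\<in>I. c ((f(z := v)) i) ^ r i) = (\<Prod>i\<in>I. c (f i) ^ r i)" for f v
      using insert.hyps by (intro prod.cong) auto
    have "(\<Sum>f\<in>injections (insert z I) S. \<Prod>i\<in>insert z I. c (f i) ^ r i)
      = (\<Sum>f\<in>injections I S. \<Sum>v\<in>S - f ` I. c v ^ r z * (\<Prod>i\<in>I. c (f i) ^ r i))"
      using insert.hyps assms(1) by (simp add: sum_injections_insert upd del: fun_upd_apply) simp
    also have "\<dots> = (\<Sum>f\<in>injections I S. ((\<Sum>x\<in>S. c x ^ r z) - (\<Sum>j\<in>I. c (f j) ^ r z)) * (\<Prod>i\<in>I. c (f i) ^ r i))"
    proof (intro sum.cong refl)
      fix f assume f: "f \<in> injections I S"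
      then have "(\<Sum>v\<in>S - f ` I. c v ^ r z) = (\<Sum>x\<in>S. c x ^ r z) - (\<Sum>v\<in>f ` I. c v ^ r z)"
        using assms(1) by (intro sum_diff) (auto simp: injections_def)
      also have "(\<Sum>v\<in>f ` I. c v ^ r z) = (\<Sum>j\<in>I. c (f j) ^ r z)"
        using f by (subst sum.reindex) (auto simp: injections_def)
      finally show "(\<Sum>v\<in>S - f ` I. c v ^ r z * (\<Prod>i\<in>I. c (f i) ^ r i))
          = ((\<Sum>x\<in>S. c x ^ r z) - (\<Sum>j\<in>I. c (f j) ^ r z)) * (\<Prod>i\<in>I. c (f i) ^ r i)"
        by (simp flip: sum_distrib_right)
    qed
    also have "\<dots> = (\<Sum>f\<in>injections I S. (\<Sum>x\<in>S. c x ^ r z) * (\<Prod>i\<in>I. c (f i) ^ r i)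
        - (\<Sum>j\<in>I. c (f j) ^ r z * (\<Prod>i\<in>I. c (f i) ^ r i)))"
      by (simp only: left_diff_distrib sum_distrib_right)
    also have "\<dots> = (\<Sum>x\<in>S. c x ^ r z) * (\<Sum>f\<in>injections I S. \<Prod>i\<in>I. c (f i) ^ r i)
        - (\<Sum>j\<in>I. \<Sum>f\<in>injections I S. c (f j) ^ r z * (\<Prod>i\<in>I. c (f i) ^ r i))"
      unfolding sum_subtractf sum_distrib_left[symmetric] by (subst (2) sum.swap) simp
    also have "(\<Sum>j\<in>I. \<Sum>f\<in>injections I S. c (f j) ^ r z * (\<Prod>i\<in>I. c (f i) ^ r i))
       = (\<Sum>j\<in>I. \<Sum>f\<in>injections I S. \<Prod>i\<in>I. c (f i) ^ ((r(j := r j + r z)) i))"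
    proof (intro sum.cong refl)
      fix j f assume j: "j \<in> I"
      have "(\<Prod>i\<in>I - {j}. c (f i) ^ r i) = (\<Prod>i\<in>I - {j}. c (f i) ^ ((r(j := r j + r z)) i))"
        by (intro prod.cong) auto
      then show "c (f j) ^ r z * (\<Prod>i\<in>I. c (f i) ^ r i) = (\<Prod>i\<in>I. c (f i) ^ ((r(j := r j + r z)) i))"
        using insert.hyps j by (simp add: prod.remove[of I j] power_add)
    qed
    finally show ?thesis by (simp only: mult.commute)
  qed
  have sumr: "(\<Sum>i\<in>I. (r(j := r j + r z)) i) < k" if "j \<in> I" for j
  proof -
    have "(\<Sum>i\<in>I. (r(j := r j + r z)) i) = r j + r z + (\<Sum>i\<in>I - {j}. (r(j := r j + r z)) i)"
      using insert.hyps that by (simp add: sum.remove[of I j])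
    also have "(\<Sum>i\<in>I - {j}. (r(j := r j + r z)) i) = (\<Sum>i\<in>I - {j}. r i)"
      by (intro sum.cong) auto
    also have "r j + r z + (\<Sum>i\<in>I - {j}. r i) = (\<Sum>i\<in>insert z I. r i)"
      using insert.hyps that by (simp add: sum.remove[of I j])
    finally show ?thesis using insert.prems by simp
  qed
  have "(\<Sum>i\<in>I. r i) < k" "r z < k" using insert by auto
  then show ?case
    unfolding step using insert.IH[of r] insert.IH[OF sumr] assms(3)[of "r z"]
    by (auto intro!: sum.cong)
qed

text \<open>The m-th moment of a linear form evaluated at randomly permuted values. Expanding the
  power and grouping the factors by the index they select gives symmetric sums of total degree m <
  k. This is the source of the cancellation of low orders.\<close>

lemma sum_injections_power_linear:
  fixes a b w :: "'j \<Rightarrow> real"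
  assumes S: "finite S"
    and ps: "\<And>m. m < k \<Longrightarrow> (\<Sum>x\<in>S. a x ^ m) = (\<Sum>x\<in>S. b x ^ m)"
    and "m < k"
  shows "(\<Sum>f\<in>injections S S. (\<Sum>i\<in>S. a (f i) * w i) ^ m) = (\<Sum>f\<in>injections S S. (\<Sum>i\<in>S. b (f i) * w i) ^ m)"
proof -
  have expand: "(\<Sum>f\<in>injections S S. (\<Sum>i\<in>S. c (f i) * w i) ^ m)
     = (\<Sum>g\<in>Pi\<^sub>E {..<m} (\<lambda>_. S). (\<Prod>l<m. w (g l)) *
         (\<Sum>f\<in>injections S S. \<Prod>i\<in>S. c (f i) ^ card {l \<in> {..<m}. g l = i}))" for c :: "'j \<Rightarrow> real"
  proof -
    have pow: "(\<Sum>i\<in>S. c (f i) * w i) ^ m = (\<Sum>g\<in>Pi\<^sub>E {..<m} (\<lambda>_. S). \<Prod>l<m. c (f (g l)) * w (g l))" for f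
      using prod_sum_PiE[of "{..<m}" "\<lambda>_. S" "\<lambda>_ i. c (f i) * w i"] S by simp
    have split: "(\<Prod>l<m. c (f (g l)) * w (g l))
        = (\<Prod>l<m. w (g l)) * (\<Prod>i\<in>S. c (f i) ^ card {l \<in> {..<m}. g l = i})"
      if "g \<in> Pi\<^sub>E {..<m} (\<lambda>_. S)" for f g
    proof -
      have "(\<Prod>l<m. c (f (g l))) = (\<Prod>i\<in>S. \<Prod>l\<in>{l \<in> {..<m}. g l = i}. c (f (g l)))"
        by (rule prod.group[symmetric]) (use that S in auto)
      also have "\<dots> = (\<Prod>i\<in>S. c (f i) ^ card {l \<in> {..<m}. g l = i})"
        by (intro prod.cong) auto
      finally show ?thesis by (simp add: prod.distrib mult.commute)
    qed
    have "(\<Sum>f\<in>injections S S. (\<Sum>i\<in>S. c (f i) * w i) ^ m)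
      = (\<Sum>f\<in>injections S S. \<Sum>g\<in>Pi\<^sub>E {..<m} (\<lambda>_. S). (\<Prod>l<m. w (g l)) *
         (\<Prod>i\<in>S. c (f i) ^ card {l \<in> {..<m}. g l = i}))"
      unfolding pow by (rule sum.cong[OF refl], rule sum.cong[OF refl], rule split)
    also have "\<dots> = (\<Sum>g\<in>Pi\<^sub>E {..<m} (\<lambda>_. S). (\<Prod>l<m. w (g l)) *
         (\<Sum>f\<in>injections S S. \<Prod>i\<in>S. c (f i) ^ card {l \<in> {..<m}. g l = i}))"
      by (subst sum.swap) (simp add: sum_distrib_left)
    finally show ?thesis .
  qed
  show ?thesis unfolding expand
  proof (rule sum.cong[OF refl], rule arg_cong2[where f = times, OF refl])
    fix g assume g: "g \<in> Pi\<^sub>E {..<m} (\<lambda>_. S)"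
    have "(\<Sum>i\<in>S. card {l \<in> {..<m}. g l = i}) = (\<Sum>i\<in>S. \<Sum>l\<in>{l \<in> {..<m}. g l = i}. 1)"
      by simp
    also have "\<dots> = (\<Sum>l<m. 1)"
      by (rule sum.group) (use g S in auto)
    finally have "(\<Sum>i\<in>S. card {l \<in> {..<m}. g l = i}) < k" using \<open>m < k\<close> by simp
    then show "(\<Sum>f\<in>injections S S. \<Prod>i\<in>S. a (f i) ^ card {l \<in> {..<m}. g l = i})
      = (\<Sum>f\<in>injections S S. \<Prod>i\<in>S. b (f i) ^ card {l \<in> {..<m}. g l = i})"
      using sum_injections_power_sums[OF S S ps] by blast
  qed
qed

subsection \<open>Two spectra with equal low moments\<close>

text \<open>From (A, B) pass to the pair of \<open>q ^ Suc k\<close> copies of A with the dilate qB,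
  and the same with A and B exchanged. The difference of the m-th power sums is multiplied by
  q^(k+1) - q^m: old coincidences persist and order k+1 becomes one. The difference and the sum of
  the lengths are multiplied by q^(k+1) - 1 and q^(k+1) + 1. Order 0 is deliberately left
  unmatched.\<close>

lemma prouhet_tarry_escott_lists:
  fixes q k :: nat
  assumes "q \<ge> 2"
  shows "\<exists>A B :: nat list. (\<forall>x \<in> set A \<union> set B. x > 0) \<and>
     (\<forall>m\<in>{1..k}. (\<Sum>x\<leftarrow>A. int x ^ m) = (\<Sum>x\<leftarrow>B. int x ^ m)) \<and>
     int (length B) - int (length A) = (\<Prod>m=1..k. int q ^ m - 1) \<and>
     int (length A) + int (length B) = (\<Prod>m=1..k. int q ^ m + 1)"
proof (induction k)
  case 0
  show ?case by (intro exI[of _ "[]"] exI[of _ "[1]"]) auto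
next
  case (Suc k)
  then obtain A B :: "nat list" where pos: "\<forall>x \<in> set A \<union> set B. x > 0"
    and mom: "\<And>m. m \<in> {1..k} \<Longrightarrow> (\<Sum>x\<leftarrow>A. int x ^ m) = (\<Sum>x\<leftarrow>B. int x ^ m)"
    and diff: "int (length B) - int (length A) = (\<Prod>m=1..k. int q ^ m - 1)"
    and tot: "int (length A) + int (length B) = (\<Prod>m=1..k. int q ^ m + 1)" by blast
  let ?Q = "q ^ Suc k"
  define C where "C = (\<lambda>X Y :: nat list. concat (replicate ?Q X) @ map (\<lambda>x. q * x) Y)"
  have len: "int (length (C X Y)) = int q ^ Suc k * int (length X) + int (length Y)" for X Y
    by (simp add: C_def length_concat sum_list_replicate)
  have rep: "(\<Sum>x\<leftarrow>concat (replicate n X). f x) = int n * (\<Sum>x\<leftarrow>X. f x)" for n f and X :: "nat list"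
    by (induction n) (auto simp: algebra_simps)
  have sumC: "(\<Sum>x\<leftarrow>C X Y. int x ^ m) = int q ^ Suc k * (\<Sum>x\<leftarrow>X. int x ^ m) + int q ^ m * (\<Sum>x\<leftarrow>Y. int x ^ m)" for X Y m
    by (simp add: C_def rep o_def power_mult_distrib sum_list_const_mult)
  have "\<forall>x \<in> set (C A B) \<union> set (C B A). x > 0"
    using pos assms by (auto simp: C_def)
  moreover have "(\<Sum>x\<leftarrow>C A B. int x ^ m) = (\<Sum>x\<leftarrow>C B A. int x ^ m)" if "m \<in> {1..Suc k}" for m
    using mom[of m] that unfolding sumC by (cases "m = Suc k") auto
  moreover have "int (length (C B A)) - int (length (C A B)) = (\<Prod>m=1..Suc k. int q ^ m - 1)"
    unfolding prod.cl_ivl_Suc diff[symmetric] len by (simp add: algebra_simps)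
  moreover have "int (length (C A B)) + int (length (C B A)) = (\<Prod>m=1..Suc k. int q ^ m + 1)"
    unfolding prod.cl_ivl_Suc tot[symmetric] len by (simp add: algebra_simps)
  ultimately show ?case by blast
qed

text \<open>Each quotient (q^m + 1)/(q^m - 1) is at most 1 + 2/(q - 1), which tends to 1. Hence for
  large q the shorter of the two lists has a negligible share of the entries.\<close>

lemma prod_ratio_bound:
  fixes q :: nat
  assumes "q \<ge> 2"
  shows "(\<Prod>m=1..k. real q ^ m + 1) \<le> (1 + 2 / (real q - 1)) ^ k * (\<Prod>m=1..k. real q ^ m - 1)"
proof -
  have "(\<Prod>m=1..k. real q ^ m + 1) \<le> (\<Prod>m=1..k. (1 + 2 / (real q - 1)) * (real q ^ m - 1))"
  proof (rule prod_mono, safe)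
    fix m assume "m \<in> {1..k}"
    then have "real q ^ m \<ge> real q ^ 1" using assms by (intro power_increasing) auto
    then have "2 \<le> 2 / (real q - 1) * (real q ^ m - 1)"
      using assms by (simp add: field_simps)
    then show "real q ^ m + 1 \<le> (1 + 2 / (real q - 1)) * (real q ^ m - 1)"
      by (simp add: algebra_simps)
  qed simp
  then show ?thesis by (simp add: prod.distrib)
qed

text \<open>The shorter list is padded with zeros up to the length of the longer one. This leaves
  the positive power sums alone, repairs order 0, and makes \<open>a\<close> sparse, the share of
  its nonzero entries being controlled by a large q. Dividing by the common mean normalises the mean
  to 1.\<close>

lemma matched_values_exist:
  fixes k :: nat and \<eta> :: real
  assumes "k \<ge> 1" "\<eta> > 0"
  obtains s :: nat and a b :: "nat \<Rightarrow> real" where "s > 0"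
    "\<And>i. i < s \<Longrightarrow> a i \<ge> 0" "\<And>i. i < s \<Longrightarrow> b i > 0"
    "(\<Sum>i<s. a i) = real s"
    "\<And>m. m \<le> k \<Longrightarrow> (\<Sum>i<s. a i ^ m) = (\<Sum>i<s. b i ^ m)"
    "real (card {i. i < s \<and> a i \<noteq> 0}) \<le> \<eta> * real s"
proof -
  have "(\<lambda>q. (1 + 2 / (real q - 1)) ^ k) \<longlonglongrightarrow> (1 + 0) ^ k"
  proof (intro tendsto_intros)
    have "filterlim (\<lambda>q. -1 + real q) at_top sequentially"
      by (intro filterlim_tendsto_add_at_top[OF tendsto_const] filterlim_real_sequentially)
    then show "(\<lambda>q. 2 / (real q - 1)) \<longlonglongrightarrow> 0"
      by (intro tendsto_divide_0[OF tendsto_const] filterlim_at_top_imp_at_infinity) simp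
  qed
  then have "eventually (\<lambda>q. (1 + 2 / (real q - 1)) ^ k < 1 + \<eta>) sequentially"
    using assms by (intro order_tendstoD) auto
  then have "eventually (\<lambda>q. (1 + 2 / (real q - 1)) ^ k < 1 + \<eta> \<and> q \<ge> 2) sequentially"
    using eventually_ge_at_top eventually_conj by blast
  then obtain q :: nat where q: "(1 + 2 / (real q - 1)) ^ k < 1 + \<eta>" "q \<ge> 2"
    by (metis (mono_tags, lifting) eventually_sequentially order_refl)
  obtain A B :: "nat list" where pos: "\<And>x. x \<in> set A \<union> set B \<Longrightarrow> x > 0"
    and mom: "\<And>m. m \<in> {1..k} \<Longrightarrow> (\<Sum>x\<leftarrow>A. int x ^ m) = (\<Sum>x\<leftarrow>B. int x ^ m)"
    and diff: "int (length B) - int (length A) = (\<Prod>m=1..k. int q ^ m - 1)"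
    and tot: "int (length A) + int (length B) = (\<Prod>m=1..k. int q ^ m + 1)"
    using prouhet_tarry_escott_lists[OF q(2), of k] by blast
  define P where "P = (\<Prod>m=1..k. int q ^ m - 1)"
  have "P > 0" unfolding P_def
  proof (rule prod_pos)
    fix m assume "m \<in> {1..k}"
    then show "int q ^ m - 1 > 0" using q(2) one_less_power[of "int q" m] by auto
  qed
  define s where "s = length B"
  have s: "int s = int (length A) + P" using diff by (simp add: s_def P_def)
  define A' where "A' = A @ replicate (nat P) 0"
  have lenA': "length A' = s" using s \<open>P > 0\<close> by (simp add: A'_def)
  have "s > 0" using s \<open>P > 0\<close> by linarith
  define \<mu> where "\<mu> = (\<Sum>x\<leftarrow>B. real x) / real s"
  have conv: "(\<Sum>x\<leftarrow>X. f x) = (\<Sum>i<length X. f (X ! i))" for X :: "nat list" and f :: "nat \<Rightarrow> real"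
    by (simp add: sum_list_sum_nth atLeast0LessThan)
  have "(\<Sum>i<s. real (B ! i)) > 0"
    using \<open>s > 0\<close> pos by (intro sum_pos) (auto simp: s_def)
  then have mu: "\<mu> > 0" using \<open>s > 0\<close> by (simp add: \<mu>_def conv s_def)
  define a where "a = (\<lambda>i. real (A' ! i) / \<mu>)"
  define b where "b = (\<lambda>i. real (B ! i) / \<mu>)"
  have realmom: "(\<Sum>x\<leftarrow>A. real x ^ m) = (\<Sum>x\<leftarrow>B. real x ^ m)" if "m \<in> {1..k}" for m
  proof -
    have "(\<Sum>x\<leftarrow>X. real x ^ m) = of_int (\<Sum>x\<leftarrow>X. int x ^ m)" for X :: "nat list"
      by (induction X) auto
    then show ?thesis using mom[OF that] by simp
  qed
  have momab: "(\<Sum>i<s. a i ^ m) = (\<Sum>i<s. b i ^ m)" if "m \<le> k" for m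
  proof (cases "m = 0")
    case False
    have "(\<Sum>i<s. a i ^ m) = (\<Sum>x\<leftarrow>A'. (real x / \<mu>) ^ m)"
      by (simp add: conv lenA' a_def)
    also have "\<dots> = (\<Sum>x\<leftarrow>A. (real x / \<mu>) ^ m)"
      using False by (simp add: A'_def sum_list_replicate)
    also have "\<dots> = (\<Sum>x\<leftarrow>A. real x ^ m) / \<mu> ^ m"
      by (simp add: conv power_divide sum_divide_distrib)
    also have "\<dots> = (\<Sum>x\<leftarrow>B. real x ^ m) / \<mu> ^ m" using realmom[of m] that False by simp
    also have "\<dots> = (\<Sum>i<s. b i ^ m)"
      by (simp add: conv s_def b_def power_divide sum_divide_distrib)
    finally show ?thesis .
  qed simp
  have sumb: "(\<Sum>i<s. b i) = real s"
  proof -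
    have "(\<Sum>i<s. b i) = (\<Sum>i<s. real (B ! i)) / \<mu>"
      by (simp add: b_def sum_divide_distrib)
    also have "(\<Sum>i<s. real (B ! i)) = \<mu> * real s"
      using \<open>s > 0\<close> by (simp add: \<mu>_def conv s_def)
    finally show ?thesis using mu by simp
  qed
  have "card {i. i < s \<and> a i \<noteq> 0} \<le> card {..<length A}"
  proof (rule card_mono)
    have "a i = 0" if "i < s" "\<not> i < length A" for i
      using that lenA' by (auto simp: a_def A'_def nth_append)
    then show "{i. i < s \<and> a i \<noteq> 0} \<subseteq> {..<length A}" by auto
  qed simp
  moreover have "real (length A) \<le> \<eta> * real s"
  proof -
    have "real (length A) + real s = (\<Prod>m=1..k. real q ^ m + 1)"
      using arg_cong[OF tot, of real_of_int] by (simp add: s_def)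
    also have "\<dots> \<le> (1 + 2 / (real q - 1)) ^ k * (\<Prod>m=1..k. real q ^ m - 1)"
      by (rule prod_ratio_bound[OF q(2)])
    also have "(\<Prod>m=1..k. real q ^ m - 1) = real s - real (length A)"
      using arg_cong[OF diff, of real_of_int] by (simp add: s_def)
    also have "(1 + 2 / (real q - 1)) ^ k * (real s - real (length A)) \<le> (1 + \<eta>) * (real s - real (length A))"
      using q(1) s \<open>P > 0\<close> by (intro mult_right_mono) auto
    finally have "(2 + \<eta>) * real (length A) \<le> \<eta> * real s" by (simp add: algebra_simps)
    moreover have "real (length A) \<le> (2 + \<eta>) * real (length A)"
      using assms by (simp add: mult_le_cancel_right1)
    ultimately show ?thesis by linarith
  qed
  ultimately have "real (card {i. i < s \<and> a i \<noteq> 0}) \<le> \<eta> * real s" by simp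
  then show thesis
    using that[of s a b] \<open>s > 0\<close> mu momab momab[of 1] assms sumb pos
    by (auto simp: a_def b_def s_def)
qed

subsection \<open>Matrices and tensor powers\<close>

lemma mat_adjoint_carrier [simp]: "A \<in> carrier_mat n m \<Longrightarrow> mat_adjoint A \<in> carrier_mat m n"
  by (auto simp: mat_adjoint_def mat_of_rows_def)

lemma mat_adjoint_dim [simp]: "dim_row (mat_adjoint A) = dim_col A" "dim_col (mat_adjoint A) = dim_row A"
  by (auto simp: mat_adjoint_def mat_of_rows_def)

lemma mat_adjoint_index [simp]:
  "i < dim_col A \<Longrightarrow> j < dim_row A \<Longrightarrow> mat_adjoint A $$ (i, j) = conjugate (A $$ (j, i))"
  by (auto simp: mat_adjoint_def mat_of_rows_index cols_length)

lemma mat_adjoint_adjoint [simp]: "mat_adjoint (mat_adjoint A) = A"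
  by (rule eq_matI) auto

lemma mat_mult_index:
  "i < dim_row A \<Longrightarrow> j < dim_col B \<Longrightarrow> dim_col A = dim_row B \<Longrightarrow>
    (A * B) $$ (i, j) = (\<Sum>l<dim_row B. A $$ (i, l) * B $$ (l, j))"
  by (simp add: scalar_prod_def atLeast0LessThan)

lemma mat_adjoint_mult:
  fixes A B :: "complex mat"
  assumes "dim_col A = dim_row B"
  shows "mat_adjoint (A * B) = mat_adjoint B * mat_adjoint A"
  by (rule eq_matI) (auto simp: mat_mult_index assms mult.commute simp del: index_mult_mat(1))

lemma mat_adjoint_one [simp]: "mat_adjoint (1\<^sub>m n :: complex mat) = 1\<^sub>m n"
  by (rule eq_matI) auto

lemma sprod_mat_vec_adjoint:
  fixes A :: "complex mat"
  assumes "A \<in> carrier_mat n m" "v \<in> carrier_vec m" "w \<in> carrier_vec n"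
  shows "(A *\<^sub>v v) \<bullet>c w = v \<bullet>c (mat_adjoint A *\<^sub>v w)"
proof -
  have "(A *\<^sub>v v) \<bullet>c w = (\<Sum>i<n. \<Sum>j<m. A $$ (i, j) * v $ j * cnj (w $ i))"
    using assms by (simp add: scalar_prod_def atLeast0LessThan sum_distrib_right)
  also have "\<dots> = (\<Sum>j<m. \<Sum>i<n. A $$ (i, j) * v $ j * cnj (w $ i))"
    by (rule sum.swap)
  also have "\<dots> = v \<bullet>c (mat_adjoint A *\<^sub>v w)"
    using assms by (simp add: scalar_prod_def atLeast0LessThan sum_distrib_left mult_ac)
  finally show ?thesis .
qed

lemma psd_mat_conj:
  assumes A: "psd_mat n A" and V: "V \<in> carrier_mat n m"
  shows "psd_mat m (mat_adjoint V * A * V)"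
proof -
  have c: "A \<in> carrier_mat n n" "mat_adjoint A = A" using A by (auto simp: psd_mat_def)
  have "mat_adjoint (mat_adjoint V * A * V) = mat_adjoint V * A * V"
    using c V by (simp add: mat_adjoint_mult assoc_mult_mat[of _ m n _ n _ m])
  moreover have "0 \<le> ((mat_adjoint V * A * V) *\<^sub>v v) \<bullet>c v" if v: "v \<in> carrier_vec m" for v
  proof -
    have Vv: "V *\<^sub>v v \<in> carrier_vec n" using V v by simp
    have "(mat_adjoint V * A * V) *\<^sub>v v = (mat_adjoint V * A) *\<^sub>v (V *\<^sub>v v)"
      by (rule assoc_mult_mat_vec[of _ m n _ m]) (use c V v in auto)
    also have "\<dots> = mat_adjoint V *\<^sub>v (A *\<^sub>v (V *\<^sub>v v))"
      by (rule assoc_mult_mat_vec[of _ m n _ n]) (use c V Vv in auto)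
    finally have "(mat_adjoint V * A * V) *\<^sub>v v = mat_adjoint V *\<^sub>v (A *\<^sub>v (V *\<^sub>v v))" .
    then have "((mat_adjoint V * A * V) *\<^sub>v v) \<bullet>c v = (A *\<^sub>v (V *\<^sub>v v)) \<bullet>c (V *\<^sub>v v)"
      using c V v by (simp add: sprod_mat_vec_adjoint[of _ m n])
    then show ?thesis using A Vv by (simp add: psd_mat_def)
  qed
  moreover have "mat_adjoint V * A * V \<in> carrier_mat m m"
    using c V by (meson mat_adjoint_carrier mult_carrier_mat)
  ultimately show ?thesis by (simp add: psd_mat_def)
qed

lemma mat_trace_comm:
  fixes A B :: "'a::comm_ring_1 mat"
  assumes "A \<in> carrier_mat n m" "B \<in> carrier_mat m n"
  shows "mat_trace (A * B) = mat_trace (B * A)"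
proof -
  have "mat_trace (A * B) = (\<Sum>i<n. \<Sum>j<m. A $$ (i, j) * B $$ (j, i))"
    using assms by (simp add: mat_trace_def scalar_prod_def atLeast0LessThan)
  also have "\<dots> = (\<Sum>j<m. \<Sum>i<n. A $$ (i, j) * B $$ (j, i))"
    by (rule sum.swap)
  also have "\<dots> = mat_trace (B * A)"
    using assms by (simp add: mat_trace_def scalar_prod_def atLeast0LessThan mult.commute)
  finally show ?thesis .
qed

lemma mat_trace_add:
  "A \<in> carrier_mat n n \<Longrightarrow> B \<in> carrier_mat n n \<Longrightarrow> mat_trace (A + B) = mat_trace A + mat_trace B"
  by (simp add: mat_trace_def sum.distrib)

lemma sum_lessThan_mult:
  fixes f :: "nat \<Rightarrow> 'a::comm_monoid_add"
  assumes "n > 0"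
  shows "(\<Sum>l<m * n. f l) = (\<Sum>i<m. \<Sum>j<n. f (i * n + j))"
proof -
  have "sum f {i * n..<i * n + n} = (\<Sum>j<n. f (i * n + j))" for i
    by (rule sum.reindex_bij_witness[of _ "\<lambda>j. i * n + j" "\<lambda>l. l - i * n"]) auto
  then show ?thesis using sum.nat_group[of f n m] by simp
qed

lemma nat_mult_div_mod_bounds:
  fixes i m n :: nat
  assumes "i < m * n"
  shows "i div n < m" "i mod n < n"
  using assms by (auto simp: less_mult_imp_div_less) (metis mod_less_divisor mult_0_right not_gr0 not_less0)

lemma kronecker_carrier:
  "A \<in> carrier_mat a b \<Longrightarrow> B \<in> carrier_mat c e \<Longrightarrow> kronecker A B \<in> carrier_mat (a * c) (b * e)"
  by (auto simp: kronecker_def)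

lemma kronecker_index:
  assumes "A \<in> carrier_mat a b" "B \<in> carrier_mat c e" "i < a * c" "j < b * e"
  shows "kronecker A B $$ (i, j) = A $$ (i div c, j div e) * B $$ (i mod c, j mod e)"
  using assms by (auto simp: kronecker_def)

lemma kronecker_mult:
  fixes A B C E :: "'a::comm_ring_1 mat"
  assumes "A \<in> carrier_mat a a" "B \<in> carrier_mat b b" "C \<in> carrier_mat a a" "E \<in> carrier_mat b b" "b > 0"
  shows "kronecker A B * kronecker C E = kronecker (A * C) (B * E)"
proof (rule eq_matI)
  note k = kronecker_carrier[OF assms(1,2)] kronecker_carrier[OF assms(3,4)]
  have AC: "A * C \<in> carrier_mat a a" and BE: "B * E \<in> carrier_mat b b" using assms by auto
  note k' = kronecker_carrier[OF AC BE]
  fix i j assume "i < dim_row (kronecker (A * C) (B * E))" "j < dim_col (kronecker (A * C) (B * E))"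
  then have ij: "i < a * b" "j < a * b" using k' by auto
  note bnd = nat_mult_div_mod_bounds[OF ij(1)] nat_mult_div_mod_bounds[OF ij(2)]
  have "(kronecker A B * kronecker C E) $$ (i, j) =
      (\<Sum>l<a * b. kronecker A B $$ (i, l) * kronecker C E $$ (l, j))"
    using k ij by (simp add: scalar_prod_def atLeast0LessThan)
  also have "\<dots> = (\<Sum>l<a * b. (A $$ (i div b, l div b) * B $$ (i mod b, l mod b)) *
        (C $$ (l div b, j div b) * E $$ (l mod b, j mod b)))"
    using ij by (intro sum.cong refl) (simp add: kronecker_index[OF assms(1,2)] kronecker_index[OF assms(3,4)])
  also have "\<dots> = (\<Sum>l<a. A $$ (i div b, l) * C $$ (l, j div b)) * (\<Sum>l<b. B $$ (i mod b, l) * E $$ (l, j mod b))"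
    using \<open>b > 0\<close> by (simp add: sum_lessThan_mult sum_product mult_ac)
  also have "\<dots> = (A * C) $$ (i div b, j div b) * (B * E) $$ (i mod b, j mod b)"
    using assms bnd by (simp add: scalar_prod_def atLeast0LessThan)
  also have "\<dots> = kronecker (A * C) (B * E) $$ (i, j)"
    using ij by (simp add: kronecker_index[OF AC BE])
  finally show "(kronecker A B * kronecker C E) $$ (i, j) = kronecker (A * C) (B * E) $$ (i, j)" .
qed (use assms in \<open>auto simp: kronecker_def\<close>)

lemma kronecker_one: "b > 0 \<Longrightarrow> kronecker (1\<^sub>m a) (1\<^sub>m b) = (1\<^sub>m (a * b) :: 'a::comm_ring_1 mat)"
proof (rule eq_matI)
  fix i j assume b: "b > 0" and "i < dim_row (1\<^sub>m (a * b) :: 'a mat)" "j < dim_col (1\<^sub>m (a * b) :: 'a mat)"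
  then have ij: "i < a * b" "j < a * b" by auto
  note bnd = nat_mult_div_mod_bounds[OF ij(1)] nat_mult_div_mod_bounds[OF ij(2)]
  have "i = j \<longleftrightarrow> i div b = j div b \<and> i mod b = j mod b"
    by (metis div_mult_mod_eq)
  then show "kronecker (1\<^sub>m a) (1\<^sub>m b) $$ (i, j) = (1\<^sub>m (a * b) :: 'a mat) $$ (i, j)"
    using ij bnd by (subst kronecker_index[of _ a a _ b b]) auto
qed (auto simp: kronecker_def)

lemma kronecker_adjoint:
  fixes A B :: "complex mat"
  assumes "A \<in> carrier_mat a a" "B \<in> carrier_mat b b"
  shows "mat_adjoint (kronecker A B) = kronecker (mat_adjoint A) (mat_adjoint B)"
proof (rule eq_matI)
  note c = mat_adjoint_carrier[OF assms(1)] mat_adjoint_carrier[OF assms(2)]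
  fix i j assume "i < dim_row (kronecker (mat_adjoint A) (mat_adjoint B))"
    "j < dim_col (kronecker (mat_adjoint A) (mat_adjoint B))"
  then have ij: "i < a * b" "j < a * b" using kronecker_carrier[OF c] by auto
  note bnd = nat_mult_div_mod_bounds[OF ij(1)] nat_mult_div_mod_bounds[OF ij(2)]
  show "mat_adjoint (kronecker A B) $$ (i, j) = kronecker (mat_adjoint A) (mat_adjoint B) $$ (i, j)"
    using ij bnd assms kronecker_carrier[OF assms]
    by (simp add: kronecker_index[OF c] kronecker_index[OF assms])
qed (use assms in \<open>auto simp: kronecker_def\<close>)

lemma tensor_power_mult:
  fixes A B :: "'a::comm_ring_1 mat"
  assumes "A \<in> carrier_mat d d" "B \<in> carrier_mat d d" "d > 0"
  shows "tensor_power (A * B) n = tensor_power A n * tensor_power B n"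
proof (induction n)
  case (Suc n)
  then show ?case
    using assms tensor_power_carrier[OF assms(1), of n] tensor_power_carrier[OF assms(2), of n]
    by (simp add: kronecker_mult[of _ d _ "d ^ n"])
qed simp

lemma tensor_power_one: "d > 0 \<Longrightarrow> tensor_power (1\<^sub>m d) n = (1\<^sub>m (d ^ n) :: 'a::comm_ring_1 mat)"
  by (induction n) (auto simp: kronecker_one)

lemma tensor_power_adjoint:
  fixes A :: "complex mat"
  assumes "A \<in> carrier_mat d d"
  shows "mat_adjoint (tensor_power A n) = tensor_power (mat_adjoint A) n"
  by (induction n) (auto simp: kronecker_adjoint[OF assms tensor_power_carrier[OF assms]])

text \<open>A multiplicative function of entries factorises along Kronecker products. The instance
  needed is \<open>a * b / c\<close>, which is multiplicative even at \<open>c = 0\<close> by the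
  convention for division; the third matrix enters through its diagonal as a weight on the
  rows.\<close>

lemma sum_tensor_power_entries:
  fixes f :: "'a::comm_ring_1 \<Rightarrow> 'a \<Rightarrow> 'a \<Rightarrow> 'b::comm_ring_1"
  assumes A: "A \<in> carrier_mat d d" and B: "B \<in> carrier_mat d d" and W: "W \<in> carrier_mat d d" and "d > 0"
    and f1: "f 1 1 1 = 1" and fm: "\<And>a b c a' b' c'. f (a * a') (b * b') (c * c') = f a b c * f a' b' c'"
  shows "(\<Sum>i<d ^ n. \<Sum>j<d ^ n. f (tensor_power A n $$ (i, j)) (tensor_power B n $$ (i, j)) (tensor_power W n $$ (i, i)))
     = (\<Sum>i<d. \<Sum>j<d. f (A $$ (i, j)) (B $$ (i, j)) (W $$ (i, i))) ^ n"
proof (induction n)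
  case 0
  then show ?case by (simp add: f1)
next
  case (Suc n)
  have pos: "d ^ n > 0" using \<open>d > 0\<close> by simp
  note c = tensor_power_carrier[OF A, of n] tensor_power_carrier[OF B, of n] tensor_power_carrier[OF W, of n]
  let ?F = "\<lambda>n i j. f (tensor_power A n $$ (i, j)) (tensor_power B n $$ (i, j)) (tensor_power W n $$ (i, i))"
  let ?G = "\<lambda>i j. f (A $$ (i, j)) (B $$ (i, j)) (W $$ (i, i))"
  have ent: "?F (Suc n) (i * d ^ n + k) (j * d ^ n + l) = ?G i j * ?F n k l"
    if "i < d" "j < d" "k < d ^ n" "l < d ^ n" for i j k l
  proof -
    have b: "i * d ^ n + k < d * d ^ n" "j * d ^ n + l < d * d ^ n"
      using that mult_le_mono1[of "Suc i" d "d ^ n"] mult_le_mono1[of "Suc j" d "d ^ n"] by auto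
    show ?thesis using that b
      by (simp add: kronecker_index[OF A c(1)] kronecker_index[OF B c(2)] kronecker_index[OF W c(3)] fm)
  qed
  have "(\<Sum>i<d ^ Suc n. \<Sum>j<d ^ Suc n. ?F (Suc n) i j)
      = (\<Sum>i<d. \<Sum>k<d ^ n. \<Sum>j<d. \<Sum>l<d ^ n. ?F (Suc n) (i * d ^ n + k) (j * d ^ n + l))"
    unfolding power_Suc sum_lessThan_mult[OF pos] ..
  also have "\<dots> = (\<Sum>i<d. \<Sum>k<d ^ n. \<Sum>j<d. \<Sum>l<d ^ n. ?G i j * ?F n k l)"
    by (intro sum.cong refl ent) auto
  also have "\<dots> = (\<Sum>i<d. \<Sum>j<d. ?G i j) * (\<Sum>k<d ^ n. \<Sum>l<d ^ n. ?F n k l)"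
    by (simp only: sum_product)
  finally show ?case using Suc by simp
qed

subsection \<open>Measurements\<close>

definition effect :: "nat \<Rightarrow> complex mat \<Rightarrow> bool" where
  "effect N M \<longleftrightarrow> psd_mat N M \<and> psd_mat N (1\<^sub>m N - M)"

lemma cscalar_prod_minus_right:
  fixes u v w :: "complex vec"
  assumes "u \<in> carrier_vec n" "v \<in> carrier_vec n" "w \<in> carrier_vec n"
  shows "u \<bullet>c (v - w) = u \<bullet>c v - u \<bullet>c w"
  using assms by (simp add: scalar_prod_def sum_subtractf algebra_simps)

lemma psd_mat_Re: "psd_mat N A \<Longrightarrow> v \<in> carrier_vec N \<Longrightarrow> 0 \<le> Re ((A *\<^sub>v v) \<bullet>c v)"
  by (auto simp: psd_mat_def less_eq_complex_def)

text \<open>In operator terms, M^2 \<le> M \<le> 1. No operator square root is needed: with y = Me,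
  positivity of M at e - y gives 2|y|^2 \<le> <y,e> + <My,y>, and positivity of 1 - M at e and at y
  bounds the two terms by 1 and |y|^2.\<close>

lemma effect_column_bound:
  assumes "effect N M" "j < N"
  shows "(\<Sum>i<N. (cmod (M $$ (i, j)))\<^sup>2) \<le> 1"
proof -
  have M: "M \<in> carrier_mat N N" "mat_adjoint M = M" and psd: "psd_mat N M" "psd_mat N (1\<^sub>m N - M)"
    using assms by (auto simp: effect_def psd_mat_def)
  define e where "e = (unit_vec N j :: complex vec)"
  define y where "y = M *\<^sub>v e"
  have e: "e \<in> carrier_vec N" and y: "y \<in> carrier_vec N" using M by (auto simp: e_def y_def)
  have My: "M *\<^sub>v y \<in> carrier_vec N" using M y by simp
  have compl: "((1\<^sub>m N - M) *\<^sub>v v) \<bullet>c v = v \<bullet>c v - (M *\<^sub>v v) \<bullet>c v" if "v \<in> carrier_vec N" for v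
    using that M by (simp add: minus_mult_distrib_mat_vec[of _ N N] minus_scalar_prod_distrib[of _ N])
  have 1: "Re ((M *\<^sub>v e) \<bullet>c e) \<le> 1"
    using psd_mat_Re[OF psd(2) e] assms(2) by (simp add: compl[OF e]) (simp add: e_def)
  have 2: "Re ((M *\<^sub>v y) \<bullet>c y) \<le> Re (y \<bullet>c y)"
    using psd_mat_Re[OF psd(2) y] by (simp add: compl[OF y])
  have "(M *\<^sub>v (e - y)) \<bullet>c (e - y) = (y \<bullet>c e - y \<bullet>c y) - ((M *\<^sub>v y) \<bullet>c e - (M *\<^sub>v y) \<bullet>c y)"
    using M e y My
    by (simp add: mult_minus_distrib_mat_vec[of _ N N] minus_scalar_prod_distrib[of _ N]
        cscalar_prod_minus_right[of _ N] flip: y_def)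
  moreover have "(M *\<^sub>v y) \<bullet>c e = y \<bullet>c y"
    using sprod_mat_vec_adjoint[OF M(1) y e] M by (simp flip: y_def)
  moreover have "0 \<le> Re ((M *\<^sub>v (e - y)) \<bullet>c (e - y))"
    using psd_mat_Re[OF psd(1), of "e - y"] e y by simp
  ultimately have "Re (y \<bullet>c y) \<le> 1"
    using 1 2 by (simp add: y_def)
  moreover have "y $ i = M $$ (i, j)" if "i < N" for i
    using that M assms(2) by (simp add: y_def e_def)
  ultimately show ?thesis
    using y by (simp add: scalar_prod_def atLeast0LessThan complex_mult_cnj cmod_power2)
qed

lemma outcome_prob_entries:
  assumes "M \<in> carrier_mat N N" "T \<in> carrier_mat N N"
  shows "outcome_prob M T = (\<Sum>i<N. \<Sum>j<N. Re (M $$ (i, j) * T $$ (j, i)))"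
  using assms by (simp add: outcome_prob_def mat_trace_def scalar_prod_def atLeast0LessThan)

lemma Cauchy_Schwarz_sum_real:
  fixes x y :: "'a \<Rightarrow> real"
  shows "(\<Sum>i\<in>A. x i * y i)\<^sup>2 \<le> (\<Sum>i\<in>A. (x i)\<^sup>2) * (\<Sum>i\<in>A. (y i)\<^sup>2)"
proof -
  have "\<bar>\<Sum>i\<in>A. x i * y i\<bar> \<le> (\<Sum>i\<in>A. \<bar>x i\<bar> * \<bar>y i\<bar>)"
    by (rule order_trans[OF sum_abs]) (simp add: abs_mult)
  also have "\<dots> \<le> L2_set x A * L2_set y A" by (rule L2_set_mult_ineq)
  finally have "\<bar>\<Sum>i\<in>A. x i * y i\<bar>\<^sup>2 \<le> (L2_set x A * L2_set y A)\<^sup>2"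
    by (rule power_mono) simp
  then show ?thesis by (simp add: L2_set_def power_mult_distrib sum_nonneg)
qed

text \<open>Cauchy-Schwarz after inserting \<open>sqrt (w j)\<close> into one factor and its inverse
  into the other. The column bound for effects is what makes a weight on one index sufficient. Where
  \<open>w\<close> vanishes the support condition keeps the splitting exact. As D is real, only the
  real part of M matters.\<close>

lemma weighted_Cauchy_Schwarz_effect:
  fixes D :: "nat \<Rightarrow> nat \<Rightarrow> real"
  assumes M: "effect N M" and w: "\<And>i. i < N \<Longrightarrow> w i \<ge> 0"
    and supp: "\<And>i j. i < N \<Longrightarrow> j < N \<Longrightarrow> w i = 0 \<Longrightarrow> D i j = 0"
  shows "(\<Sum>i<N. \<Sum>j<N. Re (M $$ (i, j)) * D j i)\<^sup>2 \<le> (\<Sum>i<N. w i) * (\<Sum>i<N. \<Sum>j<N. (D i j)\<^sup>2 / w i)"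
proof -
  let ?P = "{..<N} \<times> {..<N}"
  define x where "x = (\<lambda>(i, j). Re (M $$ (i, j)) * sqrt (w j))"
  define y where "y = (\<lambda>(i, j). D j i / sqrt (w j))"
  have "(\<Sum>i<N. \<Sum>j<N. Re (M $$ (i, j)) * D j i) = (\<Sum>p\<in>?P. x p * y p)"
    unfolding sum.cartesian_product
    by (intro sum.cong refl) (use w supp in \<open>auto simp: x_def y_def\<close>)
  moreover have "(\<Sum>p\<in>?P. (x p)\<^sup>2) \<le> (\<Sum>j<N. w j)"
  proof -
    have "(\<Sum>p\<in>?P. (x p)\<^sup>2) = (\<Sum>i<N. \<Sum>j<N. (Re (M $$ (i, j)))\<^sup>2 * w j)"
      unfolding sum.cartesian_product
      by (intro sum.cong refl) (use w in \<open>auto simp: x_def power_mult_distrib\<close>)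
    also have "\<dots> = (\<Sum>j<N. (\<Sum>i<N. (Re (M $$ (i, j)))\<^sup>2) * w j)"
      by (subst sum.swap) (simp add: sum_distrib_right)
    also have "\<dots> \<le> (\<Sum>j<N. 1 * w j)"
    proof (intro sum_mono mult_right_mono)
      fix j assume "j \<in> {..<N}"
      then have "(\<Sum>i<N. (cmod (M $$ (i, j)))\<^sup>2) \<le> 1" by (intro effect_column_bound[OF M]) auto
      moreover have "(\<Sum>i<N. (Re (M $$ (i, j)))\<^sup>2) \<le> (\<Sum>i<N. (cmod (M $$ (i, j)))\<^sup>2)"
        by (intro sum_mono) (simp add: cmod_power2)
      ultimately show "(\<Sum>i<N. (Re (M $$ (i, j)))\<^sup>2) \<le> 1" by linarith
    qed (use w in auto)
    finally show ?thesis by simp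
  qed
  moreover have "(\<Sum>p\<in>?P. (y p)\<^sup>2) = (\<Sum>i<N. \<Sum>j<N. (D i j)\<^sup>2 / w i)"
  proof -
    have "(\<Sum>p\<in>?P. (y p)\<^sup>2) = (\<Sum>i<N. \<Sum>j<N. (D j i)\<^sup>2 / w j)"
      unfolding sum.cartesian_product
      by (intro sum.cong refl) (use w in \<open>auto simp: y_def power_divide\<close>)
    then show ?thesis by (subst sum.swap)
  qed
  moreover have "(\<Sum>p\<in>?P. (y p)\<^sup>2) \<ge> 0" by (simp add: sum_nonneg)
  ultimately show ?thesis
    using Cauchy_Schwarz_sum_real[of x y ?P]
      mult_right_mono[of "\<Sum>p\<in>?P. (x p)\<^sup>2" "\<Sum>i<N. w i" "\<Sum>p\<in>?P. (y p)\<^sup>2"] by simp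
qed

section \<open>Second-moment bound for n-copy states\<close>

lemma tensor_power_trace:
  fixes A :: "'a::comm_ring_1 mat"
  assumes A: "A \<in> carrier_mat d d" and "d > 0"
  shows "(\<Sum>i<d ^ n. tensor_power A n $$ (i, i)) = (\<Sum>i<d. A $$ (i, i)) ^ n"
proof (induction n)
  case (Suc n)
  have pos: "d ^ n > 0" using \<open>d > 0\<close> by simp
  note c = tensor_power_carrier[OF A, of n]
  have "tensor_power A (Suc n) $$ (i * d ^ n + k, i * d ^ n + k) = A $$ (i, i) * tensor_power A n $$ (k, k)"
    if "i < d" "k < d ^ n" for i k
  proof -
    have b: "i * d ^ n + k < d * d ^ n"
      using that mult_le_mono1[of "Suc i" d "d ^ n"] by auto
    show ?thesis using that b by (simp add: kronecker_index[OF A c])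
  qed
  from this have "(\<Sum>i<d ^ Suc n. tensor_power A (Suc n) $$ (i, i)) = (\<Sum>i<d. \<Sum>k<d ^ n. A $$ (i, i) * tensor_power A n $$ (k, k))"
    unfolding power_Suc sum_lessThan_mult[OF pos] by (intro sum.cong refl) auto
  also have "\<dots> = (\<Sum>i<d. A $$ (i, i)) * (\<Sum>k<d ^ n. tensor_power A n $$ (k, k))"
    by (simp only: sum_product)
  finally show ?case using Suc by simp
qed simp

lemma tensor_power_diag_nonneg:
  fixes W :: "real mat"
  assumes W: "W \<in> carrier_mat d d" and nn: "\<And>i. i < d \<Longrightarrow> W $$ (i, i) \<ge> 0"
  shows "i < d ^ n \<Longrightarrow> tensor_power W n $$ (i, i) \<ge> 0"
proof (induction n arbitrary: i)
  case (Suc n)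
  then have "i < d * d ^ n" by simp
  then show ?case
    using Suc.IH[of "i mod d ^ n"] nn[of "i div d ^ n"] nat_mult_div_mod_bounds[of i d "d ^ n"]
    by (simp add: kronecker_index[OF W tensor_power_carrier[OF W]])
qed simp

text \<open>A zero on the diagonal of the tensor power comes from a zero in one Kronecker factor,
  and the same factor of \<open>X\<close> then vanishes.\<close>

lemma tensor_power_support:
  fixes W X :: "real mat"
  assumes W: "W \<in> carrier_mat d d" and X: "X \<in> carrier_mat d d"
    and z: "\<And>i j. i < d \<Longrightarrow> j < d \<Longrightarrow> W $$ (i, i) = 0 \<Longrightarrow> X $$ (i, j) = 0"
  shows "i < d ^ n \<Longrightarrow> j < d ^ n \<Longrightarrow> tensor_power W n $$ (i, i) = 0 \<Longrightarrow> tensor_power X n $$ (i, j) = 0"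
proof (induction n arbitrary: i j)
  case (Suc n)
  then have b: "i < d * d ^ n" "j < d * d ^ n" by simp_all
  note bnd = nat_mult_div_mod_bounds[OF b(1)] nat_mult_div_mod_bounds[OF b(2)]
  show ?case
    using Suc.IH[OF bnd(2,4)] Suc.prems(3) z[OF bnd(1,3)] b
    by (auto simp: kronecker_index[OF W tensor_power_carrier[OF W]] kronecker_index[OF X tensor_power_carrier[OF X]])
qed simp

abbreviation cmat :: "real mat \<Rightarrow> complex mat" where
  "cmat \<equiv> map_mat complex_of_real"

lemma tensor_power_cmat:
  assumes X: "X \<in> carrier_mat d d"
  shows "tensor_power (cmat X) n = cmat (tensor_power X n)"
proof (induction n)
  case 0
  show ?case by (rule eq_matI) auto
next
  case (Suc n)
  have X': "cmat X \<in> carrier_mat d d" using X by simp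
  note c = tensor_power_carrier[OF X, of n]
  note c' = tensor_power_carrier[OF X', of n]
  show ?case
  proof (rule eq_matI)
    fix i j assume "i < dim_row (cmat (tensor_power X (Suc n)))" "j < dim_col (cmat (tensor_power X (Suc n)))"
    then have b: "i < d * d ^ n" "j < d * d ^ n" using kronecker_carrier[OF X c] by auto
    note bnd = nat_mult_div_mod_bounds[OF b(1)] nat_mult_div_mod_bounds[OF b(2)]
    have k: "kronecker X (tensor_power X n) \<in> carrier_mat (d * d ^ n) (d * d ^ n)" by (rule kronecker_carrier[OF X c])
    show "tensor_power (cmat X) (Suc n) $$ (i, j) = cmat (tensor_power X (Suc n)) $$ (i, j)"
      using b bnd X c k by (simp add: kronecker_index[OF X' c'] kronecker_index[OF X c]) (simp add: Suc)
  qed (use X in \<open>auto simp: kronecker_def Suc\<close>)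
qed

text \<open>The chi-square method: the signed mixture of n-copy states is measured in the norm
  weighted by the inverse of the n-copy state with spectrum \<open>s\<close>. That state has trace
  1, so the other Cauchy-Schwarz factor disappears. In the expanded square each pair contributes the
  n-th power of a single-copy inner product.\<close>

lemma outcome_prob_sum_chi_square:
  fixes X :: "'w \<Rightarrow> real mat" and c :: "'w \<Rightarrow> real" and s :: "nat \<Rightarrow> real"
  assumes M: "effect (d ^ n) M" and "d > 0"
    and s: "\<And>i. i < d \<Longrightarrow> s i \<ge> 0" "(\<Sum>i<d. s i) = 1"
    and X: "\<And>\<omega>. \<omega> \<in> \<Omega> \<Longrightarrow> X \<omega> \<in> carrier_mat d d"
    and supp: "\<And>\<omega> i j. \<omega> \<in> \<Omega> \<Longrightarrow> i < d \<Longrightarrow> j < d \<Longrightarrow> s i = 0 \<Longrightarrow> X \<omega> $$ (i, j) = 0"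
  shows "(\<Sum>\<omega>\<in>\<Omega>. c \<omega> * outcome_prob M (tensor_power (cmat (X \<omega>)) n))\<^sup>2
    \<le> (\<Sum>\<omega>\<in>\<Omega>. \<Sum>\<omega>'\<in>\<Omega>. c \<omega> * c \<omega>' * (\<Sum>i<d. \<Sum>j<d. X \<omega> $$ (i, j) * X \<omega>' $$ (i, j) / s i) ^ n)"
proof -
  define W where "W = mat d d (\<lambda>(i, j). if i = j then s i else 0)"
  have W: "W \<in> carrier_mat d d" and Wii: "\<And>i. i < d \<Longrightarrow> W $$ (i, i) = s i" by (auto simp: W_def)
  let ?N = "d ^ n"
  define w where "w = (\<lambda>i. tensor_power W n $$ (i, i))"
  define D where "D = (\<lambda>i j. \<Sum>\<omega>\<in>\<Omega>. c \<omega> * tensor_power (X \<omega>) n $$ (i, j))"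
  have Mc: "M \<in> carrier_mat ?N ?N" using M by (simp add: effect_def psd_mat_def)
  have "(\<Sum>\<omega>\<in>\<Omega>. c \<omega> * outcome_prob M (tensor_power (cmat (X \<omega>)) n))
     = (\<Sum>\<omega>\<in>\<Omega>. \<Sum>i<?N. \<Sum>j<?N. Re (M $$ (i, j)) * (c \<omega> * tensor_power (X \<omega>) n $$ (j, i)))"
  proof (intro sum.cong refl)
    fix \<omega> assume "\<omega> \<in> \<Omega>"
    then have t: "tensor_power (X \<omega>) n \<in> carrier_mat ?N ?N" using X tensor_power_carrier by blast
    show "c \<omega> * outcome_prob M (tensor_power (cmat (X \<omega>)) n)
       = (\<Sum>i<?N. \<Sum>j<?N. Re (M $$ (i, j)) * (c \<omega> * tensor_power (X \<omega>) n $$ (j, i)))"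
      using t tensor_power_cmat[OF X[OF \<open>\<omega> \<in> \<Omega>\<close>], of n]
      by (simp add: outcome_prob_entries[OF Mc] sum_distrib_left mult_ac)
  qed
  also have "\<dots> = (\<Sum>i<?N. \<Sum>j<?N. Re (M $$ (i, j)) * D j i)"
    by (subst sum.swap, rule sum.cong[OF refl], subst sum.swap) (simp add: D_def sum_distrib_left)
  finally have eq: "(\<Sum>\<omega>\<in>\<Omega>. c \<omega> * outcome_prob M (tensor_power (cmat (X \<omega>)) n))
      = (\<Sum>i<?N. \<Sum>j<?N. Re (M $$ (i, j)) * D j i)" .
  have "(\<Sum>i<?N. \<Sum>j<?N. Re (M $$ (i, j)) * D j i)\<^sup>2 \<le> (\<Sum>i<?N. w i) * (\<Sum>i<?N. \<Sum>j<?N. (D i j)\<^sup>2 / w i)"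
  proof (rule weighted_Cauchy_Schwarz_effect[OF M])
    show "w i \<ge> 0" if "i < ?N" for i
      unfolding w_def by (rule tensor_power_diag_nonneg[OF W _ that]) (simp add: Wii s)
    show "D i j = 0" if "i < ?N" "j < ?N" "w i = 0" for i j
      unfolding D_def
      using tensor_power_support[OF W X _ that(1,2)] that(3) supp
      by (intro sum.neutral ballI) (simp add: w_def Wii)
  qed
  also have "(\<Sum>i<?N. w i) = 1"
    using s(2) by (simp add: w_def tensor_power_trace[OF W \<open>d > 0\<close>] Wii)
  also have "(\<Sum>i<?N. \<Sum>j<?N. (D i j)\<^sup>2 / w i) = (\<Sum>i<?N. \<Sum>j<?N. \<Sum>\<omega>\<in>\<Omega>. \<Sum>\<omega>'\<in>\<Omega>.
      c \<omega> * c \<omega>' * (tensor_power (X \<omega>) n $$ (i, j) * tensor_power (X \<omega>') n $$ (i, j) / w i))"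
    by (simp add: D_def power2_eq_square sum_product sum_divide_distrib mult_ac)
  also have "\<dots> = (\<Sum>\<omega>\<in>\<Omega>. \<Sum>\<omega>'\<in>\<Omega>. c \<omega> * c \<omega>' * (\<Sum>i<?N. \<Sum>j<?N.
      tensor_power (X \<omega>) n $$ (i, j) * tensor_power (X \<omega>') n $$ (i, j) / w i))"
  proof -
    have "(\<Sum>i<?N. \<Sum>j<?N. \<Sum>\<omega>\<in>\<Omega>. \<Sum>\<omega>'\<in>\<Omega>. F \<omega> \<omega>' i j)
      = (\<Sum>\<omega>\<in>\<Omega>. \<Sum>\<omega>'\<in>\<Omega>. \<Sum>i<?N. \<Sum>j<?N. F \<omega> \<omega>' i j)" for F :: "'w \<Rightarrow> 'w \<Rightarrow> nat \<Rightarrow> nat \<Rightarrow> real"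
      unfolding sum.cartesian_product
      by (rule sum.reindex_bij_witness[of _ "\<lambda>(\<omega>, \<omega>', i, j). (i, j, \<omega>, \<omega>')" "\<lambda>(i, j, \<omega>, \<omega>'). (\<omega>, \<omega>', i, j)"]) auto
    then show ?thesis by (simp add: sum_distrib_left)
  qed
  also have "\<dots> = (\<Sum>\<omega>\<in>\<Omega>. \<Sum>\<omega>'\<in>\<Omega>. c \<omega> * c \<omega>' * (\<Sum>i<d. \<Sum>j<d. X \<omega> $$ (i, j) * X \<omega>' $$ (i, j) / s i) ^ n)"
  proof (intro sum.cong refl)
    fix \<omega> \<omega>' assume h: "\<omega> \<in> \<Omega>" "\<omega>' \<in> \<Omega>"
    have "(\<Sum>i<?N. \<Sum>j<?N. tensor_power (X \<omega>) n $$ (i, j) * tensor_power (X \<omega>') n $$ (i, j) / w i)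
       = (\<Sum>i<d. \<Sum>j<d. X \<omega> $$ (i, j) * X \<omega>' $$ (i, j) / W $$ (i, i)) ^ n"
      unfolding w_def
      by (rule sum_tensor_power_entries[OF X[OF h(1)] X[OF h(2)] W \<open>d > 0\<close>, where f = "\<lambda>a b c. a * b / c"]) auto
    then show "c \<omega> * c \<omega>' * (\<Sum>i<?N. \<Sum>j<?N. tensor_power (X \<omega>) n $$ (i, j) * tensor_power (X \<omega>') n $$ (i, j) / w i)
      = c \<omega> * c \<omega>' * (\<Sum>i<d. \<Sum>j<d. X \<omega> $$ (i, j) * X \<omega>' $$ (i, j) / s i) ^ n"
      by (simp add: Wii)
  qed
  finally show ?thesis by (simp add: eq)
qed

section \<open>Frobenius norm and almost invariant effects\<close>

definition frob2 :: "complex mat \<Rightarrow> real" where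
  "frob2 A = (\<Sum>i<dim_row A. \<Sum>j<dim_col A. (cmod (A $$ (i, j)))\<^sup>2)"

lemma frob2_nonneg: "frob2 A \<ge> 0"
  by (auto simp: frob2_def intro!: sum_nonneg)

lemma frob2_entry: 
  assumes "i < dim_row A" "j < dim_col A"
  shows "(cmod (A $$ (i, j)))\<^sup>2 \<le> frob2 A"
proof -
  have "(cmod (A $$ (i, j)))\<^sup>2 \<le> (\<Sum>j<dim_col A. (cmod (A $$ (i, j)))\<^sup>2)"
    using assms by (intro member_le_sum) auto
  also have "\<dots> \<le> frob2 A"
    unfolding frob2_def using assms
    by (intro member_le_sum[of i _ "\<lambda>i. \<Sum>j<dim_col A. (cmod (A $$ (i, j)))\<^sup>2"]) (auto intro: sum_nonneg)
  finally show ?thesis .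
qed

lemma frob2_trace: "complex_of_real (frob2 A) = mat_trace (mat_adjoint A * A)"
proof -
  have "mat_trace (mat_adjoint A * A) = (\<Sum>j<dim_col A. \<Sum>i<dim_row A. cnj (A $$ (i, j)) * A $$ (i, j))"
    by (simp add: mat_trace_def scalar_prod_def atLeast0LessThan)
  also have "\<dots> = complex_of_real (frob2 A)"
    unfolding frob2_def by (subst sum.swap) (simp add: complex_norm_square mult.commute del: of_real_power)
  finally show ?thesis by simp
qed

lemma frob2_unitary_conj:
  assumes A: "A \<in> carrier_mat N N" and V: "V \<in> carrier_mat N N" "V * mat_adjoint V = 1\<^sub>m N"
  shows "frob2 (mat_adjoint V * A * V) = frob2 A"
proof -
  let ?V = "mat_adjoint V" and ?A = "mat_adjoint A"
  have V': "?V \<in> carrier_mat N N" and A': "?A \<in> carrier_mat N N" using V A by auto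
  note c = A V(1) V' A'
  have "mat_adjoint (?V * A * V) * (?V * A * V) = ?V * ?A * (V * ?V) * A * V"
    using c by (simp add: mat_adjoint_mult assoc_mult_mat[of _ N N _ N _ N] mult_carrier_mat[of _ N N _ N])
  also have "\<dots> = ?V * (?A * A * V)"
    using c by (simp add: V(2) assoc_mult_mat[of _ N N _ N _ N] mult_carrier_mat[of _ N N _ N])
  finally have "complex_of_real (frob2 (?V * A * V)) = mat_trace (?V * (?A * A * V))"
    by (simp add: frob2_trace)
  also have "\<dots> = mat_trace (?A * A * V * ?V)"
    using c by (intro mat_trace_comm[of _ N N]) (auto intro!: mult_carrier_mat[of _ N N _ N])
  also have "?A * A * V * ?V = ?A * A"
    using c by (simp add: V(2) assoc_mult_mat[of _ N N _ N _ N] mult_carrier_mat[of _ N N _ N])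
  finally show ?thesis by (simp flip: frob2_trace)
qed

lemma frob2_parallelogram:
  assumes "A \<in> carrier_mat N N" "B \<in> carrier_mat N N"
  shows "frob2 ((1/2) \<cdot>\<^sub>m (A + B)) + frob2 (A - B) / 4 = (frob2 A + frob2 B) / 2"
proof -
  have p: "(cmod ((a + b) / 2))\<^sup>2 + (cmod (a - b))\<^sup>2 / 4 = ((cmod a)\<^sup>2 + (cmod b)\<^sup>2) / 2" for a b
    unfolding cmod_power2 by (simp add: power2_eq_square field_simps)
  have "frob2 ((1/2) \<cdot>\<^sub>m (A + B)) + frob2 (A - B) / 4
     = (\<Sum>i<N. \<Sum>j<N. (cmod ((A $$ (i, j) + B $$ (i, j)) / 2))\<^sup>2 + (cmod (A $$ (i, j) - B $$ (i, j)))\<^sup>2 / 4)"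
    using assms by (simp add: frob2_def sum.distrib sum_divide_distrib)
  also have "\<dots> = (frob2 A + frob2 B) / 2"
    unfolding p using assms by (simp add: frob2_def sum.distrib sum_divide_distrib add_divide_distrib)
  finally show ?thesis .
qed

text \<open>A substitute for averaging over the Haar measure: an almost norm-minimal element of a convex set
  that is stable under a group of unitaries is almost invariant, by the parallelogram identity.\<close>

lemma exists_almost_invariant:
  fixes K G :: "complex mat set"
  assumes "K \<noteq> {}" "K \<subseteq> carrier_mat N N" "\<eta> > 0"
    and mid: "\<And>A B. A \<in> K \<Longrightarrow> B \<in> K \<Longrightarrow> (1/2) \<cdot>\<^sub>m (A + B) \<in> K"
    and conj: "\<And>A V. A \<in> K \<Longrightarrow> V \<in> G \<Longrightarrow> mat_adjoint V * A * V \<in> K"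
    and unit: "\<And>V. V \<in> G \<Longrightarrow> V \<in> carrier_mat N N \<and> V * mat_adjoint V = 1\<^sub>m N"
  obtains M where "M \<in> K" "\<And>V. V \<in> G \<Longrightarrow> frob2 (M - mat_adjoint V * M * V) \<le> \<eta>"
proof -
  define m where "m = Inf (frob2 ` K)"
  have bdd: "bdd_below (frob2 ` K)" by (rule bdd_belowI[of _ 0]) (auto simp: frob2_nonneg)
  have low: "m \<le> frob2 A" if "A \<in> K" for A
    unfolding m_def using that bdd by (intro cInf_lower) auto
  \<comment> \<open>The factor 1/4 in the parallelogram identity turns a defect \<eta>/4 from the
    infimum into squared distance at most \<eta> between two elements of equal norm.\<close>
  obtain M where M: "M \<in> K" "frob2 M < m + \<eta> / 4"
    using cInf_lessD[of "frob2 ` K" "m + \<eta> / 4"] assms(1,3) by (auto simp: m_def)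
  have "frob2 (M - mat_adjoint V * M * V) \<le> \<eta>" if V: "V \<in> G" for V
  proof -
    let ?M = "mat_adjoint V * M * V"
    have MV: "?M \<in> K" using conj M V by blast
    have c: "M \<in> carrier_mat N N" "?M \<in> carrier_mat N N" using M MV assms(2) by auto
    have "frob2 ?M = frob2 M" using frob2_unitary_conj[OF c(1)] unit[OF V] by blast
    then show ?thesis
      using frob2_parallelogram[OF c] low[OF mid[OF M(1) MV]] M(2) by simp
  qed
  then show thesis using that M by blast
qed

text \<open>Cyclicity of the trace moves the rotation from the effect to the state.\<close>

lemma outcome_prob_conj:
  assumes "M \<in> carrier_mat N N" "V \<in> carrier_mat N N" "T \<in> carrier_mat N N"
  shows "outcome_prob (mat_adjoint V * M * V) T = outcome_prob M (V * T * mat_adjoint V)"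
proof -
  note c = assms mat_adjoint_carrier[OF assms(2)]
  have "mat_adjoint V * M * V * T = mat_adjoint V * (M * V * T)"
    using c by (simp add: assoc_mult_mat[of _ N N _ N _ N] mult_carrier_mat[of _ N N _ N])
  moreover have "mat_trace (mat_adjoint V * (M * V * T)) = mat_trace (M * V * T * mat_adjoint V)"
    by (rule mat_trace_comm[of _ N N]) (use c in \<open>auto intro!: mult_carrier_mat[of _ N N _ N]\<close>)
  ultimately have "mat_trace (mat_adjoint V * M * V * T) = mat_trace (M * V * T * mat_adjoint V)"
    by simp
  also have "M * V * T * mat_adjoint V = M * (V * T * mat_adjoint V)"
    using c by (simp add: assoc_mult_mat[of _ N N _ N _ N] mult_carrier_mat[of _ N N _ N])
  finally show ?thesis by (simp add: outcome_prob_def)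
qed

text \<open>A crude entrywise estimate. The sum of the moduli of \<open>T\<close> may be huge, but
  \<eta> will be chosen only after the finitely many states \<open>T\<close> are known.\<close>

lemma outcome_prob_diff_le:
  assumes "M \<in> carrier_mat N N" "M' \<in> carrier_mat N N" "T \<in> carrier_mat N N" "frob2 (M - M') \<le> \<eta>\<^sup>2" "\<eta> \<ge> 0"
  shows "\<bar>outcome_prob M T - outcome_prob M' T\<bar> \<le> \<eta> * (\<Sum>i<N. \<Sum>j<N. cmod (T $$ (i, j)))"
proof -
  have e: "cmod (M $$ (i, j) - M' $$ (i, j)) \<le> \<eta>" if "i < N" "j < N" for i j
  proof -
    have "(cmod ((M - M') $$ (i, j)))\<^sup>2 \<le> frob2 (M - M')"
      using frob2_entry[of i "M - M'" j] assms that by auto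
    also have "(M - M') $$ (i, j) = M $$ (i, j) - M' $$ (i, j)"
      using assms that by auto
    also note \<open>frob2 (M - M') \<le> \<eta>\<^sup>2\<close>
    finally have "(cmod (M $$ (i, j) - M' $$ (i, j)))\<^sup>2 \<le> \<eta>\<^sup>2" .
    then show ?thesis by (rule power2_le_imp_le) fact
  qed
  have "\<bar>outcome_prob M T - outcome_prob M' T\<bar>
     = \<bar>\<Sum>i<N. \<Sum>j<N. Re ((M $$ (i, j) - M' $$ (i, j)) * T $$ (j, i))\<bar>"
    using assms by (simp add: outcome_prob_entries sum_subtractf left_diff_distrib)
  also have "\<dots> \<le> (\<Sum>i<N. \<Sum>j<N. \<bar>Re ((M $$ (i, j) - M' $$ (i, j)) * T $$ (j, i))\<bar>)"
    by (rule order_trans[OF sum_abs], intro sum_mono, rule sum_abs)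
  also have "\<dots> \<le> (\<Sum>i<N. \<Sum>j<N. \<eta> * cmod (T $$ (j, i)))"
  proof (intro sum_mono)
    fix i j assume "i \<in> {..<N}" "j \<in> {..<N}"
    then have "cmod (M $$ (i, j) - M' $$ (i, j)) * cmod (T $$ (j, i)) \<le> \<eta> * cmod (T $$ (j, i))"
      by (intro mult_right_mono e) auto
    then show "\<bar>Re ((M $$ (i, j) - M' $$ (i, j)) * T $$ (j, i))\<bar> \<le> \<eta> * cmod (T $$ (j, i))"
      by (metis abs_Re_le_cmod norm_mult order_trans)
  qed
  also have "\<dots> = \<eta> * (\<Sum>i<N. \<Sum>j<N. cmod (T $$ (i, j)))"
    by (subst sum.swap) (simp add: sum_distrib_left)
  finally show ?thesis .
qed

subsection \<open>Spectral decomposition, trace norm and rank\<close>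

definition dmat :: "nat \<Rightarrow> (nat \<Rightarrow> real) \<Rightarrow> complex mat" where
  "dmat n a = mat n n (\<lambda>(i, j). if i = j then complex_of_real (a i) else 0)"

lemma dmat_carrier [simp]: "dmat n a \<in> carrier_mat n n"
  by (simp add: dmat_def)

lemma dmat_dim [simp]: "dim_row (dmat n a) = n" "dim_col (dmat n a) = n"
  by (simp_all add: dmat_def)

lemma dmat_adjoint [simp]: "mat_adjoint (dmat n a) = dmat n a"
  by (rule eq_matI) (auto simp: dmat_def)

lemma sum_if_eq_lessThan:
  fixes f :: "nat \<Rightarrow> 'a::comm_monoid_add"
  assumes "i < n"
  shows "(\<Sum>l<n. if i = l then f l else 0) = f i" "(\<Sum>l<n. if l = i then f l else 0) = f i"
  using assms by auto

lemma dmat_mult: "dmat n a * dmat n b = dmat n (\<lambda>i. a i * b i)"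
  by (rule eq_matI) (auto simp: dmat_def scalar_prod_def atLeast0LessThan if_distrib[where f = "\<lambda>x. x * _"] sum_if_eq_lessThan cong: if_cong)

lemma dmat_one: "dmat n (\<lambda>_. 1) = 1\<^sub>m n"
  by (rule eq_matI) (auto simp: dmat_def)

lemma dmat_add: "dmat n a + dmat n b = dmat n (\<lambda>i. a i + b i)"
  by (rule eq_matI) (auto simp: dmat_def)

definition unitary_mat :: "nat \<Rightarrow> complex mat \<Rightarrow> bool" where
  "unitary_mat n U \<longleftrightarrow> U \<in> carrier_mat n n \<and> mat_adjoint U * U = 1\<^sub>m n \<and> U * mat_adjoint U = 1\<^sub>m n"

lemma unitary_matI:
  assumes "U \<in> carrier_mat n n" "mat_adjoint U * U = 1\<^sub>m n"
  shows "unitary_mat n U"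
  using assms mat_mult_left_right_inverse[of "mat_adjoint U" n U] by (auto simp: unitary_mat_def)

lemma unitary_mat_one: "unitary_mat n (1\<^sub>m n)"
  by (simp add: unitary_mat_def)

lemma unitary_mat_adjoint: "unitary_mat n U \<Longrightarrow> unitary_mat n (mat_adjoint U)"
  by (auto simp: unitary_mat_def)

lemma assoc_mult_square:
  fixes A B C :: "'a::semiring_0 mat"
  assumes "A \<in> carrier_mat n n" "B \<in> carrier_mat n n" "C \<in> carrier_mat n n"
  shows "A * B * C = A * (B * C)" "A * B \<in> carrier_mat n n"
  using assms assoc_mult_mat mult_carrier_mat by blast+

lemma unitary_mat_cancel:
  assumes "unitary_mat n U" "X \<in> carrier_mat n n"
  shows "mat_adjoint U * (U * X) = X" "U * (mat_adjoint U * X) = X"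
  using assms assoc_mult_square(1)[of "mat_adjoint U" n U X] assoc_mult_square(1)[of U n "mat_adjoint U" X]
  by (auto simp: unitary_mat_def)

lemma unitary_mat_mult:
  assumes "unitary_mat n U" "unitary_mat n V"
  shows "unitary_mat n (U * V)"
proof (rule unitary_matI)
  have c: "U \<in> carrier_mat n n" "V \<in> carrier_mat n n" "mat_adjoint U \<in> carrier_mat n n" "mat_adjoint V \<in> carrier_mat n n"
    using assms by (auto simp: unitary_mat_def)
  show "U * V \<in> carrier_mat n n" using c by simp
  have "mat_adjoint (U * V) * (U * V) = mat_adjoint V * V"
    using c by (simp add: mat_adjoint_mult assoc_mult_square[where n = n] unitary_mat_cancel[OF assms(1)])
  then show "mat_adjoint (U * V) * (U * V) = 1\<^sub>m n"
    using assms by (simp add: unitary_mat_def)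
qed

lemma unitary_conj_mult:
  fixes A :: "complex mat"
  assumes "W \<in> carrier_mat n n" "U \<in> carrier_mat n n" "A \<in> carrier_mat n n"
  shows "mat_adjoint (W * U) * A * (W * U) = mat_adjoint U * ((mat_adjoint W * A * W) * U)"
  using assms mat_adjoint_carrier[OF assms(1)] mat_adjoint_carrier[OF assms(2)]
  by (simp add: mat_adjoint_mult assoc_mult_square[where n = n])

lemma unitary_mat_tensor_power:
  assumes "unitary_mat d U" "d > 0"
  shows "unitary_mat (d ^ n) (tensor_power U n)"
proof -
  have c: "U \<in> carrier_mat d d" "mat_adjoint U \<in> carrier_mat d d" using assms by (auto simp: unitary_mat_def)
  have "mat_adjoint (tensor_power U n) * tensor_power U n = tensor_power (mat_adjoint U * U) n"
    using tensor_power_mult[OF c(2,1) assms(2)] c by (simp add: tensor_power_adjoint)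
  also have "\<dots> = 1\<^sub>m (d ^ n)" using assms by (simp add: unitary_mat_def tensor_power_one)
  finally show ?thesis using unitary_matI tensor_power_carrier c by blast
qed

text \<open>Complete v to a basis and apply Gram-Schmidt, which leaves the first vector unchanged.
  The result is orthogonal but not normalised, so the columns are divided by their lengths
  \<open>r j\<close>; this is the origin of the scalar c.\<close>

lemma orthonormal_completion:
  fixes v :: "complex vec"
  assumes v: "v \<in> carrier_vec n" "v \<noteq> 0\<^sub>v n" and n: "n > 0"
  obtains W c where "unitary_mat n W" "c \<noteq> 0" "\<And>i. i < n \<Longrightarrow> W $$ (i, 0) = c * v $ i"
proof -
  interpret cof_vec_space n "TYPE(complex)" .
  define b where "b = basis_completion v"
  define ws where "ws = gram_schmidt n b"
  from basis_completion[OF v, folded b_def]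
  have dist_b: "distinct b" and indep: "\<not> lin_dep (set b)" and b: "set b \<subseteq> carrier_vec n"
    and hdb: "hd b = v" and len_b: "length b = n" by auto
  from hdb len_b n obtain vs where bv: "b = v # vs" by (cases b, auto)
  from gram_schmidt_result[OF b dist_b indep refl, folded ws_def]
  have ws: "set ws \<subseteq> carrier_vec n" "corthogonal ws" "length ws = n" by (auto simp: len_b)
  from gram_schmidt_hd[OF v(1), of vs, folded bv] have hdws: "hd ws = v" unfolding ws_def .
  have ws0: "ws ! 0 = v" using hdws ws(3) n by (metis hd_conv_nth length_greater_0_conv)
  have wsc: "ws ! i \<in> carrier_vec n" if "i < n" for i using ws that by auto
  define r where "r = (\<lambda>i. sqrt (Re (ws ! i \<bullet>c ws ! i)))"
  have sq: "ws ! i \<bullet>c ws ! i = complex_of_real (\<Sum>l<n. (cmod (ws ! i $ l))\<^sup>2)" if "i < n" for i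
    using wsc[OF that] by (simp add: scalar_prod_def atLeast0LessThan complex_norm_square del: of_real_power)
  have r2: "complex_of_real (r i) * complex_of_real (r i) = ws ! i \<bullet>c ws ! i" if "i < n" for i
    unfolding r_def sq[OF that] by (simp add: sum_nonneg flip: of_real_mult)
  have r0: "r i \<noteq> 0" if "i < n" for i
    using corthogonalD[OF ws(2), of i i] r2[OF that] that ws(3) by auto
  define W where "W = mat n n (\<lambda>(i, j). ws ! j $ i / complex_of_real (r j))"
  have W: "W \<in> carrier_mat n n" by (simp add: W_def)
  have "mat_adjoint W * W = 1\<^sub>m n"
  proof (rule eq_matI)
    fix i j assume "i < dim_row (1\<^sub>m n :: complex mat)" "j < dim_col (1\<^sub>m n :: complex mat)"
    then have ij: "i < n" "j < n" by auto
    have "(mat_adjoint W * W) $$ (i, j) = (\<Sum>l<n. ws ! j $ l * cnj (ws ! i $ l)) / (complex_of_real (r i) * complex_of_real (r j))"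
      using ij W by (simp add: scalar_prod_def atLeast0LessThan sum_divide_distrib) (simp add: W_def mult_ac)
    also have "(\<Sum>l<n. ws ! j $ l * cnj (ws ! i $ l)) = ws ! j \<bullet>c ws ! i"
      using wsc[OF ij(1)] wsc[OF ij(2)] by (simp add: scalar_prod_def atLeast0LessThan)
    also have "ws ! j \<bullet>c ws ! i / (complex_of_real (r i) * complex_of_real (r j)) = 1\<^sub>m n $$ (i, j)"
      using corthogonalD[OF ws(2), of j i] ij ws(3) r2[of i] r0[of i] by auto
    finally show "(mat_adjoint W * W) $$ (i, j) = 1\<^sub>m n $$ (i, j)" .
  qed (use W in auto)
  then have "unitary_mat n W" using W by (rule unitary_matI[rotated])
  moreover have "W $$ (i, 0) = inverse (complex_of_real (r 0)) * v $ i" if "i < n" for i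
    using that n by (simp add: W_def ws0 field_simps)
  ultimately show thesis using that[of W "inverse (complex_of_real (r 0))"] r0[of 0] n by simp
qed

lemma hermitian_entry:
  fixes A :: "complex mat"
  assumes "A \<in> carrier_mat n n" "mat_adjoint A = A" "i < n" "j < n"
  shows "cnj (A $$ (j, i)) = A $$ (i, j)"
  using mat_adjoint_index[of i A j] assms by simp

lemma complex_eigenvector_exists:
  fixes A :: "complex mat"
  assumes A: "A \<in> carrier_mat n n" and n: "n > 0"
  obtains v e where "v \<in> carrier_vec n" "v \<noteq> 0\<^sub>v n" "A *\<^sub>v v = e \<cdot>\<^sub>v v"
proof -
  have "degree (char_poly A) > 0" using degree_monic_char_poly[OF A] n by simp
  then obtain e where "poly (char_poly A) e = 0"
    using fundamental_theorem_of_algebra[of "char_poly A"] constant_degree[of "char_poly A"] by auto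
  then show thesis
    using eigenvalue_root_char_poly[OF A, of e] A that by (auto simp: eigenvalue_def eigenvector_def)
qed

text \<open>The direct sum of the 1 x 1 identity and \<open>U\<close>; it lifts the diagonalisation
  of the lower right corner in the deflation argument.\<close>

definition bordered :: "'a::{zero, one} mat \<Rightarrow> 'a mat" where
  "bordered U = mat (Suc (dim_row U)) (Suc (dim_col U))
     (\<lambda>(i, j). if i = 0 \<or> j = 0 then (if i = j then 1 else 0) else U $$ (i - 1, j - 1))"

lemma bordered_unitary:
  assumes "unitary_mat m U"
  shows "unitary_mat (Suc m) (bordered U)"
proof (rule unitary_matI)
  have U: "U \<in> carrier_mat m m" "mat_adjoint U * U = 1\<^sub>m m" using assms by (auto simp: unitary_mat_def)
  show c: "bordered U \<in> carrier_mat (Suc m) (Suc m)" using U by (auto simp: bordered_def)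
  show "mat_adjoint (bordered U) * bordered U = 1\<^sub>m (Suc m)"
  proof (rule eq_matI)
    fix i j assume "i < dim_row (1\<^sub>m (Suc m) :: complex mat)" "j < dim_col (1\<^sub>m (Suc m) :: complex mat)"
    then have ij: "i < Suc m" "j < Suc m" by auto
    have "(mat_adjoint U * U) $$ (i', j') = (\<Sum>l<m. cnj (U $$ (l, i')) * U $$ (l, j'))" if "i' < m" "j' < m" for i' j'
      using that U(1) by (simp add: scalar_prod_def atLeast0LessThan)
    then have uu: "(\<Sum>l<m. cnj (U $$ (l, i')) * U $$ (l, j')) = (if i' = j' then 1 else 0)" if "i' < m" "j' < m" for i' j'
      using that U(2) by simp
    have "(mat_adjoint (bordered U) * bordered U) $$ (i, j) = (\<Sum>l<Suc m. cnj (bordered U $$ (l, i)) * bordered U $$ (l, j))"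
      using ij c by (simp add: scalar_prod_def atLeast0LessThan)
    also have "\<dots> = 1\<^sub>m (Suc m) $$ (i, j)"
      unfolding sum.lessThan_Suc_shift using ij U(1) uu by (cases i; cases j) (auto simp: bordered_def)
    finally show "(mat_adjoint (bordered U) * bordered U) $$ (i, j) = 1\<^sub>m (Suc m) $$ (i, j)" .
  qed (use c in auto)
qed

text \<open>Deflation. In an orthonormal basis that starts with an eigenvector, the eigenvalue
  equation clears the first column below the diagonal; being Hermitian then clears the first row and
  makes the eigenvalue real. The remaining corner is Hermitian of smaller size.\<close>

lemma hermitian_spectral_decomposition:
  fixes A :: "complex mat"
  assumes "A \<in> carrier_mat n n" "mat_adjoint A = A"
  obtains U a where "unitary_mat n U" "A = U * dmat n a * mat_adjoint U"
proof -
  have "\<exists>U a. unitary_mat n U \<and> mat_adjoint U * A * U = dmat n a"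
    using assms
  proof (induction n arbitrary: A)
    case 0
    show ?case
      by (rule exI[of _ "1\<^sub>m 0"], rule exI[of _ "\<lambda>_. 0"]) (use 0 in \<open>auto simp: unitary_mat_one\<close>)
  next
    case (Suc m)
    let ?n = "Suc m"
    note A = Suc.prems
    obtain v e where v: "v \<in> carrier_vec ?n" "v \<noteq> 0\<^sub>v ?n" "A *\<^sub>v v = e \<cdot>\<^sub>v v"
      using complex_eigenvector_exists[OF A(1)] by auto
    obtain W c where W: "unitary_mat ?n W" "\<And>i. i < ?n \<Longrightarrow> W $$ (i, 0) = c * v $ i"
      using orthonormal_completion[OF v(1,2) zero_less_Suc] by metis
    have Wc: "W \<in> carrier_mat ?n ?n" "mat_adjoint W \<in> carrier_mat ?n ?n" and WW: "mat_adjoint W * W = 1\<^sub>m ?n"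
      using W(1) by (auto simp: unitary_mat_def)
    define B where "B = mat_adjoint W * A * W"
    have B: "B \<in> carrier_mat ?n ?n" using A Wc by (simp add: B_def assoc_mult_square[where n = ?n])
    have Bh: "mat_adjoint B = B"
      using A Wc by (simp add: B_def mat_adjoint_mult assoc_mult_square[where n = ?n])
    have AW: "(A * W) $$ (i, 0) = e * W $$ (i, 0)" if "i < ?n" for i
    proof -
      have "(A * W) $$ (i, 0) = c * (\<Sum>l<?n. A $$ (i, l) * v $ l)"
        unfolding sum_distrib_left using that A(1) Wc(1) W(2) by (simp add: scalar_prod_def atLeast0LessThan mult_ac)
      also have "(\<Sum>l<?n. A $$ (i, l) * v $ l) = (A *\<^sub>v v) $ i"
        using that A(1) v(1) by (simp add: scalar_prod_def atLeast0LessThan)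
      also have "\<dots> = e * v $ i" using v that by simp
      finally show ?thesis using W(2)[OF that] by simp
    qed
    have B0: "B $$ (i, 0) = (if i = 0 then e else 0)" if "i < ?n" for i
    proof -
      have "B $$ (i, 0) = (mat_adjoint W * (A * W)) $$ (i, 0)"
        using A Wc by (simp add: B_def assoc_mult_square[where n = ?n])
      also have "\<dots> = (\<Sum>l<?n. mat_adjoint W $$ (i, l) * (A * W) $$ (l, 0))"
        using that A(1) Wc(1) by (simp add: scalar_prod_def atLeast0LessThan)
      also have "\<dots> = (\<Sum>l<?n. mat_adjoint W $$ (i, l) * (e * W $$ (l, 0)))"
        by (intro sum.cong refl) (simp add: AW del: index_mult_mat(1))
      also have "\<dots> = e * (mat_adjoint W * W) $$ (i, 0)"
        unfolding sum_distrib_left using that Wc by (simp add: scalar_prod_def atLeast0LessThan mult_ac sum_distrib_left del: sum.lessThan_Suc)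
      finally show ?thesis unfolding WW using that by simp
    qed
    have B0': "B $$ (0, i) = (if i = 0 then e else 0)" if "i < ?n" for i
    proof -
      have "B $$ (0, i) = cnj (B $$ (i, 0))"
        using arg_cong[OF Bh, of "\<lambda>X. X $$ (0, i)"] that B by simp
      moreover have "cnj e = e"
        using arg_cong[OF Bh, of "\<lambda>X. X $$ (0, 0)"] B B0[of 0] by simp
      ultimately show ?thesis using B0[OF that] by simp
    qed
    have e_real: "e = complex_of_real (Re e)"
      using arg_cong[OF Bh, of "\<lambda>X. X $$ (0, 0)"] B B0[of 0] by (simp add: complex_eq_iff)
    define C where "C = mat m m (\<lambda>(i, j). B $$ (Suc i, Suc j))"
    have C: "C \<in> carrier_mat m m" by (simp add: C_def)
    have Ch: "mat_adjoint C = C"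
    proof (rule eq_matI)
      fix i j assume "i < dim_row C" "j < dim_col C"
      then show "mat_adjoint C $$ (i, j) = C $$ (i, j)"
        using arg_cong[OF Bh, of "\<lambda>X. X $$ (Suc i, Suc j)"] B C by (simp add: C_def)
    qed (use C in auto)
    obtain U a where U: "unitary_mat m U" and D: "mat_adjoint U * C * U = dmat m a"
      using Suc.IH[OF C Ch] by blast
    have Uc: "U \<in> carrier_mat m m" "mat_adjoint U \<in> carrier_mat m m" using U by (auto simp: unitary_mat_def)
    let ?U = "bordered U"
    have bU: "unitary_mat ?n ?U" by (rule bordered_unitary[OF U])
    then have bc: "?U \<in> carrier_mat ?n ?n" "mat_adjoint ?U \<in> carrier_mat ?n ?n" by (auto simp: unitary_mat_def)
    have "mat_adjoint ?U * (B * ?U) = dmat ?n (case_nat (Re e) a)"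
    proof (rule eq_matI)
      fix i j assume "i < dim_row (dmat ?n (case_nat (Re e) a))" "j < dim_col (dmat ?n (case_nat (Re e) a))"
      then have ij: "i < ?n" "j < ?n" by auto
      have BU: "(B * ?U) $$ (k, j) = (\<Sum>l<?n. B $$ (k, l) * ?U $$ (l, j))" if "k < ?n" for k
        using that ij B bc by (simp add: scalar_prod_def atLeast0LessThan)
      have "(mat_adjoint ?U * (B * ?U)) $$ (i, j) = (\<Sum>k<?n. cnj (?U $$ (k, i)) * (B * ?U) $$ (k, j))"
        using ij B bc by (simp add: scalar_prod_def atLeast0LessThan)
      also have "\<dots> = (\<Sum>k<?n. cnj (?U $$ (k, i)) * (\<Sum>l<?n. B $$ (k, l) * ?U $$ (l, j)))"
        by (intro sum.cong refl) (simp add: BU del: index_mult_mat(1))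
      also have "\<dots> = dmat ?n (case_nat (Re e) a) $$ (i, j)"
      proof (cases i; cases j)
        fix i' j' assume s: "i = Suc i'" "j = Suc j'"
        then have b: "i' < m" "j' < m" using ij by auto
        have "dmat m a $$ (i', j') = (mat_adjoint U * (C * U)) $$ (i', j')"
          using D C Uc by (simp add: assoc_mult_square[where n = m])
        also have "\<dots> = (\<Sum>k<m. cnj (U $$ (k, i')) * (\<Sum>l<m. C $$ (k, l) * U $$ (l, j')))"
          using b C Uc by (simp add: scalar_prod_def atLeast0LessThan)
        finally show ?thesis
          unfolding sum.lessThan_Suc_shift using s b Uc by (simp add: bordered_def C_def) (auto simp: dmat_def)
      qed (use ij Uc B0 B0' e_real in \<open>auto simp: sum.lessThan_Suc_shift bordered_def dmat_def simp del: sum.lessThan_Suc\<close>)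
      finally show "(mat_adjoint ?U * (B * ?U)) $$ (i, j) = dmat ?n (case_nat (Re e) a) $$ (i, j)" .
    qed (use bc in auto)
    moreover have "mat_adjoint (W * ?U) * A * (W * ?U) = mat_adjoint ?U * (B * ?U)"
      unfolding B_def by (rule unitary_conj_mult[OF Wc(1) bc(1) A(1)])
    ultimately show ?case using unitary_mat_mult[OF W(1) bU] by metis
  qed
  then obtain U a where U: "unitary_mat n U" and D: "mat_adjoint U * A * U = dmat n a" by blast
  have c: "U \<in> carrier_mat n n" "mat_adjoint U \<in> carrier_mat n n" and UU: "U * mat_adjoint U = 1\<^sub>m n"
    using U by (auto simp: unitary_mat_def)
  have "U * dmat n a * mat_adjoint U = (U * mat_adjoint U) * A * (U * mat_adjoint U)"
    using c assms(1) by (simp add: D[symmetric] assoc_mult_square[where n = n])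
  also have "\<dots> = A" using assms(1) by (simp add: UU)
  finally show thesis using that U by metis
qed

section \<open>Trace norm and rank read off from the spectrum\<close>

lemma proots_prod_linear_factors:
  "proots (\<Prod>a\<leftarrow>as. [:- a, 1:]) = mset (as :: 'a::{idom, ring_char_0} list)"
proof (induction as)
  case (Cons a as)
  have "(\<Prod>a\<leftarrow>as. [:- a, 1:]) \<noteq> 0" by (auto simp: prod_list_zero_iff)
  then show ?case using Cons by (simp add: proots_mult del: mult_pCons_left)
qed simp

text \<open>The product of the adjoint with \<open>A\<close> is similar to the diagonal matrix of
  the squares of \<open>a\<close>, so its characteristic polynomial has these squares as roots with
  the right multiplicities.\<close>

lemma schatten1_norm_spectral:
  assumes U: "unitary_mat n U" and A: "A = U * dmat n a * mat_adjoint U"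
  shows "schatten1_norm A = (\<Sum>i<n. \<bar>a i\<bar>)"
proof -
  have c: "U \<in> carrier_mat n n" "mat_adjoint U \<in> carrier_mat n n"
    and UU: "mat_adjoint U * U = 1\<^sub>m n" "U * mat_adjoint U = 1\<^sub>m n"
    using U by (auto simp: unitary_mat_def)
  let ?D = "dmat n (\<lambda>i. a i * a i)"
  have "mat_adjoint A * A = U * dmat n a * ((mat_adjoint U * U) * (dmat n a * mat_adjoint U))"
    using c by (simp add: A mat_adjoint_mult assoc_mult_square[where n = n])
  also have "\<dots> = U * (dmat n a * dmat n a) * mat_adjoint U"
    using c by (simp add: UU assoc_mult_square[where n = n])
  finally have "mat_adjoint A * A = U * ?D * mat_adjoint U" by (simp add: dmat_mult)
  then have "similar_mat_wit (mat_adjoint A * A) ?D U (mat_adjoint U)"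
    using c UU A by (intro similar_mat_witI[of _ _ n]) (auto intro: assoc_mult_square)
  then have "char_poly (mat_adjoint A * A) = char_poly ?D"
    by (intro char_poly_similar) (auto simp: similar_mat_def)
  also have "\<dots> = (\<Prod>x\<leftarrow>diag_mat ?D. [:- x, 1:])"
    by (rule char_poly_upper_triangular[of _ n]) (auto simp: dmat_def)
  finally have "proots (char_poly (mat_adjoint A * A)) = mset (diag_mat ?D)"
    by (simp add: proots_prod_linear_factors)
  then have "schatten1_norm A = (\<Sum>x\<leftarrow>diag_mat ?D. sqrt (Re x))"
    by (simp add: schatten1_norm_def sum_mset_sum_list flip: mset_map)
  also have "\<dots> = (\<Sum>i\<leftarrow>[0..<n]. \<bar>a i\<bar>)"
    unfolding diag_mat_def map_map o_def dmat_dim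
    by (intro arg_cong[where f = sum_list] map_cong) (auto simp: dmat_def)
  also have "\<dots> = (\<Sum>i<n. \<bar>a i\<bar>)"
    by (simp add: sum_list_sum_nth atLeast0LessThan)
  finally show ?thesis .
qed

lemma conj_dmat_entry:
  assumes "U \<in> carrier_mat n n" "i < n" "j < n"
  shows "(U * dmat n a * mat_adjoint U) $$ (i, j) = (\<Sum>l<n. complex_of_real (a l) * (U $$ (i, l) * cnj (U $$ (j, l))))"
proof -
  have "(U * dmat n a) $$ (i, l) = U $$ (i, l) * complex_of_real (a l)" if "l < n" for l
    using assms that by (simp add: scalar_prod_def atLeast0LessThan dmat_def if_distrib[where f = "\<lambda>x. _ * x"] sum_if_eq_lessThan cong: if_cong)
  moreover have "(U * dmat n a * mat_adjoint U) $$ (i, j) = (\<Sum>l<n. (U * dmat n a) $$ (i, l) * mat_adjoint U $$ (l, j))"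
    using assms by (simp add: scalar_prod_def atLeast0LessThan)
  ultimately show ?thesis using assms by (auto intro!: sum.cong)
qed

lemma unitary_row_norm:
  assumes "unitary_mat n U" "i < n"
  shows "(\<Sum>l<n. (cmod (U $$ (i, l)))\<^sup>2) = 1"
proof -
  have c: "U \<in> carrier_mat n n" "U * mat_adjoint U = 1\<^sub>m n" using assms by (auto simp: unitary_mat_def)
  from c(1) have "complex_of_real (\<Sum>l<n. (cmod (U $$ (i, l)))\<^sup>2) = (U * mat_adjoint U) $$ (i, i)"
    using assms(2) by (simp add: scalar_prod_def atLeast0LessThan complex_norm_square del: of_real_power)
  also have "\<dots> = 1" unfolding c(2) using assms(2) by simp
  finally show ?thesis using of_real_eq_1_iff by blast
qed

lemma unitary_col_norm:
  assumes "unitary_mat n U" "l < n"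
  shows "(\<Sum>i<n. (cmod (U $$ (i, l)))\<^sup>2) = 1"
proof -
  have "U \<in> carrier_mat n n" using assms by (auto simp: unitary_mat_def)
  then show ?thesis using unitary_row_norm[OF unitary_mat_adjoint[OF assms(1)] assms(2)] assms(2) by simp
qed

lemma conj_dmat_diag_Re:
  assumes "U \<in> carrier_mat n n" "i < n"
  shows "Re ((U * dmat n a * mat_adjoint U) $$ (i, i)) = (\<Sum>l<n. a l * (cmod (U $$ (i, l)))\<^sup>2)"
  using assms by (simp add: conj_dmat_entry del: index_mult_mat(1) flip: complex_norm_square of_real_mult of_real_power)

text \<open>Each diagonal entry is a combination of the eigenvalues with weights the squared moduli
  in a row of \<open>U\<close>. The columns of squared moduli sum to 1, so every eigenvalue receives
  total weight at most 1.\<close>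

lemma partial_trace_le_abs_sum:
  assumes U: "unitary_mat n U" and I: "I \<subseteq> {..<n}"
  shows "(\<Sum>i\<in>I. Re ((U * dmat n a * mat_adjoint U) $$ (i, i))) \<le> (\<Sum>i<n. \<bar>a i\<bar>)"
proof -
  have c: "U \<in> carrier_mat n n" using U by (auto simp: unitary_mat_def)
  have "(\<Sum>i\<in>I. Re ((U * dmat n a * mat_adjoint U) $$ (i, i))) = (\<Sum>i\<in>I. \<Sum>l<n. a l * (cmod (U $$ (i, l)))\<^sup>2)"
    using I conj_dmat_diag_Re[OF c] by (intro sum.cong) auto
  also have "\<dots> \<le> (\<Sum>i\<in>I. \<Sum>l<n. \<bar>a l\<bar> * (cmod (U $$ (i, l)))\<^sup>2)"
    by (intro sum_mono mult_right_mono) auto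
  also have "\<dots> \<le> (\<Sum>i<n. \<Sum>l<n. \<bar>a l\<bar> * (cmod (U $$ (i, l)))\<^sup>2)"
    using I by (intro sum_mono2) (auto intro!: sum_nonneg)
  also have "\<dots> = (\<Sum>l<n. \<bar>a l\<bar> * (\<Sum>i<n. (cmod (U $$ (i, l)))\<^sup>2))"
    by (subst sum.swap) (simp add: sum_distrib_left)
  also have "\<dots> = (\<Sum>l<n. \<bar>a l\<bar>)" using unitary_col_norm[OF U] by simp
  finally show ?thesis .
qed

lemma rank_conj_dmat_le:
  assumes U: "U \<in> carrier_mat n n"
  shows "vec_space.rank n (U * dmat n a * mat_adjoint U) \<le> card {i. i < n \<and> a i \<noteq> 0}"
proof -
  interpret vec_space "TYPE(complex)" n .
  have *: "rank (mat n n (\<lambda>(i, j). \<Sum>l\<in>S. complex_of_real (a l) * (U $$ (i, l) * cnj (U $$ (j, l))))) \<le> card S" if "finite S" for S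
    using that
  proof (induction S rule: finite_induct)
    case empty
    have "mat n n (\<lambda>_. 0 :: complex) = 0\<^sub>m n n" by (rule eq_matI) auto
    then show ?case using rank_0I[of n] by simp
  next
    case (insert k S)
    let ?f = "\<lambda>l i j. complex_of_real (a l) * (U $$ (i, l) * cnj (U $$ (j, l)))"
    have "mat n n (\<lambda>(i, j). \<Sum>l\<in>insert k S. ?f l i j) = mat n n (\<lambda>(i, j). ?f k i j) + mat n n (\<lambda>(i, j). \<Sum>l\<in>S. ?f l i j)"
      by (rule eq_matI) (use insert.hyps in auto)
    moreover have "rank (mat n n (\<lambda>(i, j). ?f k i j)) \<le> 1"
      by (rule rank_le_1_product_entries[of _ n "\<lambda>i. complex_of_real (a k) * U $$ (i, k)" "\<lambda>j. cnj (U $$ (j, k))"]) auto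
    ultimately show ?case
      using insert rank_subadditive[of "mat n n (\<lambda>(i, j). ?f k i j)" n "mat n n (\<lambda>(i, j). \<Sum>l\<in>S. ?f l i j)"] by simp
  qed
  have "U * dmat n a * mat_adjoint U = mat n n (\<lambda>(i, j). \<Sum>l\<in>{i. i < n \<and> a i \<noteq> 0}. complex_of_real (a l) * (U $$ (i, l) * cnj (U $$ (j, l))))"
  proof (rule eq_matI)
    fix i j assume "i < dim_row (mat n n (\<lambda>(i, j). \<Sum>l\<in>{i. i < n \<and> a i \<noteq> 0}. complex_of_real (a l) * (U $$ (i, l) * cnj (U $$ (j, l)))))"
      "j < dim_col (mat n n (\<lambda>(i, j). \<Sum>l\<in>{i. i < n \<and> a i \<noteq> 0}. complex_of_real (a l) * (U $$ (i, l) * cnj (U $$ (j, l)))))"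
    then have ij: "i < n" "j < n" by auto
    have "(\<Sum>l<n. complex_of_real (a l) * (U $$ (i, l) * cnj (U $$ (j, l))))
       = (\<Sum>l\<in>{i. i < n \<and> a i \<noteq> 0}. complex_of_real (a l) * (U $$ (i, l) * cnj (U $$ (j, l))))"
      by (rule sum.mono_neutral_right) auto
    then show "(U * dmat n a * mat_adjoint U) $$ (i, j) = mat n n (\<lambda>(i, j). \<Sum>l\<in>{i. i < n \<and> a i \<noteq> 0}. complex_of_real (a l) * (U $$ (i, l) * cnj (U $$ (j, l)))) $$ (i, j)"
      using ij by (simp add: conj_dmat_entry[OF U] del: index_mult_mat(1))
  qed (use U in auto)
  then show ?thesis using *[of "{i. i < n \<and> a i \<noteq> 0}"] by simp
qed

text \<open>Filling the zeros of \<open>a\<close> with ones, in the same eigenbasis, gives an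
  invertible matrix. The added part has rank at most the number of zeros, and rank is
  subadditive.\<close>

lemma rank_conj_dmat_ge:
  assumes U: "unitary_mat n U"
  shows "n \<le> vec_space.rank n (U * dmat n a * mat_adjoint U) + card {i. i < n \<and> a i = 0}"
proof -
  interpret vec_space "TYPE(complex)" n .
  have c: "U \<in> carrier_mat n n" "mat_adjoint U \<in> carrier_mat n n"
    and UU: "mat_adjoint U * U = 1\<^sub>m n" "U * mat_adjoint U = 1\<^sub>m n"
    using U by (auto simp: unitary_mat_def)
  define z where "z = (\<lambda>i. if a i = 0 then 1 else 0 :: real)"
  let ?A = "U * dmat n a * mat_adjoint U" and ?Z = "U * dmat n z * mat_adjoint U"
  let ?B = "U * dmat n (\<lambda>i. a i + z i) * mat_adjoint U" and ?C = "U * dmat n (\<lambda>i. 1 / (a i + z i)) * mat_adjoint U"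
  have AZ: "?A + ?Z = ?B"
    using c by (simp add: add_mult_distrib_mat[of _ n n _ _ n, symmetric] mult_add_distrib_mat[of _ n n _ n, symmetric]
        dmat_add[symmetric] mult_carrier_mat[of _ n n _ n])
  have "?B * ?C = U * (dmat n (\<lambda>i. a i + z i) * ((mat_adjoint U * U) * (dmat n (\<lambda>i. 1 / (a i + z i)) * mat_adjoint U)))"
    using c by (simp add: assoc_mult_square[where n = n])
  also have "\<dots> = U * ((dmat n (\<lambda>i. a i + z i) * dmat n (\<lambda>i. 1 / (a i + z i))) * mat_adjoint U)"
    using c by (simp add: UU assoc_mult_square[where n = n])
  also have "dmat n (\<lambda>i. a i + z i) * dmat n (\<lambda>i. 1 / (a i + z i)) = 1\<^sub>m n"
    unfolding dmat_mult dmat_one[symmetric] by (rule arg_cong[where f = "dmat n"]) (auto simp: z_def)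
  finally have "?B * ?C = 1\<^sub>m n" using c by (simp add: UU)
  moreover have Bc: "?B \<in> carrier_mat n n" "?C \<in> carrier_mat n n" "?A \<in> carrier_mat n n" "?Z \<in> carrier_mat n n"
    using c by (auto intro!: mult_carrier_mat[of _ n n _ n])
  ultimately have "det ?B \<noteq> 0"
    using det_mult[OF Bc(1,2)] det_one[of n] by auto
  then have "rank ?B = n" using det_rank_iff[OF Bc(1)] by simp
  then have "n \<le> rank ?A + rank ?Z" using rank_subadditive[OF Bc(3,4)] AZ by simp
  also have "rank ?Z \<le> card {i. i < n \<and> z i \<noteq> 0}" by (rule rank_conj_dmat_le[OF c(1)])
  also have "{i. i < n \<and> z i \<noteq> 0} = {i. i < n \<and> a i = 0}" by (auto simp: z_def)
  finally show ?thesis by simp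
qed

text \<open>Pass to an eigenbasis of S. At the zero eigenvalues of S the diagonal entries of R - S
  are those of R, hence at least c as averages of the \<open>a i\<close>; their sum is at most the
  trace norm. There are at least n - rank S such positions.\<close>

lemma trace_distance_lower_bound:
  assumes U: "unitary_mat n U" and a: "\<And>i. i < n \<Longrightarrow> a i \<ge> c"
    and c0: "c \<ge> 0" and S: "S \<in> carrier_mat n n" "mat_adjoint S = S"
  shows "trace_distance (U * dmat n a * mat_adjoint U) S \<ge> c * (real n - real (vec_space.rank n S)) / 2"
proof -
  define R where "R = U * dmat n a * mat_adjoint U"
  have Uc: "U \<in> carrier_mat n n" "mat_adjoint U \<in> carrier_mat n n" using U by (auto simp: unitary_mat_def)
  have R: "R \<in> carrier_mat n n" using Uc by (auto simp: R_def intro!: mult_carrier_mat[of _ n n _ n])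
  have Rh: "mat_adjoint R = R" using Uc by (simp add: R_def mat_adjoint_mult assoc_mult_square[where n = n])
  obtain V s where V: "unitary_mat n V" and Sd: "S = V * dmat n s * mat_adjoint V"
    using hermitian_spectral_decomposition[OF S] by blast
  have RS: "R - S \<in> carrier_mat n n" "mat_adjoint (R - S) = R - S"
  proof -
    show "R - S \<in> carrier_mat n n" using S(1) by (rule minus_carrier_mat)
    show "mat_adjoint (R - S) = R - S"
    proof (rule eq_matI)
      fix i j assume "i < dim_row (R - S)" "j < dim_col (R - S)"
      then have ij: "i < n" "j < n" using S by auto
      show "mat_adjoint (R - S) $$ (i, j) = (R - S) $$ (i, j)"
        using ij R S hermitian_entry[OF R Rh ij] hermitian_entry[OF S ij] by simp
    qed (use R S in auto)
  qed
  obtain Y b where Y: "unitary_mat n Y" and D: "R - S = Y * dmat n b * mat_adjoint Y"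
    using hermitian_spectral_decomposition[OF RS] by blast
  have Vc: "V \<in> carrier_mat n n" "mat_adjoint V \<in> carrier_mat n n" and VV: "mat_adjoint V * V = 1\<^sub>m n"
    and Yc: "Y \<in> carrier_mat n n" "mat_adjoint Y \<in> carrier_mat n n"
    using V Y by (auto simp: unitary_mat_def)
  let ?I = "{i. i < n \<and> s i = 0}"
  have VSV: "mat_adjoint V * S * V = dmat n s"
  proof -
    have "mat_adjoint V * S * V = (mat_adjoint V * V) * dmat n s * (mat_adjoint V * V)"
      using Vc by (simp add: Sd assoc_mult_square[where n = n])
    then show ?thesis by (simp add: VV)
  qed
  have entry: "(mat_adjoint V * (R - S) * V) $$ (i, i) = (mat_adjoint V * R * V) $$ (i, i)" if "i \<in> ?I" for i
  proof -
    have "mat_adjoint V * (R - S) * V = mat_adjoint V * R * V - mat_adjoint V * S * V"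
      using Vc R S by (simp add: minus_mult_distrib_mat[of _ n n _ _ n] mult_minus_distrib_mat[of _ n n _ n] mult_carrier_mat[of _ n n _ n])
    then show ?thesis using that Vc by (simp add: VSV del: index_mult_mat(1)) (simp add: dmat_def)
  qed
  have wR: "mat_adjoint V * R * V = (mat_adjoint V * U) * dmat n a * mat_adjoint (mat_adjoint V * U)"
    using Vc Uc by (simp add: R_def mat_adjoint_mult assoc_mult_square[where n = n])
  have wD: "mat_adjoint V * (R - S) * V = (mat_adjoint V * Y) * dmat n b * mat_adjoint (mat_adjoint V * Y)"
    unfolding D using Vc Yc by (simp add: mat_adjoint_mult assoc_mult_square[where n = n])
  have uVU: "unitary_mat n (mat_adjoint V * U)" and uVY: "unitary_mat n (mat_adjoint V * Y)"
    using unitary_mat_mult unitary_mat_adjoint U V Y by blast+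
  have "c * real (card ?I) = (\<Sum>i\<in>?I. c)" by simp
  also have "\<dots> \<le> (\<Sum>i\<in>?I. Re ((mat_adjoint V * R * V) $$ (i, i)))"
  proof (rule sum_mono)
    fix i assume i: "i \<in> ?I"
    have "c = c * (\<Sum>l<n. (cmod ((mat_adjoint V * U) $$ (i, l)))\<^sup>2)"
      using unitary_row_norm[OF uVU] i by simp
    also have "\<dots> \<le> (\<Sum>l<n. a l * (cmod ((mat_adjoint V * U) $$ (i, l)))\<^sup>2)"
      unfolding sum_distrib_left by (intro sum_mono mult_right_mono) (auto simp: a)
    also have "\<dots> = Re ((mat_adjoint V * R * V) $$ (i, i))"
      unfolding wR using uVU i by (subst conj_dmat_diag_Re) (auto simp: unitary_mat_def)
    finally show "c \<le> Re ((mat_adjoint V * R * V) $$ (i, i))" .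
  qed
  also have "\<dots> = (\<Sum>i\<in>?I. Re ((mat_adjoint V * (R - S) * V) $$ (i, i)))"
    using entry by (intro sum.cong) auto
  also have "\<dots> \<le> (\<Sum>i<n. \<bar>b i\<bar>)"
    unfolding wD by (rule partial_trace_le_abs_sum[OF uVY]) auto
  also have "\<dots> = schatten1_norm (R - S)" by (rule schatten1_norm_spectral[OF Y D, symmetric])
  finally have 1: "c * real (card ?I) \<le> schatten1_norm (R - S)" .
  have "n \<le> vec_space.rank n S + card ?I" unfolding Sd by (rule rank_conj_dmat_ge[OF V])
  then have "c * (real n - real (vec_space.rank n S)) \<le> c * real (card ?I)"
    using c0 by (intro mult_left_mono) linarith+
  with 1 show ?thesis by (simp add: trace_distance_def R_def)
qed

subsection \<open>Perturbing a flat spectrum in a random direction\<close>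

lemma permutation_conj_dmat:
  assumes "inj_on \<rho> {..<d}" "\<And>x. x < d \<Longrightarrow> \<rho> x < d"
  obtains P where "unitary_mat d P" "dmat d (\<lambda>x. a (\<rho> x)) = P * dmat d a * mat_adjoint P"
proof -
  define P where "P = mat d d (\<lambda>(x, l). if l = \<rho> x then 1 else 0 :: complex)"
  have P: "P \<in> carrier_mat d d" by (simp add: P_def)
  have eq: "\<rho> x = \<rho> y \<longleftrightarrow> x = y" if "x < d" "y < d" for x y
    using assms(1) that by (auto simp: inj_on_def)
  have conj: "P * dmat d f * mat_adjoint P = dmat d (\<lambda>x. f (\<rho> x))" for f
  proof (rule eq_matI)
    fix x y assume "x < dim_row (dmat d (\<lambda>x. f (\<rho> x)))" "y < dim_col (dmat d (\<lambda>x. f (\<rho> x)))"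
    then have xy: "x < d" "y < d" by auto
    have "(P * dmat d f * mat_adjoint P) $$ (x, y)
        = (\<Sum>l<d. complex_of_real (f l) * (P $$ (x, l) * cnj (P $$ (y, l))))"
      by (rule conj_dmat_entry[OF P xy])
    also have "\<dots> = (\<Sum>l<d. if l = \<rho> x then complex_of_real (f (\<rho> x)) * (if \<rho> x = \<rho> y then 1 else 0) else 0)"
      using xy by (intro sum.cong) (auto simp: P_def)
    also have "\<dots> = dmat d (\<lambda>x. f (\<rho> x)) $$ (x, y)"
      using xy assms(2) eq[OF xy] by (simp add: dmat_def)
    finally show "(P * dmat d f * mat_adjoint P) $$ (x, y) = dmat d (\<lambda>x. f (\<rho> x)) $$ (x, y)" .
  qed (use P in auto)
  have "P * mat_adjoint P = 1\<^sub>m d"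
    using conj[of "\<lambda>_. 1"] P by (simp add: dmat_one)
  then have "unitary_mat d P"
    using P mat_mult_left_right_inverse[of P d "mat_adjoint P"] by (auto simp: unitary_mat_def)
  then show thesis using that conj by metis
qed

lemma sum_delta_mult:
  fixes f :: "nat \<Rightarrow> real"
  assumes "x < d"
  shows "(\<Sum>y<d. (if x = y then 1 else 0) * f y) = f x" "(\<Sum>y<d. f y * (if y = x then 1 else 0)) = f x"
  using assms by (simp_all add: if_distrib[of "\<lambda>c. c * _"] if_distrib[of "\<lambda>c. _ * c"] cong: if_cong)

text \<open>\<open>H\<close> is the product of the commuting Householder reflections along the
  pairwise orthogonal vectors \<open>v i\<close>, with \<open>q i\<close> the squared length. A
  vector of length 0 contributes a zero term, so degenerate reflections are covered as the
  identity.\<close>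

lemma orthogonal_reflection_square:
  fixes v :: "'i \<Rightarrow> nat \<Rightarrow> real"
  assumes "finite I"
    and orth: "\<And>i j. i \<in> I \<Longrightarrow> j \<in> I \<Longrightarrow> (\<Sum>y<d. v i y * v j y) = (if i = j then q i else 0)"
  defines "H \<equiv> (\<lambda>x y. (if x = y then 1 else 0) - (\<Sum>i\<in>I. 2 * v i x * v i y / q i))"
  assumes "x < d" "z < d"
  shows "(\<Sum>y<d. H x y * H y z) = (if x = z then 1 else 0)"
proof -
  let ?R = "\<lambda>x y. \<Sum>i\<in>I. 2 * v i x * v i y / q i"
  have vq: "v i y = 0" if "i \<in> I" "q i = 0" "y < d" for i y
  proof -
    have "(\<Sum>y<d. (v i y)\<^sup>2) = 0" using orth[of i i] that by (simp add: power2_eq_square)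
    then show ?thesis using that by (simp add: sum_nonneg_eq_0_iff)
  qed
  have "(\<Sum>y<d. ?R x y * ?R y z) = (\<Sum>y<d. \<Sum>i\<in>I. \<Sum>j\<in>I. (4 * v i x * v j z / (q i * q j)) * (v i y * v j y))"
    unfolding sum_product by (intro sum.cong refl) (simp add: mult_ac)
  also have "\<dots> = (\<Sum>i\<in>I. \<Sum>j\<in>I. (4 * v i x * v j z / (q i * q j)) * (\<Sum>y<d. v i y * v j y))"
    unfolding sum_distrib_left by (subst sum.swap, rule sum.cong[OF refl], rule sum.swap)
  also have "\<dots> = (\<Sum>i\<in>I. \<Sum>j\<in>I. if i = j then (4 * v i x * v i z / (q i * q i)) * q i else 0)"
    by (intro sum.cong refl) (auto simp: orth)
  also have "\<dots> = (\<Sum>i\<in>I. 4 * v i x * v i z / (q i * q i) * q i)"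
    using \<open>finite I\<close> by simp
  also have "\<dots> = 2 * ?R x z"
    unfolding sum_distrib_left by (intro sum.cong refl) (auto simp: vq assms)
  finally have RR: "(\<Sum>y<d. ?R x y * ?R y z) = 2 * ?R x z" .
  have "(\<Sum>y<d. H x y * H y z) = (\<Sum>y<d. (if x = y then 1 else 0) * (if y = z then 1 else 0))
      - (\<Sum>y<d. (if x = y then 1 else 0) * ?R y z) - (\<Sum>y<d. ?R x y * (if y = z then 1 else 0))
      + (\<Sum>y<d. ?R x y * ?R y z)"
    unfolding H_def by (simp add: algebra_simps sum.distrib sum_subtractf del: mult_minus_left mult_minus_right)
  also have "\<dots> = (if x = z then 1 else 0)"
    unfolding sum_delta_mult[OF \<open>x < d\<close>] sum_delta_mult[OF \<open>z < d\<close>] RR by simp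
  finally show ?thesis .
qed

text \<open>The eigenvector at the block coordinate \<open>e i\<close> is to be replaced by a flat vector with random signs
  supported on the chunk \<open>C i\<close>, which otherwise consists of reservoir coordinates.\<close>

locale chunked_spectrum =
  fixes d s L :: nat and \<sigma> :: "nat \<Rightarrow> real" and C :: "nat \<Rightarrow> nat set" and e :: "nat \<Rightarrow> nat"
  assumes d_pos: "d > 0" and L_pos: "L > 0" and s_pos: "s > 0"
    and C_sub: "\<And>i. i < s \<Longrightarrow> C i \<subseteq> {..<d}"
    and C_card: "\<And>i. i < s \<Longrightarrow> card (C i) = L"
    and C_disj: "\<And>i j. i < s \<Longrightarrow> j < s \<Longrightarrow> i \<noteq> j \<Longrightarrow> C i \<inter> C j = {}"
    and e_C: "\<And>i. i < s \<Longrightarrow> e i \<in> C i"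
    and \<sigma>_C: "\<And>i x. i < s \<Longrightarrow> x \<in> C i \<Longrightarrow> \<sigma> x = 1 / real d"
    and \<sigma>_nonneg: "\<And>x. x < d \<Longrightarrow> \<sigma> x \<ge> 0"
    and \<sigma>_sum: "(\<Sum>x<d. \<sigma> x) = 1"
begin

abbreviation signs :: "(nat \<Rightarrow> real) set" where
  "signs \<equiv> Pi\<^sub>E {..<d} (\<lambda>_. {-1, 1})"

definition u :: "(nat \<Rightarrow> real) \<Rightarrow> nat \<Rightarrow> nat \<Rightarrow> real" where
  "u \<epsilon> i x = (if x \<in> C i then \<epsilon> x / sqrt (real L) else 0)"

text \<open>\<open>z i\<close> is the deviation from 1 of an eigenvalue in units of 1/d. The unit
  vectors of distinct chunks are orthogonal and the reference is flat on each chunk, so the rank-one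
  terms change the eigenvalues 1/d into (1 + z i)/d.\<close>

definition X :: "(nat \<Rightarrow> real) \<Rightarrow> (nat \<Rightarrow> real) \<Rightarrow> real mat" where
  "X z \<epsilon> = mat d d (\<lambda>(x, y). (if x = y then \<sigma> x else 0) + (\<Sum>i<s. z i / real d * (u \<epsilon> i x * u \<epsilon> i y)))"

lemma X_carrier [simp]: "X z \<epsilon> \<in> carrier_mat d d"
  by (simp add: X_def)

definition overlap :: "(nat \<Rightarrow> real) \<Rightarrow> (nat \<Rightarrow> real) \<Rightarrow> nat \<Rightarrow> real" where
  "overlap \<epsilon> \<epsilon>' i = (\<Sum>x<d. u \<epsilon> i x * u \<epsilon>' i x)"

lemma e_less: "i < s \<Longrightarrow> e i < d"
  using e_C C_sub by fastforce

lemma e_in_C_iff: "i < s \<Longrightarrow> j < s \<Longrightarrow> e i \<in> C j \<longleftrightarrow> i = j"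
  using e_C[of i] C_disj[of i j] by auto

lemma sign_square:
  assumes "\<epsilon> \<in> signs" "x < d"
  shows "\<epsilon> x * \<epsilon> x = 1"
proof -
  have "\<epsilon> x \<in> {-1, 1}" using PiE_mem[OF assms(1), of x] assms(2) by simp
  then show ?thesis by auto
qed

lemma u_inner:
  assumes "i < s" "j < s"
  shows "(\<Sum>x<d. u \<epsilon> i x * u \<epsilon>' j x) = (if i = j then overlap \<epsilon> \<epsilon>' i else 0)"
proof (cases "i = j")
  case False
  then have "u \<epsilon> i x * u \<epsilon>' j x = 0" for x using C_disj[OF assms] by (auto simp: u_def)
  then show ?thesis using False by simp
qed (simp add: overlap_def)

lemma overlap_self:
  assumes "\<epsilon> \<in> signs" "i < s"
  shows "overlap \<epsilon> \<epsilon> i = 1"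
proof -
  have "overlap \<epsilon> \<epsilon> i = (\<Sum>x<d. if x \<in> C i then 1 / real L else 0)"
    unfolding overlap_def using sign_square[OF assms(1)] by (intro sum.cong) (auto simp: u_def)
  also have "\<dots> = (\<Sum>x\<in>C i. 1 / real L)"
    using C_sub[OF assms(2)] by (simp add: sum.inter_restrict[symmetric] Int_absorb1)
  also have "\<dots> = 1" using C_card[OF assms(2)] L_pos by simp
  finally show ?thesis .
qed

text \<open>On the chunks dividing by \<open>\<sigma> x\<close> is multiplying by d, and elsewhere
  the perturbations vanish. The terms linear in a perturbation are traces, zero because the
  deviations have mean zero. Distinct chunks are disjoint, so in the bilinear term only squared
  overlaps of equal chunks survive.\<close>

lemma X_inner:
  assumes \<epsilon>: "\<epsilon> \<in> signs" "\<epsilon>' \<in> signs" and z: "(\<Sum>i<s. z i) = 0" "(\<Sum>i<s. z' i) = 0"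
  shows "(\<Sum>x<d. \<Sum>y<d. X z \<epsilon> $$ (x, y) * X z' \<epsilon>' $$ (x, y) / \<sigma> x)
    = 1 + (\<Sum>i<s. z i * (z' i * (overlap \<epsilon> \<epsilon>' i)\<^sup>2 / real d))"
proof -
  define Z where "Z = (\<lambda>z \<epsilon> x y. \<Sum>i<s. z i / real d * (u \<epsilon> i x * u \<epsilon> i y))"
  let ?\<delta> = "\<lambda>x y :: nat. if x = y then 1 else 0 :: real"
  have Zd: "Z z \<epsilon> x y / \<sigma> x = real d * Z z \<epsilon> x y" for z \<epsilon> x y
    unfolding Z_def sum_distrib_left sum_divide_distrib
    by (intro sum.cong refl) (auto simp: u_def \<sigma>_C)
  have Zs: "Z z \<epsilon> x y * \<sigma> x / \<sigma> x = Z z \<epsilon> x y" for z \<epsilon> x y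
    unfolding Z_def sum_distrib_right sum_divide_distrib
    using d_pos by (intro sum.cong refl) (auto simp: u_def \<sigma>_C)
  have diag: "(\<Sum>x<d. Z z \<epsilon> x x) = 0" if "\<epsilon> \<in> signs" "(\<Sum>i<s. z i) = 0" for z \<epsilon>
  proof -
    have "(\<Sum>x<d. Z z \<epsilon> x x) = (\<Sum>i<s. z i / real d * overlap \<epsilon> \<epsilon> i)"
      unfolding Z_def overlap_def by (subst sum.swap) (simp add: sum_distrib_left)
    also have "\<dots> = (\<Sum>i<s. z i) / real d" using overlap_self[OF that(1)] by (simp add: sum_divide_distrib)
    finally show ?thesis using that(2) by simp
  qed
  have "X z \<epsilon> $$ (x, y) * X z' \<epsilon>' $$ (x, y) / \<sigma> x
     = ?\<delta> x y * \<sigma> y + ?\<delta> x y * Z z \<epsilon> y y + ?\<delta> x y * Z z' \<epsilon>' y y + real d * (Z z \<epsilon> x y * Z z' \<epsilon>' x y)"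
    if "x < d" "y < d" for x y
  proof -
    have "X z \<epsilon> $$ (x, y) * X z' \<epsilon>' $$ (x, y) / \<sigma> x
      = ?\<delta> x y * (\<sigma> x * \<sigma> x / \<sigma> x) + ?\<delta> x y * (Z z \<epsilon> x y * \<sigma> x / \<sigma> x) + ?\<delta> x y * (Z z' \<epsilon>' x y * \<sigma> x / \<sigma> x)
         + Z z \<epsilon> x y * (Z z' \<epsilon>' x y / \<sigma> x)"
    proof -
      have "X z \<epsilon> $$ (x, y) = ?\<delta> x y * \<sigma> x + Z z \<epsilon> x y" for z \<epsilon>
        using that by (simp add: X_def Z_def)
      then show ?thesis by (cases "x = y") (simp_all add: algebra_simps add_divide_distrib)
    qed
    then show ?thesis unfolding Zs unfolding Zd by (cases "x = y") auto
  qed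
  then have "(\<Sum>x<d. \<Sum>y<d. X z \<epsilon> $$ (x, y) * X z' \<epsilon>' $$ (x, y) / \<sigma> x)
     = (\<Sum>x<d. \<Sum>y<d. ?\<delta> x y * \<sigma> y + ?\<delta> x y * Z z \<epsilon> y y + ?\<delta> x y * Z z' \<epsilon>' y y + real d * (Z z \<epsilon> x y * Z z' \<epsilon>' x y))"
    by (intro sum.cong refl) auto
  also have "\<dots> = (\<Sum>x<d. \<sigma> x + Z z \<epsilon> x x + Z z' \<epsilon>' x x + (\<Sum>y<d. real d * (Z z \<epsilon> x y * Z z' \<epsilon>' x y)))"
    by (intro sum.cong refl) (simp add: sum.distrib sum_delta_mult)
  also have "\<dots> = 1 + (\<Sum>x<d. \<Sum>y<d. real d * (Z z \<epsilon> x y * Z z' \<epsilon>' x y))"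
    using diag \<epsilon> z by (simp add: sum.distrib \<sigma>_sum)
  also have "(\<Sum>x<d. \<Sum>y<d. real d * (Z z \<epsilon> x y * Z z' \<epsilon>' x y))
     = (\<Sum>x<d. \<Sum>y<d. \<Sum>i<s. \<Sum>j<s. z i * z' j / real d * ((u \<epsilon> i x * u \<epsilon>' j x) * (u \<epsilon> i y * u \<epsilon>' j y)))"
    unfolding Z_def unfolding sum_product unfolding sum_distrib_left
    using d_pos by (intro sum.cong refl) (simp add: field_simps)
  also have "\<dots> = (\<Sum>i<s. \<Sum>j<s. z i * z' j / real d * ((\<Sum>x<d. u \<epsilon> i x * u \<epsilon>' j x) * (\<Sum>y<d. u \<epsilon> i y * u \<epsilon>' j y)))"
  proof -
    have "(\<Sum>x<d. \<Sum>y<d. \<Sum>i<s. \<Sum>j<s. F x y i j) = (\<Sum>i<s. \<Sum>j<s. \<Sum>x<d. \<Sum>y<d. F x y i j)"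
      for F :: "nat \<Rightarrow> nat \<Rightarrow> nat \<Rightarrow> nat \<Rightarrow> real"
      unfolding sum.cartesian_product
      by (rule sum.reindex_bij_witness[of _ "\<lambda>(i, j, x, y). (x, y, i, j)" "\<lambda>(x, y, i, j). (i, j, x, y)"]) auto
    moreover have "(\<Sum>x<d. \<Sum>y<d. c * (f x * g y)) = c * ((\<Sum>x<d. f x) * (\<Sum>y<d. g y))"
      for c :: real and f g :: "nat \<Rightarrow> real"
      unfolding sum_product unfolding sum_distrib_left ..
    ultimately show ?thesis by (simp only:)
  qed
  also have "\<dots> = (\<Sum>i<s. \<Sum>j<s. if i = j then z i * (z' i * (overlap \<epsilon> \<epsilon>' i)\<^sup>2 / real d) else 0)"
  proof (rule sum.cong[OF refl], rule sum.cong[OF refl])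
    fix i j assume "i \<in> {..<s}" "j \<in> {..<s}"
    then show "z i * z' j / real d * ((\<Sum>x<d. u \<epsilon> i x * u \<epsilon>' j x) * (\<Sum>y<d. u \<epsilon> i y * u \<epsilon>' j y))
        = (if i = j then z i * (z' i * (overlap \<epsilon> \<epsilon>' i)\<^sup>2 / real d) else 0)"
      by (simp add: u_inner power2_eq_square)
  qed
  finally show ?thesis by simp
qed

lemma X_support:
  assumes "x < d" "y < d" "\<sigma> x = 0"
  shows "X z \<epsilon> $$ (x, y) = 0"
proof -
  have "x \<notin> C i" if "i < s" for i using \<sigma>_C[OF that, of x] assms d_pos by auto
  then show ?thesis using assms by (auto simp: X_def u_def)
qed

text \<open>A permutation matrix P rearranges the block values according to \<pi>, and a reflection
  H exchanges the basis vector at \<open>e i\<close> with \<open>u \<epsilon> i\<close> for all i at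
  once. The reflecting vectors live on chunks, where \<sigma> is constant, so H commutes with the
  diagonal reference and moves only the rank-one terms.\<close>

lemma X_unitarily_diagonal:
  assumes \<epsilon>: "\<epsilon> \<in> signs" and \<pi>: "\<pi> \<in> injections {..<s} {..<s}"
    and a_e: "\<And>i. i < s \<Longrightarrow> a (e i) = (1 + z i) / real d"
    and a_rest: "\<And>x. x < d \<Longrightarrow> x \<notin> e ` {..<s} \<Longrightarrow> a x = \<sigma> x"
  obtains W where "unitary_mat d W" "cmat (X (\<lambda>i. z (\<pi> i)) \<epsilon>) = W * dmat d a * mat_adjoint W"
proof -
  have \<pi>s: "\<pi> i < s" if "i < s" for i using \<pi> that by (auto simp: injections_def)
  have e_inj: "e i = e j \<longleftrightarrow> i = j" if "i < s" "j < s" for i j using e_in_C_iff[OF that] e_C that by auto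
  define \<rho> where "\<rho> = (\<lambda>x. if x \<in> e ` {..<s} then e (\<pi> (inv_into {..<s} e x)) else x)"
  have inv: "inv_into {..<s} e (e i) = i" if "i < s" for i
    using that e_inj by (intro inv_into_f_f) (auto simp: inj_on_def)
  have \<rho>e: "\<rho> (e i) = e (\<pi> i)" if "i < s" for i using that by (simp add: \<rho>_def inv)
  have \<rho>_less: "\<rho> x < d" if "x < d" for x
  proof (cases "x \<in> e ` {..<s}")
    case True then show ?thesis using \<rho>e \<pi>s e_less by auto
  next
    case False then show ?thesis using that by (simp add: \<rho>_def)
  qed
  have "inj_on \<rho> {..<d}"
  proof (rule inj_onI)
    fix x y assume xy: "x \<in> {..<d}" "y \<in> {..<d}" "\<rho> x = \<rho> y"
    show "x = y"
    proof (cases "x \<in> e ` {..<s}"; cases "y \<in> e ` {..<s}")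
      assume "x \<in> e ` {..<s}" "y \<in> e ` {..<s}"
      then obtain i j where "i < s" "j < s" "x = e i" "y = e j" by auto
      moreover from this have "\<pi> i = \<pi> j" using xy \<rho>e \<pi>s e_inj by simp
      ultimately show "x = y" using \<pi> by (auto simp: injections_def inj_on_def)
    next
      assume h: "x \<in> e ` {..<s}" "y \<notin> e ` {..<s}"
      then have "\<rho> x \<in> e ` {..<s}" using \<rho>e \<pi>s by auto
      then show "x = y" using h xy by (simp add: \<rho>_def)
    next
      assume h: "x \<notin> e ` {..<s}" "y \<in> e ` {..<s}"
      then have "\<rho> y \<in> e ` {..<s}" using \<rho>e \<pi>s by auto
      then show "x = y" using h xy by (simp add: \<rho>_def)
    next
      assume "x \<notin> e ` {..<s}" "y \<notin> e ` {..<s}"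
      then show "x = y" using xy by (simp add: \<rho>_def)
    qed
  qed
  then obtain P where P: "unitary_mat d P" "dmat d (\<lambda>x. a (\<rho> x)) = P * dmat d a * mat_adjoint P"
    using permutation_conj_dmat \<rho>_less by metis
  \<comment> \<open>The difference of two unit vectors that the reflection is to exchange;
    \<open>q i\<close> is its squared length, zero when the two coincide.\<close>
  define v where "v = (\<lambda>i x. (if x = e i then 1 else 0) - u \<epsilon> i x)"
  define q where "q = (\<lambda>i. 2 - 2 * u \<epsilon> i (e i))"
  have v0: "v i x = 0" if "i < s" "x \<notin> C i" for i x
    using that e_C by (auto simp: v_def u_def)
  have orth: "(\<Sum>y<d. v i y * v j y) = (if i = j then q i else 0)" if ij: "i < s" "j < s" for i j
  proof (cases "i = j")
    case True
    have "(\<Sum>y<d. v i y * v i y) = (\<Sum>y<d. (if e i = y then 1 else 0) * (1 - 2 * u \<epsilon> i y)) + (\<Sum>y<d. u \<epsilon> i y * u \<epsilon> i y)"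
      unfolding sum.distrib[symmetric] by (intro sum.cong refl) (auto simp: v_def algebra_simps)
    also have "\<dots> = q i"
      using overlap_self[OF \<epsilon> ij(1)] sum_delta_mult(1)[OF e_less[OF ij(1)], of "\<lambda>y. 1 - 2 * u \<epsilon> i y"]
      by (simp add: overlap_def q_def)
    finally show ?thesis using True by simp
  next
    case False
    have "v i y * v j y = 0" for y
      using v0 ij C_disj[OF ij False] by (cases "y \<in> C i") auto
    then show ?thesis using False by simp
  qed
  define Hf where "Hf = (\<lambda>x y. (if x = y then 1 else 0) - (\<Sum>i<s. 2 * v i x * v i y / q i))"
  have HH: "(\<Sum>y<d. Hf x y * Hf y w) = (if x = w then 1 else 0)" if "x < d" "w < d" for x w
    unfolding Hf_def by (rule orthogonal_reflection_square) (use that orth in auto)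
  have Hsym: "Hf x y = Hf y x" for x y by (auto simp: Hf_def mult_ac)
  define H where "H = mat d d (\<lambda>(x, y). complex_of_real (Hf x y))"
  have Hc: "H \<in> carrier_mat d d" by (simp add: H_def)
  have "unitary_mat d H"
  proof (rule unitary_matI[OF Hc], rule eq_matI)
    fix x y assume "x < dim_row (1\<^sub>m d :: complex mat)" "y < dim_col (1\<^sub>m d :: complex mat)"
    then have xy: "x < d" "y < d" by auto
    have "(mat_adjoint H * H) $$ (x, y) = complex_of_real (\<Sum>l<d. Hf l x * Hf l y)"
      using xy Hc by (simp add: scalar_prod_def atLeast0LessThan) (simp add: H_def)
    also have "(\<Sum>l<d. Hf l x * Hf l y) = (\<Sum>l<d. Hf x l * Hf l y)" by (simp only: Hsym[of _ x])
    also have "complex_of_real \<dots> = 1\<^sub>m d $$ (x, y)" using xy by (simp add: HH)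
    finally show "(mat_adjoint H * H) $$ (x, y) = 1\<^sub>m d $$ (x, y)" .
  qed (use Hc in auto)
  have He: "Hf x (e i) = u \<epsilon> i x" if "i < s" "x < d" for x i
  proof -
    have vj: "v j (e i) = (if j = i then q i / 2 else 0)" if "j < s" for j
      using that \<open>i < s\<close> v0[OF \<open>j < s\<close>, of "e i"] e_in_C_iff[of i j] by (auto simp: v_def q_def)
    have "(\<Sum>j<s. 2 * v j x * v j (e i) / q j) = (\<Sum>j<s. if j = i then v i x * q i / q i else 0)"
      by (intro sum.cong refl) (simp add: vj)
    also have "\<dots> = v i x * q i / q i" using \<open>i < s\<close> by simp
    also have "\<dots> = v i x"
    proof (cases "q i = 0")
      case True
      then have "(\<Sum>y<d. (v i y)\<^sup>2) = 0" using orth[of i i] \<open>i < s\<close> by (simp add: power2_eq_square)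
      then show ?thesis using \<open>x < d\<close> by (simp add: sum_nonneg_eq_0_iff)
    qed simp
    finally show ?thesis by (simp add: Hf_def v_def)
  qed
  have Hs: "Hf x y * \<sigma> y = \<sigma> x * Hf x y" for x y
  proof -
    have "(\<Sum>i<s. 2 * v i x * v i y / q i) * \<sigma> y = \<sigma> x * (\<Sum>i<s. 2 * v i x * v i y / q i)"
      unfolding sum_distrib_left sum_distrib_right
    proof (intro sum.cong refl)
      fix i assume "i \<in> {..<s}"
      then show "2 * v i x * v i y / q i * \<sigma> y = \<sigma> x * (2 * v i x * v i y / q i)"
        using v0[of i x] v0[of i y] \<sigma>_C[of i x] \<sigma>_C[of i y] by (cases "x \<in> C i"; cases "y \<in> C i") auto
    qed
    then show ?thesis by (simp add: Hf_def left_diff_distrib right_diff_distrib)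
  qed
  have a\<rho>: "a (\<rho> y) = \<sigma> y + (\<Sum>i<s. if y = e i then z (\<pi> i) / real d else 0)" if "y < d" for y
  proof (cases "y \<in> e ` {..<s}")
    case True
    then obtain j where j: "j < s" "y = e j" by auto
    have "(\<Sum>i<s. if y = e i then z (\<pi> i) / real d else 0) = (\<Sum>i<s. if i = j then z (\<pi> j) / real d else 0)"
      using j e_inj by (intro sum.cong) auto
    then show ?thesis
      using j \<rho>e a_e[OF \<pi>s[OF j(1)]] \<sigma>_C[OF j(1) e_C[OF j(1)]] by (simp add: add_divide_distrib)
  next
    case False
    then have "(\<Sum>i<s. if y = e i then z (\<pi> i) / real d else 0) = 0" by (intro sum.neutral) auto
    then show ?thesis using False a_rest[OF that False] by (simp add: \<rho>_def)
  qed
  have "H * dmat d (\<lambda>x. a (\<rho> x)) * mat_adjoint H = cmat (X (\<lambda>i. z (\<pi> i)) \<epsilon>)"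
  proof (rule eq_matI)
    fix x y assume "x < dim_row (cmat (X (\<lambda>i. z (\<pi> i)) \<epsilon>))" "y < dim_col (cmat (X (\<lambda>i. z (\<pi> i)) \<epsilon>))"
    then have xy: "x < d" "y < d" by (auto simp: X_def)
    have "(H * dmat d (\<lambda>x. a (\<rho> x)) * mat_adjoint H) $$ (x, y)
       = complex_of_real (\<Sum>l<d. a (\<rho> l) * (Hf x l * Hf y l))"
      unfolding conj_dmat_entry[OF Hc xy] using xy by (simp add: H_def)
    also have "(\<Sum>l<d. a (\<rho> l) * (Hf x l * Hf y l))
       = (\<Sum>l<d. \<sigma> x * (Hf x l * Hf l y)) + (\<Sum>l<d. \<Sum>i<s. if l = e i then z (\<pi> i) / real d * (Hf x l * Hf y l) else 0)"
      unfolding sum.distrib[symmetric]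
    proof (intro sum.cong refl)
      fix l assume l: "l \<in> {..<d}"
      have "\<sigma> l * (Hf x l * Hf y l) = \<sigma> x * (Hf x l * Hf l y)"
        using Hs[of x l] Hsym[of y l] by (simp add: algebra_simps)
      moreover have "(\<Sum>i<s. if l = e i then z (\<pi> i) / real d else 0) * (Hf x l * Hf y l)
         = (\<Sum>i<s. if l = e i then z (\<pi> i) / real d * (Hf x l * Hf y l) else 0)"
        unfolding sum_distrib_right by (intro sum.cong) auto
      ultimately show "a (\<rho> l) * (Hf x l * Hf y l) = \<sigma> x * (Hf x l * Hf l y)
         + (\<Sum>i<s. if l = e i then z (\<pi> i) / real d * (Hf x l * Hf y l) else 0)"
        using l by (simp add: a\<rho> distrib_right)
    qed
    also have "(\<Sum>l<d. \<sigma> x * (Hf x l * Hf l y)) = (if x = y then \<sigma> x else 0)"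
      unfolding sum_distrib_left[symmetric] HH[OF xy] by simp
    also have "(\<Sum>l<d. \<Sum>i<s. if l = e i then z (\<pi> i) / real d * (Hf x l * Hf y l) else 0)
       = (\<Sum>i<s. \<Sum>l<d. if l = e i then z (\<pi> i) / real d * (Hf x l * Hf y l) else 0)"
      by (rule sum.swap)
    also have "\<dots> = (\<Sum>i<s. z (\<pi> i) / real d * (u \<epsilon> i x * u \<epsilon> i y))"
      using xy by (intro sum.cong refl) (simp add: He e_less)
    finally show "(H * dmat d (\<lambda>x. a (\<rho> x)) * mat_adjoint H) $$ (x, y) = cmat (X (\<lambda>i. z (\<pi> i)) \<epsilon>) $$ (x, y)"
      using xy by (simp add: X_def)
  qed (use Hc in \<open>auto simp: X_def\<close>)
  moreover have "H * dmat d (\<lambda>x. a (\<rho> x)) * mat_adjoint H = (H * P) * dmat d a * mat_adjoint (H * P)"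
  proof -
    have Pc: "P \<in> carrier_mat d d" "mat_adjoint P \<in> carrier_mat d d"
      using P(1) by (auto simp: unitary_mat_def)
    show ?thesis
      using Hc Pc mat_adjoint_carrier[OF Hc] by (simp add: P(2) mat_adjoint_mult assoc_mult_square[where n = d])
  qed
  ultimately show thesis
    using that[of "H * P"] unitary_mat_mult[OF \<open>unitary_mat d H\<close> P(1)] by simp
qed

end

section \<open>Estimates for averages over signs and permutations\<close>

lemma power_sum_le: 
  fixes x :: "nat \<Rightarrow> real"
  assumes "s > 0" "\<And>i. i < s \<Longrightarrow> x i \<ge> 0"
  shows "(\<Sum>i<s. x i) ^ m \<le> real s ^ m * (\<Sum>i<s. x i ^ m)"
proof -
  define M where "M = Max (x ` {..<s})"
  have fin: "finite (x ` {..<s})" "x ` {..<s} \<noteq> {}" using assms(1) by auto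
  have "M \<in> x ` {..<s}" unfolding M_def by (rule Max_in[OF fin])
  then obtain j where j: "j < s" "M = x j" by auto
  have "(\<Sum>i<s. x i) \<le> (\<Sum>i<s. M)"
    using fin by (intro sum_mono) (auto simp: M_def)
  then have "(\<Sum>i<s. x i) ^ m \<le> (real s * x j) ^ m"
    using assms j by (intro power_mono) (auto intro: sum_nonneg)
  also have "\<dots> = real s ^ m * x j ^ m" by (simp add: power_mult_distrib)
  also have "\<dots> \<le> real s ^ m * (\<Sum>i<s. x i ^ m)"
    using j assms by (intro mult_left_mono member_le_sum) auto
  finally show ?thesis .
qed

lemma double_sum_factor:
  fixes c V B :: real
  shows "c * (\<Sum>x\<in>A. c * (\<Sum>y\<in>A'. V * (B * g x y))) = V * B * c\<^sup>2 * (\<Sum>x\<in>A. \<Sum>y\<in>A'. g x y)"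
  by (simp add: sum_distrib_left power2_eq_square mult_ac)

lemma sum_snd_snd:
  fixes F :: "'c \<Rightarrow> real"
  shows "(\<Sum>x\<in>A \<times> B \<times> E. F (snd (snd x))) = real (card A) * real (card B) * (\<Sum>e\<in>E. F e)"
proof -
  have "(\<Sum>x\<in>A \<times> B \<times> E. F (snd (snd x))) = (\<Sum>a\<in>A. \<Sum>p\<in>B \<times> E. F (snd p))"
    using sum.cartesian_product[of "\<lambda>a p. F (snd p)" "B \<times> E" A] by (simp add: case_prod_beta)
  also have "(\<Sum>p\<in>B \<times> E. F (snd p)) = (\<Sum>b\<in>B. \<Sum>e\<in>E. F e)"
    using sum.cartesian_product[of "\<lambda>b e. F e" E B] by (simp add: case_prod_beta)
  finally show ?thesis by simp
qed

lemma sum_geometric_tail_le: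
  fixes y :: real
  assumes "0 \<le> y" "y \<le> 1 / 2"
  shows "(\<Sum>m\<in>{k..n}. y ^ m) \<le> 2 * y ^ k"
proof (cases "k \<le> n")
  case True
  have "(1 - y) * (\<Sum>m\<in>{k..n}. y ^ m) = y ^ k - y ^ Suc n"
    using sum_gp_multiplied[OF True, of y] .
  also have "\<dots> \<le> y ^ k" using assms by simp
  finally have "(1 - y) * (\<Sum>m\<in>{k..n}. y ^ m) \<le> y ^ k" .
  moreover have "1 / 2 * (\<Sum>m\<in>{k..n}. y ^ m) \<le> (1 - y) * (\<Sum>m\<in>{k..n}. y ^ m)"
    using assms by (intro mult_right_mono sum_nonneg) auto
  ultimately show ?thesis by linarith
qed (use assms in simp)

lemma choose_fact_le_power: "real (n choose m) * fact m \<le> real n ^ m"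
proof -
  have "(n choose m) * fact m \<le> n ^ m" by (rule binomial_fact_pow)
  then show ?thesis by (metis of_nat_fact of_nat_le_iff of_nat_mult of_nat_power)
qed

lemma finite_sign_vectors: "finite (Pi\<^sub>E {..<d::nat} (\<lambda>_. {-1, 1::real}))"
  by (intro finite_PiE) auto

lemma card_sign_vectors: "card (Pi\<^sub>E {..<d::nat} (\<lambda>_. {-1, 1::real})) = 2 ^ d"
  by (subst card_PiE) (auto simp: numeral_2_eq_2)

lemma injections_self_nonempty: "injections {..<s::nat} {..<s} \<noteq> {}"
proof -
  have "(\<lambda>i\<in>{..<s}. i) \<in> injections {..<s} {..<s}"
    by (auto simp: injections_def inj_on_def)
  then show ?thesis by blast
qed

context chunked_spectrum
begin

text \<open>For fixed \<epsilon>' an overlap is a Rademacher sum whose L coefficients have modulus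
  1/L, hence variance 1/L, and Khintchine applies. Combining the s chunks crudely costs a power of
  s, which is harmless because s does not grow with d.\<close>

lemma overlap_moment:
  assumes "\<epsilon>' \<in> signs"
  shows "(\<Sum>\<epsilon>\<in>signs. (\<Sum>i<s. (overlap \<epsilon> \<epsilon>' i)\<^sup>2) ^ m)
    \<le> 2 ^ d * (real s ^ (m + 1) * (2 ^ m * fact m) / real L ^ m)"
proof -
  have one: "(\<Sum>\<epsilon>\<in>signs. (overlap \<epsilon> \<epsilon>' i) ^ (2 * m)) \<le> 2 ^ d * (2 ^ m * fact m / real L ^ m)" if "i < s" for i
  proof -
    define y where "y = (\<lambda>x. if x \<in> C i then \<epsilon>' x / real L else 0)"
    have ov: "overlap \<epsilon> \<epsilon>' i = (\<Sum>x<d. \<epsilon> x * y x)" for \<epsilon>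
      unfolding overlap_def by (intro sum.cong) (auto simp: u_def y_def)
    have "(\<Sum>x<d. (y x)\<^sup>2) = (\<Sum>x<d. if x \<in> C i then 1 / (real L)\<^sup>2 else 0)"
      using sign_square[OF assms] by (intro sum.cong) (auto simp: y_def power2_eq_square)
    also have "\<dots> = 1 / real L"
      using C_sub[OF that] C_card[OF that] L_pos
      by (simp add: sum.inter_restrict[symmetric] Int_absorb1 power2_eq_square)
    finally have yy: "(\<Sum>x<d. (y x)\<^sup>2) = 1 / real L" .
    have "(\<Sum>\<epsilon>\<in>signs. (overlap \<epsilon> \<epsilon>' i) ^ (2 * m)) \<le> 2 ^ d * (odd_fact m * (1 / real L) ^ m)"
      unfolding ov using Rademacher_even_moment[of "{..<d}" y m] yy by simp
    also have "\<dots> \<le> 2 ^ d * ((2 ^ m * fact m) * (1 / real L) ^ m)"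
      using odd_fact_le[of m] by (intro mult_left_mono mult_right_mono) auto
    finally show ?thesis by (simp add: power_divide)
  qed
  have "(\<Sum>\<epsilon>\<in>signs. (\<Sum>i<s. (overlap \<epsilon> \<epsilon>' i)\<^sup>2) ^ m)
     \<le> (\<Sum>\<epsilon>\<in>signs. real s ^ m * (\<Sum>i<s. (overlap \<epsilon> \<epsilon>' i) ^ (2 * m)))"
    using power_sum_le[OF s_pos, of "\<lambda>i. (overlap _ \<epsilon>' i)\<^sup>2" m] by (intro sum_mono) (simp add: power_mult)
  also have "\<dots> = real s ^ m * (\<Sum>i<s. \<Sum>\<epsilon>\<in>signs. (overlap \<epsilon> \<epsilon>' i) ^ (2 * m))"
    by (subst sum.swap) (simp add: sum_distrib_left)
  also have "\<dots> \<le> real s ^ m * (\<Sum>i<s. 2 ^ d * (2 ^ m * fact m / real L ^ m))"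
    by (intro mult_left_mono sum_mono one) auto
  also have "\<dots> = 2 ^ d * (real s ^ (m + 1) * (2 ^ m * fact m) / real L ^ m)"
    by simp
  finally show ?thesis .
qed

text \<open>The signs randomise the directions of the eigenvectors; the permutations symmetrise the
  assignment of the values to the chunks.\<close>

definition avg_outcome :: "nat \<Rightarrow> complex mat \<Rightarrow> (nat \<Rightarrow> real) \<Rightarrow> real" where
  "avg_outcome n M z = (\<Sum>\<pi>\<in>injections {..<s} {..<s}. \<Sum>\<epsilon>\<in>signs.
     outcome_prob M (tensor_power (cmat (X (\<lambda>i. z (\<pi> i)) \<epsilon>)) n)) / (card (injections {..<s} {..<s}) * 2 ^ d)"

text \<open>The two averages form one signed mixture over \<open>?\<Omega>\<close>, and the
  chi-square bound is a signed mean of (1 + Y)^n. After binomial expansion the orders below k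
  vanish. In the others |Y| is at most K^2/d times the sum of the squared overlaps, and the m! of
  the moment bound cancels against \<open>n choose m\<close>. This leaves a geometric series with
  ratio y, started at y^k.\<close>

lemma avg_outcome_diff:
  fixes zA zB :: "nat \<Rightarrow> real" and K :: real
  assumes M: "effect (d ^ n) M"
    and moments: "\<And>m. m < k \<Longrightarrow> (\<Sum>i<s. zA i ^ m) = (\<Sum>i<s. zB i ^ m)"
    and mean: "(\<Sum>i<s. zA i) = 0" "(\<Sum>i<s. zB i) = 0"
    and bound: "\<And>i. i < s \<Longrightarrow> \<bar>zA i\<bar> \<le> K" "\<And>i. i < s \<Longrightarrow> \<bar>zB i\<bar> \<le> K"
    and y: "y = 2 * K\<^sup>2 * real s * real n / (real d * real L)" "y \<le> 1 / 2"
  shows "(avg_outcome n M zA - avg_outcome n M zB)\<^sup>2 \<le> 8 * real s * y ^ k"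
proof -
  let ?\<Pi> = "injections {..<s} {..<s}"
  define w where "w = 1 / (real (card ?\<Pi>) * 2 ^ d)"
  define zt where "zt = (\<lambda>t. if t then zA else zB)"
  define sg where "sg = (\<lambda>t. if t then w else - w)"
  let ?\<Omega> = "(UNIV :: bool set) \<times> ?\<Pi> \<times> signs"
  define XX where "XX = (\<lambda>(t, \<pi>, \<epsilon>). X (\<lambda>i. zt t (\<pi> i)) \<epsilon>)"
  define cc where "cc = (\<lambda>(t, \<pi> :: nat \<Rightarrow> nat, \<epsilon> :: nat \<Rightarrow> real). sg t)"
  define Y where "Y = (\<lambda>(t, \<pi>, \<epsilon>) (t', \<pi>', \<epsilon>'). \<Sum>i<s. zt t (\<pi> i) * (zt t' (\<pi>' i) * (overlap \<epsilon> \<epsilon>' i)\<^sup>2 / real d))"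
  have fin\<Pi>: "finite ?\<Pi>" by (rule finite_injections) auto
  have fin: "finite ?\<Omega>" using fin\<Pi> finite_sign_vectors[of d] by auto
  have card\<Pi>: "card ?\<Pi> > 0" using fin\<Pi> injections_self_nonempty by (simp add: card_gt_0_iff)
  have w: "w > 0" using card\<Pi> by (simp add: w_def)
  have \<pi>s: "\<pi> i < s" if "\<pi> \<in> ?\<Pi>" "i < s" for \<pi> i using that by (auto simp: injections_def)
  have zt_bound: "\<bar>zt t i\<bar> \<le> K" if "i < s" for t i using bound that by (simp add: zt_def)
  have K0: "K \<ge> 0" using bound(1)[of 0] s_pos by linarith
  have zt_sum: "(\<Sum>i<s. zt t (\<pi> i)) = 0" if "\<pi> \<in> ?\<Pi>" for t \<pi>
  proof -
    have "bij_betw \<pi> {..<s} {..<s}"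
      using that endo_inj_surj[of "{..<s}" \<pi>] by (auto simp: injections_def bij_betw_def)
    then have "(\<Sum>i<s. zt t (\<pi> i)) = (\<Sum>i<s. zt t i)" by (rule sum.reindex_bij_betw)
    then show ?thesis using mean by (simp add: zt_def)
  qed
  have diff: "avg_outcome n M zA - avg_outcome n M zB
      = (\<Sum>\<omega>\<in>?\<Omega>. cc \<omega> * outcome_prob M (tensor_power (cmat (XX \<omega>)) n))"
  proof -
    have "(\<Sum>\<omega>\<in>?\<Omega>. cc \<omega> * outcome_prob M (tensor_power (cmat (XX \<omega>)) n))
      = (\<Sum>t\<in>UNIV. \<Sum>\<pi>\<in>?\<Pi>. \<Sum>\<epsilon>\<in>signs. sg t * outcome_prob M (tensor_power (cmat (X (\<lambda>i. zt t (\<pi> i)) \<epsilon>)) n))"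
      by (simp add: sum.cartesian_product XX_def cc_def case_prod_beta)
    also have "\<dots> = (\<Sum>t\<in>UNIV. sg t * (\<Sum>\<pi>\<in>?\<Pi>. \<Sum>\<epsilon>\<in>signs. outcome_prob M (tensor_power (cmat (X (\<lambda>i. zt t (\<pi> i)) \<epsilon>)) n)))"
      by (simp only: sum_distrib_left)
    also have "\<dots> = avg_outcome n M zA - avg_outcome n M zB"
      by (simp add: UNIV_bool avg_outcome_def sg_def zt_def w_def)
    finally show ?thesis by simp
  qed
  have "(avg_outcome n M zA - avg_outcome n M zB)\<^sup>2
     \<le> (\<Sum>\<omega>\<in>?\<Omega>. \<Sum>\<omega>'\<in>?\<Omega>. cc \<omega> * cc \<omega>' * (\<Sum>i<d. \<Sum>j<d. XX \<omega> $$ (i, j) * XX \<omega>' $$ (i, j) / \<sigma> i) ^ n)"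
    unfolding diff
  proof (rule outcome_prob_sum_chi_square[OF M d_pos \<sigma>_nonneg \<sigma>_sum, where X = XX and c = cc])
    show "XX \<omega> \<in> carrier_mat d d" for \<omega> by (simp add: XX_def case_prod_beta)
    show "XX \<omega> $$ (i, j) = 0" if "i < d" "j < d" "\<sigma> i = 0" for \<omega> i j
      using X_support[OF that] by (simp add: XX_def case_prod_beta)
  qed
  also have "\<dots> = (\<Sum>\<omega>\<in>?\<Omega>. \<Sum>\<omega>'\<in>?\<Omega>. cc \<omega> * cc \<omega>' * (Y \<omega> \<omega>' + 1) ^ n)"
  proof (intro sum.cong refl)
    fix \<omega> \<omega>' assume h: "\<omega> \<in> ?\<Omega>" "\<omega>' \<in> ?\<Omega>"
    obtain t \<pi> \<epsilon> where o1: "\<omega> = (t, \<pi>, \<epsilon>)" by (cases \<omega>)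
    obtain t' \<pi>' \<epsilon>' where o2: "\<omega>' = (t', \<pi>', \<epsilon>')" by (cases \<omega>')
    have "(\<Sum>i<d. \<Sum>j<d. XX \<omega> $$ (i, j) * XX \<omega>' $$ (i, j) / \<sigma> i) = 1 + Y \<omega> \<omega>'"
      unfolding o1 o2 XX_def Y_def prod.case
      by (rule X_inner) (use h zt_sum in \<open>auto simp: o1 o2\<close>)
    then show "cc \<omega> * cc \<omega>' * (\<Sum>i<d. \<Sum>j<d. XX \<omega> $$ (i, j) * XX \<omega>' $$ (i, j) / \<sigma> i) ^ n
       = cc \<omega> * cc \<omega>' * (Y \<omega> \<omega>' + 1) ^ n" by (simp add: add.commute)
  qed
  also have "\<dots> = (\<Sum>m\<le>n. real (n choose m) * (\<Sum>\<omega>\<in>?\<Omega>. \<Sum>\<omega>'\<in>?\<Omega>. cc \<omega> * cc \<omega>' * Y \<omega> \<omega>' ^ m))"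
  proof -
    have "(\<Sum>\<omega>\<in>?\<Omega>. \<Sum>\<omega>'\<in>?\<Omega>. cc \<omega> * cc \<omega>' * (Y \<omega> \<omega>' + 1) ^ n)
      = (\<Sum>\<omega>\<in>?\<Omega>. \<Sum>\<omega>'\<in>?\<Omega>. \<Sum>m\<le>n. real (n choose m) * (cc \<omega> * cc \<omega>' * Y \<omega> \<omega>' ^ m))"
      unfolding binomial_ring sum_distrib_left by (intro sum.cong refl) (simp add: mult_ac)
    also have "\<dots> = (\<Sum>\<omega>\<in>?\<Omega>. \<Sum>m\<le>n. \<Sum>\<omega>'\<in>?\<Omega>. real (n choose m) * (cc \<omega> * cc \<omega>' * Y \<omega> \<omega>' ^ m))"
      by (rule sum.cong[OF refl], rule sum.swap)
    also have "\<dots> = (\<Sum>m\<le>n. \<Sum>\<omega>\<in>?\<Omega>. \<Sum>\<omega>'\<in>?\<Omega>. real (n choose m) * (cc \<omega> * cc \<omega>' * Y \<omega> \<omega>' ^ m))"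
      by (rule sum.swap)
    finally show ?thesis by (simp only: sum_distrib_left)
  qed
  also have "\<dots> \<le> (\<Sum>m\<le>n. if m < k then 0 else 4 * real s * y ^ m)"
  proof (rule sum_mono)
    fix m
    show "real (n choose m) * (\<Sum>\<omega>\<in>?\<Omega>. \<Sum>\<omega>'\<in>?\<Omega>. cc \<omega> * cc \<omega>' * Y \<omega> \<omega>' ^ m)
        \<le> (if m < k then 0 else 4 * real s * y ^ m)"
    proof (cases "m < k")
      \<comment> \<open>Cancellation in one argument is enough: for a fixed second argument and
        fixed signs, Y is a linear form in the permuted values of the first.\<close>
      case True
      have "(\<Sum>\<omega>\<in>?\<Omega>. cc \<omega> * Y \<omega> \<omega>' ^ m) = 0" for \<omega>'
      proof -
        obtain t' \<pi>' \<epsilon>' where o2: "\<omega>' = (t', \<pi>', \<epsilon>')" by (cases \<omega>')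
        let ?v = "\<lambda>\<epsilon> i. zt t' (\<pi>' i) * (overlap \<epsilon> \<epsilon>' i)\<^sup>2 / real d"
        have "(\<Sum>\<omega>\<in>?\<Omega>. cc \<omega> * Y \<omega> \<omega>' ^ m)
          = (\<Sum>t\<in>UNIV. \<Sum>\<pi>\<in>?\<Pi>. \<Sum>\<epsilon>\<in>signs. sg t * (\<Sum>i<s. zt t (\<pi> i) * ?v \<epsilon> i) ^ m)"
          by (simp add: sum.cartesian_product o2 Y_def cc_def case_prod_beta)
        also have "\<dots> = (\<Sum>t\<in>UNIV. sg t * (\<Sum>\<epsilon>\<in>signs. \<Sum>\<pi>\<in>?\<Pi>. (\<Sum>i<s. zt t (\<pi> i) * ?v \<epsilon> i) ^ m))"
          unfolding sum_distrib_left by (rule sum.cong[OF refl], rule sum.swap)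
        also have "(\<lambda>t. sg t * (\<Sum>\<epsilon>\<in>signs. \<Sum>\<pi>\<in>?\<Pi>. (\<Sum>i<s. zt t (\<pi> i) * ?v \<epsilon> i) ^ m))
            = (\<lambda>t. sg t * (\<Sum>\<epsilon>\<in>signs. \<Sum>\<pi>\<in>?\<Pi>. (\<Sum>i<s. zA (\<pi> i) * ?v \<epsilon> i) ^ m))"
        proof
          fix t
          have "(\<Sum>\<pi>\<in>?\<Pi>. (\<Sum>i<s. zt t (\<pi> i) * ?v \<epsilon> i) ^ m) = (\<Sum>\<pi>\<in>?\<Pi>. (\<Sum>i<s. zA (\<pi> i) * ?v \<epsilon> i) ^ m)" for \<epsilon>
            by (rule sum_injections_power_linear[OF _ _ True]) (auto simp: zt_def moments)
          then show "sg t * (\<Sum>\<epsilon>\<in>signs. \<Sum>\<pi>\<in>?\<Pi>. (\<Sum>i<s. zt t (\<pi> i) * ?v \<epsilon> i) ^ m)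
            = sg t * (\<Sum>\<epsilon>\<in>signs. \<Sum>\<pi>\<in>?\<Pi>. (\<Sum>i<s. zA (\<pi> i) * ?v \<epsilon> i) ^ m)" by simp
        qed
        finally show ?thesis by (simp add: UNIV_bool sg_def)
      qed
      then have "(\<Sum>\<omega>\<in>?\<Omega>. \<Sum>\<omega>'\<in>?\<Omega>. cc \<omega> * cc \<omega>' * Y \<omega> \<omega>' ^ m) = 0"
        by (subst sum.swap) (simp add: mult.assoc mult.left_commute[of "cc _" "cc _"] flip: sum_distrib_left)
      then show ?thesis using True by simp
    next
      case False
      have Yb: "\<bar>Y (t, \<pi>, \<epsilon>) (t', \<pi>', \<epsilon>')\<bar> \<le> K\<^sup>2 / real d * (\<Sum>i<s. (overlap \<epsilon> \<epsilon>' i)\<^sup>2)"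
        if "\<pi> \<in> ?\<Pi>" "\<pi>' \<in> ?\<Pi>" for t \<pi> \<epsilon> t' \<pi>' \<epsilon>'
      proof -
        have "\<bar>Y (t, \<pi>, \<epsilon>) (t', \<pi>', \<epsilon>')\<bar> \<le> (\<Sum>i<s. \<bar>zt t (\<pi> i)\<bar> * (\<bar>zt t' (\<pi>' i)\<bar> * (overlap \<epsilon> \<epsilon>' i)\<^sup>2 / real d))"
          unfolding Y_def prod.case by (rule order_trans[OF sum_abs]) (simp add: abs_mult)
        also have "\<dots> \<le> (\<Sum>i<s. K * (K * (overlap \<epsilon> \<epsilon>' i)\<^sup>2 / real d))"
          using \<pi>s that K0
          by (intro sum_mono mult_mono divide_right_mono mult_right_mono zt_bound) auto
        also have "\<dots> = K\<^sup>2 / real d * (\<Sum>i<s. (overlap \<epsilon> \<epsilon>' i)\<^sup>2)"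
          by (simp add: sum_distrib_left power2_eq_square mult.assoc)
        finally show ?thesis .
      qed
      let ?B = "(K\<^sup>2 / real d) ^ m"
      have "(\<Sum>\<omega>\<in>?\<Omega>. \<Sum>\<omega>'\<in>?\<Omega>. cc \<omega> * cc \<omega>' * Y \<omega> \<omega>' ^ m)
        \<le> (\<Sum>\<omega>\<in>?\<Omega>. \<Sum>\<omega>'\<in>?\<Omega>. w * w * (?B * (\<Sum>i<s. (overlap (snd (snd \<omega>)) (snd (snd \<omega>')) i)\<^sup>2) ^ m))"
      proof (intro sum_mono)
        fix \<omega> \<omega>' assume h: "\<omega> \<in> ?\<Omega>" "\<omega>' \<in> ?\<Omega>"
        obtain t \<pi> \<epsilon> where o1: "\<omega> = (t, \<pi>, \<epsilon>)" by (cases \<omega>)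
        obtain t' \<pi>' \<epsilon>' where o2: "\<omega>' = (t', \<pi>', \<epsilon>')" by (cases \<omega>')
        have "\<bar>cc \<omega> * cc \<omega>' * Y \<omega> \<omega>' ^ m\<bar> = w * w * \<bar>Y \<omega> \<omega>'\<bar> ^ m"
          using w by (simp add: o1 o2 cc_def sg_def abs_mult power_abs)
        also have "\<dots> \<le> w * w * (K\<^sup>2 / real d * (\<Sum>i<s. (overlap \<epsilon> \<epsilon>' i)\<^sup>2)) ^ m"
          using h w unfolding o1 o2 by (intro mult_left_mono power_mono Yb) auto
        finally have "\<bar>cc \<omega> * cc \<omega>' * Y \<omega> \<omega>' ^ m\<bar> \<le> w * w * (?B * (\<Sum>i<s. (overlap \<epsilon> \<epsilon>' i)\<^sup>2) ^ m)"
          by (simp only: power_mult_distrib)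
        then have "cc \<omega> * cc \<omega>' * Y \<omega> \<omega>' ^ m \<le> w * w * (?B * (\<Sum>i<s. (overlap \<epsilon> \<epsilon>' i)\<^sup>2) ^ m)"
          by (rule abs_le_D1)
        then show "cc \<omega> * cc \<omega>' * Y \<omega> \<omega>' ^ m
           \<le> w * w * (?B * (\<Sum>i<s. (overlap (snd (snd \<omega>)) (snd (snd \<omega>')) i)\<^sup>2) ^ m)"
          by (simp only: o1 o2 snd_conv)
      qed
      also have "\<dots> = w * w * ?B * (real (2 * card ?\<Pi>))\<^sup>2 * (\<Sum>\<epsilon>'\<in>signs. \<Sum>\<epsilon>\<in>signs. (\<Sum>i<s. (overlap \<epsilon> \<epsilon>' i)\<^sup>2) ^ m)"
      proof -
        have "(\<Sum>\<omega>\<in>?\<Omega>. F (snd (snd \<omega>))) = real (2 * card ?\<Pi>) * (\<Sum>\<epsilon>\<in>signs. F \<epsilon>)" for F :: "(nat \<Rightarrow> real) \<Rightarrow> real"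
          using sum_snd_snd[of F "UNIV :: bool set" ?\<Pi> signs] by simp
        note pull = this
        define G where "G = (\<lambda>\<epsilon> \<epsilon>'. (\<Sum>i<s. (overlap \<epsilon> \<epsilon>' i)\<^sup>2) ^ m)"
        let ?c = "real (2 * card ?\<Pi>)"
        have "(\<Sum>\<omega>\<in>?\<Omega>. \<Sum>\<omega>'\<in>?\<Omega>. w * w * (?B * G (snd (snd \<omega>)) (snd (snd \<omega>'))))
          = (\<Sum>\<omega>\<in>?\<Omega>. ?c * (\<Sum>\<epsilon>'\<in>signs. w * w * (?B * G (snd (snd \<omega>)) \<epsilon>')))"
          by (rule sum.cong[OF refl], rule pull[of "\<lambda>\<epsilon>'. w * w * (?B * G (snd (snd _)) \<epsilon>')"])
        also have "\<dots> = ?c * (\<Sum>\<epsilon>\<in>signs. ?c * (\<Sum>\<epsilon>'\<in>signs. w * w * (?B * G \<epsilon> \<epsilon>')))"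
          by (rule pull[of "\<lambda>\<epsilon>. ?c * (\<Sum>\<epsilon>'\<in>signs. w * w * (?B * G \<epsilon> \<epsilon>'))"])
        also have "\<dots> = w * w * ?B * ?c\<^sup>2 * (\<Sum>\<epsilon>\<in>signs. \<Sum>\<epsilon>'\<in>signs. G \<epsilon> \<epsilon>')"
          by (rule double_sum_factor)
        also have "(\<Sum>\<epsilon>\<in>signs. \<Sum>\<epsilon>'\<in>signs. G \<epsilon> \<epsilon>') = (\<Sum>\<epsilon>'\<in>signs. \<Sum>\<epsilon>\<in>signs. G \<epsilon> \<epsilon>')"
          by (rule sum.swap)
        finally show ?thesis by (simp only: G_def)
      qed
      also have "\<dots> \<le> w * w * ?B * (real (2 * card ?\<Pi>))\<^sup>2 *
          (\<Sum>\<epsilon>'\<in>signs. 2 ^ d * (real s ^ (m + 1) * (2 ^ m * fact m) / real L ^ m))"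
        using w K0 by (intro mult_left_mono sum_mono overlap_moment) auto
      \<comment> \<open>The 4 is the square of the total mass 2 of the signed weights.\<close>
      also have "\<dots> = 4 * ?B * (real s ^ (m + 1) * (2 ^ m * fact m) / real L ^ m)"
      proof -
        have "w * w * (real (2 * card ?\<Pi>))\<^sup>2 * (2 ^ d * 2 ^ d) = 4"
          using card\<Pi> by (simp add: w_def power2_eq_square field_simps)
        moreover have "(\<Sum>\<epsilon>'\<in>signs. 2 ^ d * Q) = (2 ^ d * 2 ^ d) * Q" for Q :: real
          by (simp add: card_sign_vectors)
        moreover have "w * w * b * p * ((2 ^ d * 2 ^ d) * Q) = (w * w * p * (2 ^ d * 2 ^ d)) * b * Q" for b p Q :: real
          by (simp only: mult_ac)
        ultimately show ?thesis by (simp only:)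
      qed
      finally have "(\<Sum>\<omega>\<in>?\<Omega>. \<Sum>\<omega>'\<in>?\<Omega>. cc \<omega> * cc \<omega>' * Y \<omega> \<omega>' ^ m)
        \<le> 4 * ?B * (real s ^ (m + 1) * (2 ^ m * fact m) / real L ^ m)" .
      then have "real (n choose m) * (\<Sum>\<omega>\<in>?\<Omega>. \<Sum>\<omega>'\<in>?\<Omega>. cc \<omega> * cc \<omega>' * Y \<omega> \<omega>' ^ m)
        \<le> real (n choose m) * (4 * ?B * (real s ^ (m + 1) * (2 ^ m * fact m) / real L ^ m))"
        by (rule mult_left_mono) simp
      also have "\<dots> = (real (n choose m) * fact m) * (4 * ?B * (real s ^ (m + 1) * 2 ^ m / real L ^ m))"
        by simp
      also have "\<dots> \<le> real n ^ m * (4 * ?B * (real s ^ (m + 1) * 2 ^ m / real L ^ m))"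
        using K0 by (intro mult_right_mono choose_fact_le_power) auto
      also have "\<dots> = 4 * real s * y ^ m"
        unfolding y(1) by (simp add: power_mult_distrib power_divide)
      finally show ?thesis using False by simp
    qed
  qed
  also have "\<dots> = (\<Sum>m\<in>{..n} - {..<k}. 4 * real s * y ^ m)"
    by (rule sum.mono_neutral_cong_right) auto
  also have "{..n} - {..<k} = {k..n}" by auto
  also have "(\<Sum>m\<in>{k..n}. 4 * real s * y ^ m) = 4 * real s * (\<Sum>m\<in>{k..n}. y ^ m)"
    by (simp add: sum_distrib_left)
  also have "\<dots> \<le> 4 * real s * (2 * y ^ k)"
    using y by (intro mult_left_mono sum_geometric_tail_le) auto
  finally show ?thesis by simp
qed

lemma avg_outcome_close:
  assumes "\<And>\<pi> \<epsilon>. \<pi> \<in> injections {..<s} {..<s} \<Longrightarrow> \<epsilon> \<in> signs \<Longrightarrow>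
    \<bar>outcome_prob M (tensor_power (cmat (X (\<lambda>i. z (\<pi> i)) \<epsilon>)) n) - c\<bar> \<le> \<xi>"
  shows "\<bar>avg_outcome n M z - c\<bar> \<le> \<xi>"
proof -
  let ?\<Pi> = "injections {..<s} {..<s}"
  let ?N = "real (card ?\<Pi>) * 2 ^ d"
  let ?f = "\<lambda>\<pi> \<epsilon>. outcome_prob M (tensor_power (cmat (X (\<lambda>i. z (\<pi> i)) \<epsilon>)) n)"
  have "finite ?\<Pi>" by (rule finite_injections) auto
  then have card: "card ?\<Pi> \<noteq> 0" using injections_self_nonempty by (simp add: card_gt_0_iff)
  then have N: "?N > 0" by simp
  have const: "(\<Sum>\<pi>\<in>?\<Pi>. \<Sum>\<epsilon>\<in>signs. r) = ?N * r" for r :: real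
    by (simp add: card_sign_vectors)
  have "?N * (avg_outcome n M z - c) = (\<Sum>\<pi>\<in>?\<Pi>. \<Sum>\<epsilon>\<in>signs. ?f \<pi> \<epsilon> - c)"
    unfolding sum_subtractf const using card by (simp add: avg_outcome_def right_diff_distrib)
  then have "?N * \<bar>avg_outcome n M z - c\<bar> = \<bar>\<Sum>\<pi>\<in>?\<Pi>. \<Sum>\<epsilon>\<in>signs. ?f \<pi> \<epsilon> - c\<bar>"
    using N by (metis abs_mult abs_of_pos)
  also have "\<dots> \<le> (\<Sum>\<pi>\<in>?\<Pi>. \<Sum>\<epsilon>\<in>signs. \<bar>?f \<pi> \<epsilon> - c\<bar>)"
    by (rule order_trans[OF sum_abs], intro sum_mono, rule sum_abs)
  also have "\<dots> \<le> (\<Sum>\<pi>\<in>?\<Pi>. \<Sum>\<epsilon>\<in>signs. \<xi>)"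
    by (intro sum_mono assms)
  also have "\<dots> = ?N * \<xi>" by (rule const)
  finally show ?thesis using N mult_le_cancel_left_pos by blast
qed

end

subsection \<open>Interpolating between the two spectra\<close>

text \<open>Matching of power sums survives translation, by the binomial formula; deviations are
  measured from the reference value 1.\<close>

lemma shifted_power_sums:
  fixes a b :: "nat \<Rightarrow> real"
  assumes "\<And>m. m < k \<Longrightarrow> (\<Sum>i<s. a i ^ m) = (\<Sum>i<s. b i ^ m)" "m < k"
  shows "(\<Sum>i<s. (a i + c) ^ m) = (\<Sum>i<s. (b i + c) ^ m)"
proof -
  have "(\<Sum>i<s. (f i + c) ^ m) = (\<Sum>j\<le>m. real (m choose j) * c ^ (m - j) * (\<Sum>i<s. f i ^ j))" for f :: "nat \<Rightarrow> real"
    unfolding binomial_ring by (subst sum.swap) (simp add: sum_distrib_left mult_ac)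
  then show ?thesis using assms by (auto intro!: sum.cong)
qed

text \<open>A reservoir of R coordinates followed by consecutive blocks of length s. The values of
  \<open>f\<close> are in units of 1/d, so blocks of mean 1 keep the trace equal to 1.\<close>

definition block_spectrum :: "nat \<Rightarrow> nat \<Rightarrow> nat \<Rightarrow> (nat \<Rightarrow> nat \<Rightarrow> real) \<Rightarrow> nat \<Rightarrow> real" where
  "block_spectrum d R s f x = (if x < R then 1 else f ((x - R) div s) ((x - R) mod s)) / real d"

lemma sum_lessThan_plus:
  fixes f :: "nat \<Rightarrow> 'a::comm_monoid_add"
  shows "(\<Sum>x<m + n. f x) = (\<Sum>x<m. f x) + (\<Sum>x<n. f (m + x))"
  by (induction n) (auto simp: add.assoc)

lemma block_spectrum_sum:
  assumes "d = R + T * s" "d > 0" "s > 0" "\<And>\<tau>. \<tau> < T \<Longrightarrow> (\<Sum>i<s. f \<tau> i) = real s"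
  shows "(\<Sum>x<d. block_spectrum d R s f x) = 1"
proof -
  have "(\<Sum>x<R + T * s. block_spectrum d R s f x) = (real R + (\<Sum>x<T * s. f (x div s) (x mod s))) / real d"
    unfolding sum_lessThan_plus by (simp add: block_spectrum_def sum_divide_distrib add_divide_distrib)
  also have "(\<Sum>x<T * s. f (x div s) (x mod s)) = (\<Sum>\<tau><T. \<Sum>i<s. f \<tau> i)"
    using assms(3) by (simp add: sum_lessThan_mult)
  also have "\<dots> = real T * real s" using assms(4) by simp
  also have "(real R + real T * real s) / real d = 1"
    using assms(2) arg_cong[OF assms(1), of real] by simp
  finally show ?thesis using assms(1) by simp
qed

lemma block_index:
  fixes R d T s x :: nat
  assumes "d = R + T * s" "x < d" "\<not> x < R"
  shows "(x - R) div s < T" "(x - R) mod s < s"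
  using nat_mult_div_mod_bounds[of "x - R" T s] assms by auto

lemma block_spectrum_nonneg:
  assumes "d = R + T * s" "x < d" "\<And>\<tau> i. \<tau> < T \<Longrightarrow> i < s \<Longrightarrow> f \<tau> i \<ge> 0"
  shows "block_spectrum d R s f x \<ge> 0"
  using block_index[OF assms(1,2)] assms(3) by (auto simp: block_spectrum_def)

text \<open>In the application \<open>a\<close> is the sparse and \<open>b\<close> the positive
  family: t = 0 gives the far spectrum, the last t the low-rank one, and neighbours differ in block
  t alone.\<close>

definition hybrid :: "(nat \<Rightarrow> real) \<Rightarrow> (nat \<Rightarrow> real) \<Rightarrow> nat \<Rightarrow> nat \<Rightarrow> nat \<Rightarrow> real" where
  "hybrid a b t = (\<lambda>\<tau>. if \<tau> < t then a else b)"

text \<open>Both hybrids are compared through the reference whose block t is constantly 1. Chunk i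
  joins one coordinate of block t to its own share of the reservoir, so the reference is flat on it.
  Each hybrid is a unitary conjugate of every \<open>X\<close> built from its values, so almost
  invariance replaces its outcome probability by \<open>avg_outcome\<close> at cost \<xi>.
  Deviations are at most s because nonnegative values with sum s are.\<close>

lemma hybrid_step:
  fixes a b :: "nat \<Rightarrow> real" and T R s d n k t :: nat
  defines "\<mu> \<equiv> (\<lambda>t. block_spectrum d R s (hybrid a b t))"
  assumes dims: "d = R + T * s" "d > 0" "s > 0" and t: "t < T"
    and a: "\<And>i. i < s \<Longrightarrow> 0 \<le> a i" and b: "\<And>i. i < s \<Longrightarrow> 0 \<le> b i"
    and mean: "(\<Sum>i<s. a i) = real s"
    and moments: "\<And>m. m < k \<Longrightarrow> (\<Sum>i<s. a i ^ m) = (\<Sum>i<s. b i ^ m)" and k: "k \<ge> 2"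
    and M: "effect (d ^ n) M"
    and inv: "\<And>t' W. t' \<in> {t, Suc t} \<Longrightarrow> unitary_mat d W \<Longrightarrow>
        \<bar>outcome_prob M (tensor_power (W * dmat d (\<mu> t') * mat_adjoint W) n)
         - outcome_prob M (tensor_power (dmat d (\<mu> t')) n)\<bar> \<le> \<xi>"
    and y: "y = 2 * (real s)\<^sup>2 * real s * real n / (real d * real (R div s + 1))" "y \<le> 1 / 2"
  shows "\<bar>outcome_prob M (tensor_power (dmat d (\<mu> (Suc t))) n) - outcome_prob M (tensor_power (dmat d (\<mu> t)) n)\<bar>
     \<le> 2 * \<xi> + sqrt (8 * real s * y ^ k)"
proof -
  \<comment> \<open>The reservoir is divided evenly among the s chunks; the 1 counts the block
    coordinate itself and keeps L positive.\<close>
  define L where "L = R div s + 1"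
  define g where "g = (\<lambda>\<tau>. if \<tau> < t then a else if \<tau> = t then (\<lambda>_. 1) else b)"
  define \<sigma> where "\<sigma> = block_spectrum d R s g"
  define e where "e = (\<lambda>i. R + t * s + i)"
  define C where "C = (\<lambda>i. insert (e i) ((\<lambda>l. i * (R div s) + l) ` {..<R div s}))"
  have meanb: "(\<Sum>i<s. b i) = real s" using moments[of 1] k mean by simp
  have e_less: "e i < d" if "i < s" for i
  proof -
    have "Suc t * s \<le> T * s" using t by (intro mult_le_mono1) simp
    then show ?thesis using that dims by (simp add: e_def)
  qed
  have low: "i * (R div s) + l < R" if "i < s" "l < R div s" for i l
  proof -
    have "i * (R div s) + l < Suc i * (R div s)" using that by simp
    also have "\<dots> \<le> s * (R div s)" using that by (intro mult_le_mono1) simp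
    also have "\<dots> \<le> R" by simp
    finally show ?thesis .
  qed
  have e_div: "(e i - R) div s = t" "(e i - R) mod s = i" if "i < s" for i
    using that by (auto simp: e_def)
  interpret chunked_spectrum d s L \<sigma> C e
  proof
    show "d > 0" "s > 0" by fact+
    show "L > 0" by (simp add: L_def)
    show "C i \<subseteq> {..<d}" if "i < s" for i
      using e_less[OF that] low[OF that] dims(1) by (fastforce simp: C_def)
    show "card (C i) = L" if "i < s" for i
    proof -
      have "e i \<notin> (\<lambda>l. i * (R div s) + l) ` {..<R div s}"
        using low[OF that] by (fastforce simp: e_def)
      moreover have "card ((\<lambda>l. i * (R div s) + l) ` {..<R div s}) = R div s"
        by (subst card_image) (auto simp: inj_on_def)
      ultimately show ?thesis by (simp add: C_def L_def)
    qed
    show "C i \<inter> C j = {}" if "i < s" "j < s" "i \<noteq> j" for i j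
    proof -
      have 1: "(i * q + l = j * q + l') = False" if "l < q" "l' < q" for q l l'
        using that \<open>i \<noteq> j\<close> by (metis add.commute div_mult_self3 div_less add.right_neutral less_nat_zero_code)
      have "e i \<noteq> e j" using that by (simp add: e_def)
      then show ?thesis
        using low[OF that(1)] low[OF that(2)] 1 by (fastforce simp: C_def e_def)
    qed
    show "e i \<in> C i" for i by (simp add: C_def)
    show "\<sigma> x = 1 / real d" if "i < s" "x \<in> C i" for i x
      using that low[OF that(1)] e_div[OF that(1)]
      by (auto simp: C_def \<sigma>_def block_spectrum_def g_def e_def)
    show "\<sigma> x \<ge> 0" if "x < d" for x
      unfolding \<sigma>_def by (rule block_spectrum_nonneg[OF dims(1) that]) (use a b in \<open>auto simp: g_def\<close>)
    show "(\<Sum>x<d. \<sigma> x) = 1"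
      unfolding \<sigma>_def by (rule block_spectrum_sum[OF dims]) (use mean meanb in \<open>auto simp: g_def\<close>)
  qed
  have le_s: "f i \<le> real s" if "i < s" "\<And>i. i < s \<Longrightarrow> f i \<ge> 0" "(\<Sum>i<s. f i) = real s" for f :: "nat \<Rightarrow> real" and i
    using member_le_sum[of i "{..<s}" f] that by simp
  have a_le: "a i \<le> real s" if "i < s" for i using le_s[of i a] that a mean by simp
  have b_le: "b i \<le> real s" if "i < s" for i using le_s[of i b] that b meanb by simp
  have s1: "real s \<ge> 1" using dims(3) by simp
  have close: "\<bar>avg_outcome n M (\<lambda>i. f i - 1) - outcome_prob M (tensor_power (dmat d (\<mu> t')) n)\<bar> \<le> \<xi>"
    if t': "t' \<in> {t, Suc t}" and f: "\<And>i. hybrid a b t' t i = f i" for t' f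
  proof (rule avg_outcome_close)
    fix \<pi> \<epsilon> assume h: "\<pi> \<in> injections {..<s} {..<s}" "\<epsilon> \<in> signs"
    have 1: "\<mu> t' (e i) = (1 + (f i - 1)) / real d" if "i < s" for i
      using e_div[OF that] f by (simp add: \<mu>_def block_spectrum_def e_def)
    have 2: "\<mu> t' x = \<sigma> x" if "x < d" "x \<notin> e ` {..<s}" for x
    proof (cases "x < R")
      case False
      have "(x - R) div s \<noteq> t"
      proof
        assume "(x - R) div s = t"
        then have "x = e ((x - R) mod s)" using False div_mult_mod_eq[of "x - R" s] by (simp add: e_def)
        then show False using that(2) block_index(2)[OF dims(1) that(1) False] by blast
      qed
      then show ?thesis using t' False by (auto simp: \<mu>_def \<sigma>_def block_spectrum_def hybrid_def g_def)
    qed (simp add: \<mu>_def \<sigma>_def block_spectrum_def)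
    obtain W where W: "unitary_mat d W" "cmat (X (\<lambda>i. f (\<pi> i) - 1) \<epsilon>) = W * dmat d (\<mu> t') * mat_adjoint W"
      using X_unitarily_diagonal[OF h(2,1), of "\<mu> t'" "\<lambda>i. f i - 1"] 1 2 by blast
    show "\<bar>outcome_prob M (tensor_power (cmat (X (\<lambda>i. f (\<pi> i) - 1) \<epsilon>)) n)
        - outcome_prob M (tensor_power (dmat d (\<mu> t')) n)\<bar> \<le> \<xi>"
      unfolding W(2) by (rule inv[OF t' W(1)])
  qed
  have "(avg_outcome n M (\<lambda>i. a i - 1) - avg_outcome n M (\<lambda>i. b i - 1))\<^sup>2 \<le> 8 * real s * y ^ k"
  proof (rule avg_outcome_diff[OF M])
    show "(\<Sum>i<s. (a i - 1) ^ m) = (\<Sum>i<s. (b i - 1) ^ m)" if "m < k" for m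
      using shifted_power_sums[OF moments that, of "-1"] by simp
    show "(\<Sum>i<s. a i - 1) = 0" "(\<Sum>i<s. b i - 1) = 0" using mean meanb by (simp_all add: sum_subtractf)
    show "\<bar>a i - 1\<bar> \<le> real s" if "i < s" for i using a[OF that] a_le[OF that] s1 by simp
    show "\<bar>b i - 1\<bar> \<le> real s" if "i < s" for i using b[OF that] b_le[OF that] s1 by simp
    show "y = 2 * (real s)\<^sup>2 * real s * real n / (real d * real L)" using y(1) by (simp add: L_def)
  qed fact
  then have "\<bar>avg_outcome n M (\<lambda>i. a i - 1) - avg_outcome n M (\<lambda>i. b i - 1)\<bar> \<le> sqrt (8 * real s * y ^ k)"
    by (metis real_sqrt_abs real_sqrt_le_iff)
  moreover note close[of "Suc t" a] close[of t b]
  ultimately show ?thesis by (simp add: hybrid_def)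
qed

section \<open>Symmetrising the tester\<close>

lemma effect_midpoint:
  assumes "effect N A" "effect N B"
  shows "effect N ((1/2) \<cdot>\<^sub>m (A + B))"
proof -
  have psd_mid: "psd_mat N ((1/2) \<cdot>\<^sub>m (A + B))" if "psd_mat N A" "psd_mat N B" for A B
  proof -
    have c: "A \<in> carrier_mat N N" "B \<in> carrier_mat N N" "mat_adjoint A = A" "mat_adjoint B = B"
      using that by (auto simp: psd_mat_def)
    have "mat_adjoint ((1/2) \<cdot>\<^sub>m (A + B)) = (1/2) \<cdot>\<^sub>m (A + B)"
    proof (rule eq_matI)
      fix i j assume "i < dim_row ((1/2) \<cdot>\<^sub>m (A + B))" "j < dim_col ((1/2) \<cdot>\<^sub>m (A + B))"
      then have ij: "i < N" "j < N" using c by auto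
      show "mat_adjoint ((1/2) \<cdot>\<^sub>m (A + B)) $$ (i, j) = ((1/2) \<cdot>\<^sub>m (A + B)) $$ (i, j)"
        using ij c hermitian_entry[OF c(1,3) ij] hermitian_entry[OF c(2,4) ij] by simp
    qed (use c in auto)
    moreover have "0 \<le> (((1/2) \<cdot>\<^sub>m (A + B)) *\<^sub>v v) \<bullet>c v" if v: "v \<in> carrier_vec N" for v
    proof -
      have "((1/2) \<cdot>\<^sub>m (A + B)) *\<^sub>v v = (1/2) \<cdot>\<^sub>v (A *\<^sub>v v + B *\<^sub>v v)"
        using c v by (intro eq_vecI) (auto simp: add_scalar_prod_distrib[of _ N] row_add)
      then have eq: "(((1/2) \<cdot>\<^sub>m (A + B)) *\<^sub>v v) \<bullet>c v = (1/2) * ((A *\<^sub>v v) \<bullet>c v + (B *\<^sub>v v) \<bullet>c v)"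
        using c v by (simp add: add_scalar_prod_distrib[of _ N])
      have "0 \<le> (A *\<^sub>v v) \<bullet>c v" "0 \<le> (B *\<^sub>v v) \<bullet>c v"
        using \<open>psd_mat N A\<close> \<open>psd_mat N B\<close> v by (auto simp: psd_mat_def)
      then show ?thesis unfolding eq by (simp add: less_eq_complex_def)
    qed
    ultimately show ?thesis using c by (simp add: psd_mat_def)
  qed
  have c: "A \<in> carrier_mat N N" "B \<in> carrier_mat N N" using assms by (auto simp: effect_def psd_mat_def)
  have "1\<^sub>m N - (1/2) \<cdot>\<^sub>m (A + B) = (1/2) \<cdot>\<^sub>m ((1\<^sub>m N - A) + (1\<^sub>m N - B))"
  proof (intro eq_matI)
    fix i j assume "i < dim_row ((1/2) \<cdot>\<^sub>m ((1\<^sub>m N - A) + (1\<^sub>m N - B)))" "j < dim_col ((1/2) \<cdot>\<^sub>m ((1\<^sub>m N - A) + (1\<^sub>m N - B)))"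
    then have "i < N" "j < N" using c by auto
    moreover have "x - (p + q) / 2 = ((x - p) + (x - q)) / 2" for x p q :: complex by (simp add: field_simps)
    ultimately show "(1\<^sub>m N - (1/2) \<cdot>\<^sub>m (A + B)) $$ (i, j) = ((1/2) \<cdot>\<^sub>m ((1\<^sub>m N - A) + (1\<^sub>m N - B))) $$ (i, j)"
      using c by simp
  qed (use c in auto)
  then show ?thesis using assms psd_mid[of "1\<^sub>m N - A" "1\<^sub>m N - B"] psd_mid[of A B] by (simp add: effect_def)
qed

lemma effect_conj:
  assumes "effect N A" "unitary_mat N V"
  shows "effect N (mat_adjoint V * A * V)"
proof -
  have c: "A \<in> carrier_mat N N" "V \<in> carrier_mat N N" "mat_adjoint V \<in> carrier_mat N N" "mat_adjoint V * V = 1\<^sub>m N"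
    using assms by (auto simp: effect_def psd_mat_def unitary_mat_def)
  have "1\<^sub>m N - mat_adjoint V * A * V = mat_adjoint V * (1\<^sub>m N - A) * V"
    using c by (simp add: minus_mult_distrib_mat[of _ N N _ _ N] mult_minus_distrib_mat[of _ N N _ N] assoc_mult_square[where n = N])
  then show ?thesis using assms psd_mat_conj[OF _ c(2)] by (simp add: effect_def)
qed

lemma tensor_power_conj:
  fixes W S :: "complex mat"
  assumes "W \<in> carrier_mat d d" "S \<in> carrier_mat d d" "d > 0"
  shows "tensor_power W n * tensor_power S n * mat_adjoint (tensor_power W n) = tensor_power (W * S * mat_adjoint W) n"
  using tensor_power_mult[OF mult_carrier_mat[OF assms(1,2)] mat_adjoint_carrier[OF assms(1)] assms(3), of n]
    tensor_power_mult[OF assms, of n] tensor_power_adjoint[OF assms(1), of n] by simp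

lemma outcome_prob_midpoint:
  assumes "A \<in> carrier_mat N N" "B \<in> carrier_mat N N" "S \<in> carrier_mat N N"
  shows "outcome_prob ((1/2) \<cdot>\<^sub>m (A + B)) S = (outcome_prob A S + outcome_prob B S) / 2"
proof -
  have c: "(1/2) \<cdot>\<^sub>m (A + B) \<in> carrier_mat N N" using assms by simp
  have h: "Re ((1/2 * (p + q)) * r) = (Re (p * r) + Re (q * r)) / 2" for p q r :: complex
    by (simp add: field_simps)
  have "outcome_prob ((1/2) \<cdot>\<^sub>m (A + B)) S
      = (\<Sum>i<N. \<Sum>j<N. (Re (A $$ (i, j) * S $$ (j, i)) + Re (B $$ (i, j) * S $$ (j, i))) / 2)"
    unfolding outcome_prob_entries[OF c assms(3)] h[symmetric]
    by (intro sum.cong refl) (use assms in auto)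
  also have "\<dots> = (outcome_prob A S + outcome_prob B S) / 2"
    by (simp only: outcome_prob_entries[OF assms(1,3)] outcome_prob_entries[OF assms(2,3)]
        sum.distrib sum_divide_distrib[symmetric])
  finally show ?thesis .
qed

text \<open>\<open>K\<close> consists of the effects meeting both thresholds on the whole unitary
  orbits of \<open>DA\<close> and \<open>DB\<close>. It is closed under midpoints, and under
  conjugation by tensor powers of unitaries because these only permute the orbits. An almost
  norm-minimal element of \<open>K\<close> is therefore almost invariant; the tolerance \<xi>/c,
  with c above the entry sums of all n-copy states from \<open>\<S>\<close>, turns this into
  closeness of outcome probabilities.\<close>

lemma almost_invariant_tester:
  fixes DA DB :: "complex mat"
  assumes "d > 0" "effect (d ^ n) M\<^sub>0" and D: "DA \<in> carrier_mat d d" "DB \<in> carrier_mat d d"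
    and acc: "\<And>U. unitary_mat d U \<Longrightarrow> outcome_prob M\<^sub>0 (tensor_power (U * DA * mat_adjoint U) n) \<ge> p"
    and rej: "\<And>U. unitary_mat d U \<Longrightarrow> outcome_prob M\<^sub>0 (tensor_power (U * DB * mat_adjoint U) n) \<le> q"
    and S: "finite \<S>" "\<S> \<subseteq> carrier_mat d d" and "\<xi> > 0"
  obtains M where "effect (d ^ n) M" "outcome_prob M (tensor_power DA n) \<ge> p" "outcome_prob M (tensor_power DB n) \<le> q"
    "\<And>W S. unitary_mat d W \<Longrightarrow> S \<in> \<S> \<Longrightarrow>
      \<bar>outcome_prob M (tensor_power (W * S * mat_adjoint W) n) - outcome_prob M (tensor_power S n)\<bar> \<le> \<xi>"
proof -
  let ?N = "d ^ n"
  define K where "K = {M. effect ?N M \<and> (\<forall>U. unitary_mat d U \<longrightarrow>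
      outcome_prob M (tensor_power (U * DA * mat_adjoint U) n) \<ge> p \<and> outcome_prob M (tensor_power (U * DB * mat_adjoint U) n) \<le> q)}"
  define G where "G = {tensor_power W n | W. unitary_mat d W}"
  define size where "size = (\<lambda>S. \<Sum>i<?N. \<Sum>j<?N. cmod (tensor_power S n $$ (i, j)))"
  define c where "c = 1 + (\<Sum>S\<in>\<S>. size S)"
  have size0: "size S \<ge> 0" for S by (auto simp: size_def intro!: sum_nonneg)
  have c: "c > 0" using sum_nonneg[of \<S> size] size0 by (simp add: c_def)
  have Kc: "K \<subseteq> carrier_mat ?N ?N" by (auto simp: K_def effect_def psd_mat_def)
  have conj_c: "U * S * mat_adjoint U \<in> carrier_mat d d" if "unitary_mat d U" "S \<in> carrier_mat d d" for U S
    using that by (auto simp: unitary_mat_def intro!: mult_carrier_mat[of _ d d _ d])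
  have tc: "tensor_power (U * S * mat_adjoint U) n \<in> carrier_mat ?N ?N" if "unitary_mat d U" "S \<in> carrier_mat d d" for U S
    by (rule tensor_power_carrier[OF conj_c[OF that]])
  have Wc: "W \<in> carrier_mat d d" if "unitary_mat d W" for W using that by (simp add: unitary_mat_def)
  obtain M where M: "M \<in> K" and fr: "\<And>V. V \<in> G \<Longrightarrow> frob2 (M - mat_adjoint V * M * V) \<le> (\<xi> / c)\<^sup>2"
  proof (rule exists_almost_invariant[of K ?N "(\<xi> / c)\<^sup>2" G])
    show "K \<noteq> {}" using assms(2) acc rej by (auto simp: K_def)
    show "(\<xi> / c)\<^sup>2 > 0" using c \<open>\<xi> > 0\<close> by simp
    show "(1/2) \<cdot>\<^sub>m (A + B) \<in> K" if "A \<in> K" "B \<in> K" for A B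
    proof -
      have ab: "A \<in> carrier_mat ?N ?N" "B \<in> carrier_mat ?N ?N" using that Kc by auto
      have "effect ?N ((1/2) \<cdot>\<^sub>m (A + B))" using that effect_midpoint by (simp add: K_def)
      moreover have "outcome_prob ((1/2) \<cdot>\<^sub>m (A + B)) (tensor_power (U * DA * mat_adjoint U) n) \<ge> p"
        "outcome_prob ((1/2) \<cdot>\<^sub>m (A + B)) (tensor_power (U * DB * mat_adjoint U) n) \<le> q" if U: "unitary_mat d U" for U
      proof -
        have "outcome_prob A (tensor_power (U * DA * mat_adjoint U) n) \<ge> p" "outcome_prob B (tensor_power (U * DA * mat_adjoint U) n) \<ge> p"
          "outcome_prob A (tensor_power (U * DB * mat_adjoint U) n) \<le> q" "outcome_prob B (tensor_power (U * DB * mat_adjoint U) n) \<le> q"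
          using \<open>A \<in> K\<close> \<open>B \<in> K\<close> U by (auto simp: K_def)
        then show "outcome_prob ((1/2) \<cdot>\<^sub>m (A + B)) (tensor_power (U * DA * mat_adjoint U) n) \<ge> p"
          "outcome_prob ((1/2) \<cdot>\<^sub>m (A + B)) (tensor_power (U * DB * mat_adjoint U) n) \<le> q"
          unfolding outcome_prob_midpoint[OF ab tc[OF U D(1)]] outcome_prob_midpoint[OF ab tc[OF U D(2)]] by simp_all
      qed
      ultimately show ?thesis by (simp add: K_def)
    qed
    show "mat_adjoint V * A * V \<in> K" if A: "A \<in> K" and V: "V \<in> G" for A V
    proof -
      obtain W where W: "unitary_mat d W" "V = tensor_power W n" using V by (auto simp: G_def)
      have uV: "unitary_mat ?N V" using unitary_mat_tensor_power[OF W(1) \<open>d > 0\<close>] W(2) by simp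
      have eq: "outcome_prob (mat_adjoint V * A * V) (tensor_power (U * S * mat_adjoint U) n)
         = outcome_prob A (tensor_power ((W * U) * S * mat_adjoint (W * U)) n)" if U: "unitary_mat d U" and S: "S \<in> carrier_mat d d" for U S
      proof -
        have "(W * U) * S * mat_adjoint (W * U) = W * (U * S * mat_adjoint U) * mat_adjoint W"
          using Wc[OF W(1)] Wc[OF U] S mat_adjoint_carrier[OF Wc[OF W(1)]] mat_adjoint_carrier[OF Wc[OF U]]
          by (simp add: mat_adjoint_mult assoc_mult_square[where n = d])
        then show ?thesis
          using outcome_prob_conj[of A ?N V "tensor_power (U * S * mat_adjoint U) n"] A Kc uV tc[OF U S]
            tensor_power_conj[OF Wc[OF W(1)] conj_c[OF U S] \<open>d > 0\<close>, of n]
          by (auto simp: unitary_mat_def W(2))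
      qed
      show ?thesis
        using A effect_conj[OF _ uV] eq[OF _ D(1)] eq[OF _ D(2)] unitary_mat_mult[OF W(1)] by (simp add: K_def)
    qed
    show "V \<in> carrier_mat ?N ?N \<and> V * mat_adjoint V = 1\<^sub>m ?N" if "V \<in> G" for V
      using that unitary_mat_tensor_power[OF _ \<open>d > 0\<close>, of _ n] by (auto simp: G_def unitary_mat_def)
  qed (use Kc that in auto)
  have Mc: "M \<in> carrier_mat ?N ?N" using M Kc by auto
  have "outcome_prob M (tensor_power (1\<^sub>m d * DA * mat_adjoint (1\<^sub>m d)) n) \<ge> p"
    "outcome_prob M (tensor_power (1\<^sub>m d * DB * mat_adjoint (1\<^sub>m d)) n) \<le> q"
    using M unitary_mat_one[of d] by (auto simp: K_def)
  then have "outcome_prob M (tensor_power DA n) \<ge> p" "outcome_prob M (tensor_power DB n) \<le> q"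
    using D by simp_all
  moreover have "\<bar>outcome_prob M (tensor_power (W * S * mat_adjoint W) n) - outcome_prob M (tensor_power S n)\<bar> \<le> \<xi>"
    if W: "unitary_mat d W" and SS: "S \<in> \<S>" for W S
  proof -
    let ?V = "tensor_power W n"
    have Sc: "S \<in> carrier_mat d d" using SS S by auto
    note St = tensor_power_carrier[OF Sc, of n]
    have Vc: "?V \<in> carrier_mat ?N ?N" by (rule tensor_power_carrier[OF Wc[OF W]])
    have VMV: "mat_adjoint ?V * M * ?V \<in> carrier_mat ?N ?N"
      using Vc Mc by (auto intro!: mult_carrier_mat[of _ ?N ?N _ ?N])
    have "outcome_prob M (tensor_power (W * S * mat_adjoint W) n) = outcome_prob (mat_adjoint ?V * M * ?V) (tensor_power S n)"
      using outcome_prob_conj[OF Mc Vc St] tensor_power_conj[OF Wc[OF W] Sc \<open>d > 0\<close>, of n] by simp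
    moreover have "\<bar>outcome_prob M (tensor_power S n) - outcome_prob (mat_adjoint ?V * M * ?V) (tensor_power S n)\<bar> \<le> \<xi> / c * size S"
      unfolding size_def
      by (rule outcome_prob_diff_le[OF Mc VMV St]) (use fr[of ?V] W c \<open>\<xi> > 0\<close> in \<open>auto simp: G_def\<close>)
    moreover have "\<xi> / c * size S \<le> \<xi>"
    proof -
      have "size S \<le> c" using member_le_sum[of S \<S> size] SS S(1) size0 by (simp add: c_def)
      then show ?thesis using c \<open>\<xi> > 0\<close> by (simp add: divide_le_eq mult_left_mono)
    qed
    ultimately show ?thesis by linarith
  qed
  ultimately show thesis using that[of M] M by (simp add: K_def)
qed

section \<open>States with a prescribed spectrum\<close>

lemma psd_dmat:
  assumes "\<And>i. i < d \<Longrightarrow> a i \<ge> 0"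
  shows "psd_mat d (dmat d a)"
proof -
  have "0 \<le> (dmat d a *\<^sub>v v) \<bullet>c v" if v: "v \<in> carrier_vec d" for v
  proof -
    have "(dmat d a *\<^sub>v v) $ i = complex_of_real (a i) * v $ i" if "i < d" for i
      using v that by (simp add: dmat_def scalar_prod_def atLeast0LessThan if_distrib[of "\<lambda>c. c * _"] cong: if_cong)
    then have "(dmat d a *\<^sub>v v) \<bullet>c v = (\<Sum>i<d. complex_of_real (a i) * (v $ i * cnj (v $ i)))"
      using v by (simp add: scalar_prod_def atLeast0LessThan mult.assoc del: index_mult_mat_vec)
    also have "\<dots> = complex_of_real (\<Sum>i<d. a i * (cmod (v $ i))\<^sup>2)"
      by (simp add: complex_norm_square del: of_real_power)
    finally show ?thesis using assms by (auto simp: less_eq_complex_def simp del: of_real_sum intro!: sum_nonneg)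
  qed
  then show ?thesis by (simp add: psd_mat_def)
qed

lemma quantum_state_conj_dmat:
  assumes "\<And>i. i < d \<Longrightarrow> a i \<ge> 0" "(\<Sum>i<d. a i) = 1" "unitary_mat d U"
  shows "quantum_state d (U * dmat d a * mat_adjoint U)"
proof -
  have c: "U \<in> carrier_mat d d" "mat_adjoint U \<in> carrier_mat d d"
    using assms(3) by (auto simp: unitary_mat_def)
  have "psd_mat d (U * dmat d a * mat_adjoint U)"
    using psd_mat_conj[OF psd_dmat[of d a] c(2)] assms(1) by simp
  moreover have "mat_trace (U * dmat d a * mat_adjoint U) = mat_trace (mat_adjoint U * (U * dmat d a))"
    by (rule mat_trace_comm[of _ d d]) (use c in auto)
  moreover have "mat_adjoint U * (U * dmat d a) = dmat d a"
    by (rule unitary_mat_cancel[OF assms(3)]) simp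
  moreover have "mat_trace (dmat d a) = complex_of_real (\<Sum>i<d. a i)"
    by (simp add: mat_trace_def dmat_def)
  ultimately show ?thesis using assms(2) by (simp add: quantum_state_def)
qed

lemma outcome_prob_complement:
  assumes M: "two_outcome_measurement (d ^ n) M\<^sub>1 M\<^sub>2" and \<rho>: "quantum_state d \<rho>" and "d > 0"
  shows "outcome_prob M\<^sub>1 (tensor_power \<rho> n) + outcome_prob M\<^sub>2 (tensor_power \<rho> n) = 1"
proof -
  have c: "M\<^sub>1 \<in> carrier_mat (d ^ n) (d ^ n)" "M\<^sub>2 \<in> carrier_mat (d ^ n) (d ^ n)" "M\<^sub>1 + M\<^sub>2 = 1\<^sub>m (d ^ n)"
    using M by (auto simp: two_outcome_measurement_def psd_mat_def)
  have \<rho>c: "\<rho> \<in> carrier_mat d d" "mat_trace \<rho> = 1" using \<rho> by (auto simp: quantum_state_def psd_mat_def)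
  note T = tensor_power_carrier[OF \<rho>c(1), of n]
  have "mat_trace (M\<^sub>1 * tensor_power \<rho> n) + mat_trace (M\<^sub>2 * tensor_power \<rho> n)
     = mat_trace (M\<^sub>1 * tensor_power \<rho> n + M\<^sub>2 * tensor_power \<rho> n)"
    using c T by (subst mat_trace_add[of _ "d ^ n"]) auto
  also have "M\<^sub>1 * tensor_power \<rho> n + M\<^sub>2 * tensor_power \<rho> n = tensor_power \<rho> n"
    using add_mult_distrib_mat[OF c(1,2) T] c(3) T by simp
  also have "mat_trace (tensor_power \<rho> n) = (\<Sum>i<d. \<rho> $$ (i, i)) ^ n"
    using T by (simp add: mat_trace_def tensor_power_trace[OF \<rho>c(1) \<open>d > 0\<close>])
  also have "\<dots> = 1" using \<rho>c by (simp add: mat_trace_def)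
  finally show ?thesis unfolding outcome_prob_def by (metis one_complex.simps(1) plus_complex.simps(1))
qed

lemma two_outcome_measurement_effect:
  assumes "two_outcome_measurement N M\<^sub>1 M\<^sub>2"
  shows "effect N M\<^sub>1"
proof -
  have c: "M\<^sub>1 \<in> carrier_mat N N" "M\<^sub>2 \<in> carrier_mat N N" "M\<^sub>1 + M\<^sub>2 = 1\<^sub>m N"
    using assms by (auto simp: two_outcome_measurement_def psd_mat_def)
  have "1\<^sub>m N - M\<^sub>1 = M\<^sub>2"
    unfolding c(3)[symmetric] using c(1,2) by (intro eq_matI) auto
  then show ?thesis using assms by (simp add: effect_def two_outcome_measurement_def)
qed

lemma card_block_spectrum_support:
  assumes "d = R + T * s" "s > 0"
  shows "card {x. x < d \<and> block_spectrum d R s (\<lambda>\<tau>. if \<tau> < T then a else b) x \<noteq> 0}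
    \<le> R + T * card {i. i < s \<and> a i \<noteq> 0}"
proof -
  let ?I = "{i. i < s \<and> a i \<noteq> 0}" and ?g = "\<lambda>(\<tau>, i). R + \<tau> * s + i"
  let ?S = "{x. x < d \<and> block_spectrum d R s (\<lambda>\<tau>. if \<tau> < T then a else b) x \<noteq> 0}"
  have "?S \<subseteq> {..<R} \<union> ?g ` ({..<T} \<times> ?I)"
  proof
    fix x assume x: "x \<in> ?S"
    show "x \<in> {..<R} \<union> ?g ` ({..<T} \<times> ?I)"
    proof (cases "x < R")
      case False
      note bi = block_index[OF assms(1) _ False]
      have "((x - R) div s, (x - R) mod s) \<in> {..<T} \<times> ?I"
        using x False bi by (auto simp: block_spectrum_def)
      moreover have "x = ?g ((x - R) div s, (x - R) mod s)"
        using False div_mult_mod_eq[of "x - R" s] by simp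
      ultimately show ?thesis by blast
    qed simp
  qed
  then have "card ?S \<le> card ({..<R} \<union> ?g ` ({..<T} \<times> ?I))"
    by (rule card_mono[rotated]) auto
  also have "\<dots> \<le> card {..<R} + card (?g ` ({..<T} \<times> ?I))" by (rule card_Un_le)
  also have "card (?g ` ({..<T} \<times> ?I)) \<le> card ({..<T} \<times> ?I)" by (rule card_image_le) auto
  finally show ?thesis by (simp add: card_cartesian_product)
qed

section \<open>Adding up the errors of all exchanges\<close>

lemma telescope_abs_le:
  fixes f :: "nat \<Rightarrow> real"
  assumes "\<And>t. t < T \<Longrightarrow> \<bar>f (Suc t) - f t\<bar> \<le> e"
  shows "\<bar>f T - f 0\<bar> \<le> real T * e"
  using assms
proof (induction T)
  case (Suc T)
  have "\<bar>f T - f 0\<bar> \<le> real T * e" "\<bar>f (Suc T) - f T\<bar> \<le> e" using Suc by auto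
  then show ?case by (simp add: distrib_right)
qed simp

text \<open>With L \<ge> \<beta>d/(4s) the ratio y is at most 8 s^4 n/(\<beta> d^2), and 1600 = 8 *
  200 yields y \<le> d^(-\<gamma>)/200. Then k\<gamma> \<ge> 2 gives y^k \<le> 1/(200 d^2), and this
  d^2 pays for T^2 after squaring, since Ts \<le> d.\<close>

lemma accumulated_error_bound:
  fixes d s L n T k :: nat and \<beta> \<gamma> :: real
  assumes d: "d > 0" and s: "s > 0" and \<beta>: "\<beta> > 0" and k: "real k * \<gamma> \<ge> 2" "k \<ge> 1" and \<gamma>: "\<gamma> > 0"
    and L: "real L \<ge> \<beta> * real d / (4 * real s)" and T: "real T * real s \<le> real d"
    and n: "real n < \<beta> / (1600 * real s ^ 4) * real d powr (2 - \<gamma>)"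
    and y: "y = 2 * (real s)\<^sup>2 * real s * real n / (real d * real L)"
  shows "y \<le> 1 / 2" "real T * sqrt (8 * real s * y ^ k) \<le> 1 / 5"
proof -
  have L0: "real L > 0"
  proof -
    have "\<beta> * real d / (4 * real s) > 0" using d s \<beta> by simp
    then show ?thesis using L by linarith
  qed
  have y0: "y \<ge> 0" unfolding y by simp
  have d1: "real d \<ge> 1" using d by simp
  have s1: "real s \<ge> 1" using s by simp
  have "y \<le> 2 * (real s)\<^sup>2 * real s * real n / (real d * (\<beta> * real d / (4 * real s)))"
    unfolding y using L d s \<beta> L0 by (intro divide_left_mono mult_left_mono mult_pos_pos) auto
  also have "\<dots> = 8 * real s ^ 4 / \<beta> / (real d)\<^sup>2 * real n"
    using d s \<beta> by (simp add: field_simps power2_eq_square power4_eq_xxxx)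
  also have "\<dots> \<le> 8 * real s ^ 4 / \<beta> / (real d)\<^sup>2 * (\<beta> / (1600 * real s ^ 4) * real d powr (2 - \<gamma>))"
    using n \<beta> by (intro mult_left_mono) auto
  also have "\<dots> = real d powr (2 - \<gamma>) / (real d)\<^sup>2 / 200"
    using s \<beta> by (simp add: field_simps)
  also have "real d powr (2 - \<gamma>) / (real d)\<^sup>2 = real d powr (- \<gamma>)"
  proof -
    have "real d powr (2 - \<gamma>) = real d powr 2 * real d powr (- \<gamma>)"
      using powr_add[of "real d" 2 "- \<gamma>"] by simp
    moreover have "real d powr 2 = (real d)\<^sup>2" using d by (simp add: powr_numeral)
    ultimately show ?thesis using d by simp
  qed
  finally have yb: "y \<le> real d powr (- \<gamma>) / 200" .
  have "real d powr (- \<gamma>) \<le> real d powr 0" using d1 \<gamma> by (intro powr_mono) auto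
  then show "y \<le> 1 / 2" using yb d by simp
  have "y ^ k \<le> (real d powr (- \<gamma>) / 200) ^ k" using yb y0 by (rule power_mono)
  also have "\<dots> = real d powr (- (real k * \<gamma>)) * (1 / 200) ^ k"
    using d by (simp add: power_divide powr_power mult.commute)
  also have "\<dots> \<le> real d powr (- 2) * (1 / 200) ^ 1"
    using d1 k by (intro mult_mono powr_mono power_decreasing) auto
  also have "real d powr (- 2) = 1 / (real d)\<^sup>2"
    using d by (simp add: powr_minus powr_numeral divide_inverse)
  finally have yk: "y ^ k \<le> 1 / (200 * (real d)\<^sup>2)" by simp
  have "(real T)\<^sup>2 * (8 * real s * y ^ k) \<le> (real T)\<^sup>2 * (8 * real s * (1 / (200 * (real d)\<^sup>2)))"
    using yk by (intro mult_left_mono) auto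
  also have "\<dots> = (real T)\<^sup>2 * real s * 1 / (25 * (real d)\<^sup>2)" by simp
  also have "\<dots> \<le> (real T)\<^sup>2 * real s * real s / (25 * (real d)\<^sup>2)"
    using s1 by (intro divide_right_mono mult_left_mono) auto
  also have "\<dots> = (real T * real s)\<^sup>2 / (25 * (real d)\<^sup>2)" by (simp add: power2_eq_square mult_ac)
  also have "\<dots> \<le> (real d)\<^sup>2 / (25 * (real d)\<^sup>2)"
    using T by (intro divide_right_mono power_mono) auto
  also have "\<dots> = (1 / 5)\<^sup>2" using d by (simp add: power2_eq_square)
  finally have "(real T)\<^sup>2 * (8 * real s * y ^ k) \<le> (1 / 5)\<^sup>2" .
  then have "sqrt ((real T)\<^sup>2 * (8 * real s * y ^ k)) \<le> sqrt ((1 / 5)\<^sup>2)"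
    by (rule real_sqrt_le_mono)
  then show "real T * sqrt (8 * real s * y ^ k) \<le> 1 / 5"
    by (simp add: real_sqrt_mult)
qed

theorem theorem1p4:
  fixes \<gamma> \<beta> :: real
  assumes "\<gamma> > 0" and "0 < \<beta>" and "\<beta> < 1"
  shows "\<exists>\<epsilon> > 0. \<exists>c > 0. \<exists>d\<^sub>0 :: nat. \<forall>d \<ge> d\<^sub>0. \<forall>n M_acc M_rej.
           rank_tester d n \<beta> \<epsilon> M_acc M_rej \<longrightarrow> real n \<ge> c * real d powr (2 - \<gamma>)"
proof -
  \<comment> \<open>The bound 2/\<gamma> makes y^k small against the squared number of exchanges; k
    \<ge> 2 puts the mean among the moments of order below k.\<close>
  define k where "k = max 2 (nat \<lceil>2 / \<gamma>\<rceil>)"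
  have "real k \<ge> 2 / \<gamma>" unfolding k_def by linarith
  then have k: "real k * \<gamma> \<ge> 2" "k \<ge> 2" "k \<ge> 1" using assms(1) by (auto simp: field_simps k_def)
  \<comment> \<open>The rank budget \<beta>d is split: \<beta>d/4 for the nonzero values in the
    blocks, \<beta>d/4 for the reservoir, and \<beta>d/2 to absorb its rounding excess of at most
    s.\<close>
  have eta: "\<beta> / 4 > 0" using assms(2) by simp
  obtain s :: nat and a b :: "nat \<Rightarrow> real" where s: "s > 0"
    and a0: "\<And>i. i < s \<Longrightarrow> a i \<ge> 0" and b0: "\<And>i. i < s \<Longrightarrow> b i > 0" and mean: "(\<Sum>i<s. a i) = real s"
    and moments: "\<And>m. m \<le> k \<Longrightarrow> (\<Sum>i<s. a i ^ m) = (\<Sum>i<s. b i ^ m)"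
    and few: "real (card {i. i < s \<and> a i \<noteq> 0}) \<le> \<beta> / 4 * real s"
    by (rule matched_values_exist[OF k(3) eta]) (rule that; simp)
  have meanb: "(\<Sum>i<s. b i) = real s" using moments[of 1] k(3) mean by simp
  \<comment> \<open>The 1 stands for the reservoir, so that bm/d bounds every eigenvalue of the far
    state from below.\<close>
  define bm where "bm = Min (insert 1 (b ` {..<s}))"
  have bm: "bm > 0" "bm \<le> 1" "\<And>i. i < s \<Longrightarrow> bm \<le> b i" using b0 by (auto simp: bm_def)
  \<comment> \<open>A state of rank at most \<beta>d misses at least (1 - \<beta>)d directions, each
    worth bm/d; half of the product is independent of d.\<close>
  define \<epsilon> where "\<epsilon> = bm * (1 - \<beta>) / 2"
  define c where "c = \<beta> / (1600 * real s ^ 4)"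
  define d\<^sub>0 where "d\<^sub>0 = nat \<lceil>2 * real s / \<beta>\<rceil> + 1"
  have "real n \<ge> c * real d powr (2 - \<gamma>)" if d\<^sub>0: "d \<ge> d\<^sub>0" and tester: "rank_tester d n \<beta> \<epsilon> M_acc M_rej" for d n M_acc M_rej
  proof (rule ccontr)
    assume "\<not> real n \<ge> c * real d powr (2 - \<gamma>)"
    then have n: "real n < \<beta> / (1600 * real s ^ 4) * real d powr (2 - \<gamma>)" by (simp add: c_def)
    have d: "d > 0" using d\<^sub>0 unfolding d\<^sub>0_def by linarith
    have "real d \<ge> 2 * real s / \<beta>" using d\<^sub>0 unfolding d\<^sub>0_def by linarith
    then have ds: "2 * real s \<le> \<beta> * real d" using assms(2) by (simp add: field_simps)
    \<comment> \<open>As many blocks as fit while at least \<beta>d/4 coordinates are left for the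
      reservoir.\<close>
    define T where "T = nat \<lfloor>(1 - \<beta> / 4) * real d / real s\<rfloor>"
    have q0: "(1 - \<beta> / 4) * real d / real s \<ge> 0" using assms by (intro divide_nonneg_nonneg mult_nonneg_nonneg) auto
    have "real T \<le> (1 - \<beta> / 4) * real d / real s" using q0 unfolding T_def by linarith
    then have T1: "real T * real s \<le> (1 - \<beta> / 4) * real d" using s by (simp add: field_simps)
    have "(1 - \<beta> / 4) * real d / real s < real T + 1" using q0 unfolding T_def by linarith
    then have T2: "(1 - \<beta> / 4) * real d < real T * real s + real s" using s by (simp add: field_simps)
    have T3: "real T * real s \<le> real d"
    proof -
      have "(1 - \<beta> / 4) * real d \<le> 1 * real d" using assms(2) by (intro mult_right_mono) auto
      then show ?thesis using T1 by simp
    qed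
    then have "T * s \<le> d" by (metis of_nat_le_iff of_nat_mult)
    then obtain R where R: "d = R + T * s" by (metis add.commute le_Suc_ex)
    have Rr: "real R = real d - real T * real s" using R by simp
    define \<mu> where "\<mu> = (\<lambda>t. block_spectrum d R s (hybrid a b t))"
    have \<mu>0: "\<mu> t x \<ge> 0" if "x < d" for t x
      unfolding \<mu>_def by (rule block_spectrum_nonneg[OF R that]) (use a0 b0 in \<open>auto simp: hybrid_def less_imp_le\<close>)
    have \<mu>1: "(\<Sum>x<d. \<mu> t x) = 1" for t
      unfolding \<mu>_def by (rule block_spectrum_sum[OF R d s]) (use mean meanb in \<open>auto simp: hybrid_def\<close>)
    have meas: "two_outcome_measurement (d ^ n) M_acc M_rej" using tester by (simp add: rank_tester_def)
    have accept: "outcome_prob M_acc (tensor_power (U * dmat d (\<mu> T) * mat_adjoint U) n) \<ge> 2 / 3" if U: "unitary_mat d U" for U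
    proof -
      have "real (vec_space.rank d (U * dmat d (\<mu> T) * mat_adjoint U)) \<le> real (card {x. x < d \<and> \<mu> T x \<noteq> 0})"
        using rank_conj_dmat_le U by (simp add: unitary_mat_def)
      also have "\<dots> \<le> real (R + T * card {i. i < s \<and> a i \<noteq> 0})"
        unfolding \<mu>_def hybrid_def by (rule of_nat_mono, rule card_block_spectrum_support[OF R s])
      also have "\<dots> \<le> real R + real T * (\<beta> / 4 * real s)"
        using mult_left_mono[OF few, of "real T"] by simp
      also have "\<dots> = real d - real T * real s + \<beta> / 4 * (real T * real s)" by (simp add: Rr)
      also have "\<dots> \<le> \<beta> * real d"
      proof -
        have "\<beta> / 4 * (real T * real s) \<le> \<beta> / 4 * real d" using T3 assms(2) by (intro mult_left_mono) auto
        moreover have "(1 - \<beta> / 4) * real d = real d - \<beta> / 4 * real d" by (simp add: algebra_simps)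
        ultimately show ?thesis using T2 ds by linarith
      qed
      finally have "low_rank_state d \<beta> (U * dmat d (\<mu> T) * mat_adjoint U)"
        using quantum_state_conj_dmat[OF \<mu>0 \<mu>1 U] by (simp add: low_rank_state_def)
      then show ?thesis using tester by (simp add: rank_tester_def)
    qed
    have reject: "outcome_prob M_acc (tensor_power (U * dmat d (\<mu> 0) * mat_adjoint U) n) \<le> 1 / 3" if U: "unitary_mat d U" for U
    proof -
      let ?\<rho> = "U * dmat d (\<mu> 0) * mat_adjoint U"
      have st: "quantum_state d ?\<rho>" by (rule quantum_state_conj_dmat[OF \<mu>0 \<mu>1 U])
      have low: "\<mu> 0 x \<ge> bm / real d" if "x < d" for x
        using bm block_index(2)[OF R that] by (auto simp: \<mu>_def block_spectrum_def hybrid_def divide_right_mono)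
      have "trace_distance ?\<rho> \<sigma> \<ge> \<epsilon>" if "low_rank_state d \<beta> \<sigma>" for \<sigma>
      proof -
        have \<sigma>: "\<sigma> \<in> carrier_mat d d" "mat_adjoint \<sigma> = \<sigma>" "real (vec_space.rank d \<sigma>) \<le> \<beta> * real d"
          using that by (auto simp: low_rank_state_def quantum_state_def psd_mat_def)
        have "\<epsilon> = bm / real d * (real d - \<beta> * real d) / 2" using d by (simp add: \<epsilon>_def field_simps)
        also have "\<dots> \<le> bm / real d * (real d - real (vec_space.rank d \<sigma>)) / 2"
          using \<sigma>(3) bm(1) by (intro divide_right_mono mult_left_mono) auto
        also have "\<dots> \<le> trace_distance ?\<rho> \<sigma>"
          by (rule trace_distance_lower_bound[OF U low _ \<sigma>(1,2)]) (use bm in auto)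
        finally show ?thesis .
      qed
      then have "far_from_low_rank d \<beta> \<epsilon> ?\<rho>" using st by (simp add: far_from_low_rank_def)
      then have "outcome_prob M_rej (tensor_power ?\<rho> n) \<ge> 2 / 3" using tester by (simp add: rank_tester_def)
      then show ?thesis using outcome_prob_complement[OF meas st d] by linarith
    qed
    \<comment> \<open>The T exchanges lose 2\<xi> each through approximate invariance, at most 1/10
      in all. Together with 1/5 from the chi-square bounds this stays below the gap 1/3 between the
      two thresholds.\<close>
    define \<xi> where "\<xi> = 1 / (20 * (real T + 1))"
    have "\<xi> > 0" by (simp add: \<xi>_def)
    obtain M where M: "effect (d ^ n) M"
      and MT: "outcome_prob M (tensor_power (dmat d (\<mu> T)) n) \<ge> 2 / 3"
      and M0: "outcome_prob M (tensor_power (dmat d (\<mu> 0)) n) \<le> 1 / 3"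
      and inv: "\<And>W S. unitary_mat d W \<Longrightarrow> S \<in> (\<lambda>t. dmat d (\<mu> t)) ` {..T} \<Longrightarrow>
        \<bar>outcome_prob M (tensor_power (W * S * mat_adjoint W) n) - outcome_prob M (tensor_power S n)\<bar> \<le> \<xi>"
      by (rule almost_invariant_tester[OF d two_outcome_measurement_effect[OF meas] dmat_carrier dmat_carrier accept reject,
            of "(\<lambda>t. dmat d (\<mu> t)) ` {..T}" \<xi>]) (use \<open>\<xi> > 0\<close> in auto)
    define y where "y = 2 * (real s)\<^sup>2 * real s * real n / (real d * real (R div s + 1))"
    have L: "real (R div s + 1) \<ge> \<beta> * real d / (4 * real s)"
    proof -
      have "R < (R div s + 1) * s" using s by (metis add.commute dividend_less_div_times mult.commute plus_1_eq_Suc mult_Suc_right mult_Suc)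
      then have "real R \<le> real (R div s + 1) * real s" by (metis less_imp_le of_nat_le_iff of_nat_mult)
      moreover have "\<beta> / 4 * real d \<le> real R"
        using T1 by (simp add: Rr algebra_simps)
      ultimately show ?thesis using s by (simp add: field_simps)
    qed
    note err = accumulated_error_bound[OF d s assms(2) k(1,3) assms(1) L T3 n y_def]
    have "\<bar>outcome_prob M (tensor_power (dmat d (\<mu> T)) n) - outcome_prob M (tensor_power (dmat d (\<mu> 0)) n)\<bar>
        \<le> real T * (2 * \<xi> + sqrt (8 * real s * y ^ k))"
    proof (rule telescope_abs_le[of T "\<lambda>t. outcome_prob M (tensor_power (dmat d (\<mu> t)) n)"])
      fix t assume t: "t < T"
      show "\<bar>outcome_prob M (tensor_power (dmat d (\<mu> (Suc t))) n) - outcome_prob M (tensor_power (dmat d (\<mu> t)) n)\<bar>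
         \<le> 2 * \<xi> + sqrt (8 * real s * y ^ k)"
        unfolding \<mu>_def
      proof (rule hybrid_step[OF R d s t a0 less_imp_le[OF b0] mean _ k(2) M _ y_def err(1)])
        show "(\<Sum>i<s. a i ^ m) = (\<Sum>i<s. b i ^ m)" if "m < k" for m using moments that by simp
        show "\<bar>outcome_prob M (tensor_power (W * dmat d (block_spectrum d R s (hybrid a b t')) * mat_adjoint W) n)
          - outcome_prob M (tensor_power (dmat d (block_spectrum d R s (hybrid a b t'))) n)\<bar> \<le> \<xi>"
          if "t' \<in> {t, Suc t}" "unitary_mat d W" for t' W
          using inv[OF that(2), of "dmat d (\<mu> t')"] that(1) t unfolding \<mu>_def by auto
      qed
    qed
    also have "\<dots> = 2 * real T * \<xi> + real T * sqrt (8 * real s * y ^ k)" by (simp add: algebra_simps)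
    also have "\<dots> \<le> 1 / 10 + 1 / 5"
    proof -
      have "2 * real T * \<xi> \<le> 1 / 10" by (simp add: \<xi>_def divide_le_eq)
      then show ?thesis using err(2) by linarith
    qed
    finally show False using MT M0 by linarith
  qed
  moreover have "\<epsilon> > 0" using bm assms by (simp add: \<epsilon>_def)
  moreover have "c > 0" using s assms by (simp add: c_def)
  ultimately show ?thesis by blast
qed

end
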